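(* Let $n\ge3$ and let $M\subset\mathbb{R}^n$ be a convex body with empty interior, so that $M-M\subset w^\perp$ for some $w\in S^{n-1}$. Let $K,L\subset\mathbb{R}^n$ be arbitrary convex bodies with $\mathsf{V}(L,L,M,\ldots,M)>0$. Then $$\mathsf{V}(K,L,M,\ldots,M)^2=\mathsf{V}(K,K,M,\ldots,M)\,\mathsf{V}(L,L,M,\ldots,M)$$ holds if and only if $\tilde L:=\frac{\mathsf{V}(K,L,M,\ldots,M)}{\mathsf{V}(L,L,M,\ldots,M)}L$ satisfies that $K+F(\tilde L,w)$ and $\tilde L+F(K,w)$ have the same supporting hyperplanes in all $1$-extreme normal directions of $M$.
   Context: A convex body is a nonempty compact convex subset of $\mathbb{R}^n$. Mixed volumes are the symmetric coefficients in $\mathrm{Vol}(\lambda_1K_1+\cdots+\lambda_mK_m)=\sum_{i_1,\ldots,i_n}\mathsf{V}(K_{i_1},\ldots,K_{i_n})\lambda_{i_1}\cdots\lambda_{i_n}$ ($\lambda_i\ge0$); in $\mathsf{V}(K,L,M,\ldots,M)$ the body $M$ appears $n-2$ times. For $u\ne0$, $F(K,u)$ denotes the face of $K$ with outer normal $u$; the supporting hyperplane of $K$ in direction $u$ is $F(K,u)+u^\perp$. A vector $u\ne 0$ is a $1$-extreme normal vector of $M$ if there do not exist linearly independent normal vectors $u_1,u_2,u_3$ of $M$ at a common boundary point of $M$ with $u=u_1+u_2+u_3$. *)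

theory Defs
  imports "HOL-Analysis.Analysis" "HOL-Library.Set_Algebras"
begin

definition convex_body :: "('a::euclidean_space) set \<Rightarrow> bool" where
  "convex_body K \<longleftrightarrow> K \<noteq> {} \<and> compact K \<and> convex K"

text \<open>Characterising property of mixed volumes (as in the paper): V is symmetric,
  and for all finite families of convex bodies and nonnegative coefficients
  Vol(l_1 K_1 + ... + l_m K_m) = sum over index tuples (i_1..i_n) of
  V(K_i1,...,K_in) l_i1 ... l_in.  To make V unique we let it be 0 on
  arguments that are not lists of n = DIM('a) convex bodies.\<close>
definition is_mixed_volume :: "('a::euclidean_space set list \<Rightarrow> real) \<Rightarrow> bool" where
  "is_mixed_volume V \<longleftrightarrow>
     (\<forall>Ks. \<not> (length Ks = DIM('a) \<and> (\<forall>K\<in>set Ks. convex_body K)) \<longrightarrow> V Ks = 0) \<and>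
     (\<forall>Ks Ls. mset Ks = mset Ls \<longrightarrow> V Ks = V Ls) \<and>
     (\<forall>(m::nat) (K::nat \<Rightarrow> 'a set) (l::nat \<Rightarrow> real).
        (\<forall>i<m. convex_body (K i) \<and> 0 \<le> l i) \<longrightarrow>
        measure lebesgue (\<Sum>i<m. (\<lambda>x. l i *\<^sub>R x) ` K i) =
          (\<Sum>is\<in>{is. length is = DIM('a) \<and> set is \<subseteq> {..<m}}.
              V (map K is) * prod_list (map l is)))"

definition mixed_volume :: "'a::euclidean_space set list \<Rightarrow> real" where
  "mixed_volume = (THE V. is_mixed_volume V)"

definition V2 :: "'a::euclidean_space set \<Rightarrow> 'a set \<Rightarrow> 'a set \<Rightarrow> real" where
  "V2 K L M = mixed_volume (K # L # replicate (DIM('a) - 2) M)"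

definition face_dir :: "'a::euclidean_space set \<Rightarrow> 'a \<Rightarrow> 'a set" where
  "face_dir K u = {x \<in> K. \<forall>y\<in>K. inner y u \<le> inner x u}"

definition supp_hyperplane :: "'a::euclidean_space set \<Rightarrow> 'a \<Rightarrow> 'a set" where
  "supp_hyperplane K u = face_dir K u + {x. inner x u = 0}"

definition normal_at :: "'a::euclidean_space set \<Rightarrow> 'a \<Rightarrow> 'a \<Rightarrow> bool" where
  "normal_at M x u \<longleftrightarrow> u \<noteq> 0 \<and> x \<in> M \<and> (\<forall>y\<in>M. inner y u \<le> inner x u)"

definition one_extreme_normal :: "'a::euclidean_space set \<Rightarrow> 'a \<Rightarrow> bool" where
  "one_extreme_normal M u \<longleftrightarrow> u \<noteq> 0 \<and>
     \<not> (\<exists>x\<in>frontier M. \<exists>u1 u2 u3.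
           normal_at M x u1 \<and> normal_at M x u2 \<and> normal_at M x u3 \<and>
           u1 \<noteq> u2 \<and> u1 \<noteq> u3 \<and> u2 \<noteq> u3 \<and> independent {u1, u2, u3} \<and>
           u = u1 + u2 + u3)"

end

theory Submission
  imports Defs "HOL-Computational_Algebra.Polynomial"
begin

text \<open>
  Slices orthogonal to \<open>w\<close> turn the theorem into a statement about concave functions of one variable.
  As \<open>M\<close> lies in the hyperplane orthogonal to \<open>w\<close>, \<open>V2 K K M\<close> is the integral over \<open>s\<close> of a functional
  \<open>\<phi>\<close> of the slice \<open>K\<^sub>s\<close> at height \<open>s\<close>; up to a constant, \<open>\<phi>\<close> is the mixed volume with copies of \<open>M\<close>
  within the hyperplane, hence additive and monotone. If \<open>K\<close> and \<open>L\<close> have the same width in direction \<open>w\<close>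
  (and lowest height \<open>0\<close>), then \<open>(K + L)\<close> at height \<open>2s\<close> contains \<open>K\<^sub>s + L\<^sub>s\<close>, and integration yields
  \<open>V2 K K M + V2 L L M \<le> 2 * V2 K L M\<close>. After rescaling \<open>K\<close>, this and the inequality between the means
  give Minkowski's inequality. Equality means that \<open>\<phi>\<close> does not distinguish these slices. Now \<open>\<phi>\<close> sees
  exactly the support function in the extreme normal directions \<open>v\<close> of \<open>M\<close> within the hyperplane, so
  equality means that the concave functions \<open>s \<mapsto> h(K\<^sub>s, v)\<close> and \<open>s \<mapsto> h(L\<^sub>s, v)\<close> have the same
  increments. The 1-extreme normal directions of \<open>M\<close> are the directions in the half-planes spanned by
  such \<open>v\<close> and the line of \<open>w\<close>, and dualising the concave functions gives the stated condition.

  The extreme normal directions are the extreme points of the polar body, so the claim about \<open>\<phi>\<close>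
  rests on the Krein-Milman theorem: it yields outer polytopes of \<open>M\<close> with facet normals among them, and,
  conversely, near each of them a body larger than \<open>M\<close> with the same supporting hyperplanes elsewhere.

  Mixed volumes exist because the sum of the polytopes with vertex sets \<open>V\<^sub>i\<close> and weights \<open>\<lambda>\<^sub>i\<close> is,
  up to its boundary, the image of the gradient of \<open>\<Sum>\<^sub>i \<lambda>\<^sub>i ln (\<Sum>v\<in>V\<^sub>i. exp (x \<bullet> v))\<close>; its volume is thus
  the integral of a determinant, which is polynomial in the weights.
\<close>

text \<open>The description operator behind \<open>mixed_volume\<close> says nothing before
  existence and uniqueness are known, hence the long study of volumes. Surface area measures do not
  appear: a unit segment along \<open>w\<close> is added to each flat body, which turns mixed
  volumes within the hyperplane into mixed volumes of the whole space, and the finer properties of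
  \<phi> are read off from the growth of \<open>vol (A + J + dilate t M)\<close> at order
  \<open>t ^ (n - 2)\<close>. The dimension of \<open>M\<close> decides which directions \<phi>
  sees. If \<open>M\<close> spans the hyperplane, they are the extreme points of the polar body. If
  \<open>M\<close> is orthogonal to a further unit vector \<open>e\<close>, then \<phi> is a
  multiple of the width along \<open>e\<close>, and \<open>e\<close> and \<open>- e\<close> take
  over. If there is yet another such direction, \<phi> vanishes, which \<open>V2 L L M > 0\<close>
  excludes. The factor in the statement is forced: in the case of equality it must be the quotient
  of the widths of \<open>K\<close> and \<open>L\<close> along \<open>w\<close>, and this is what
  the support condition says in the direction \<open>- w\<close>.\<close>

abbreviation vol :: "'a::euclidean_space set \<Rightarrow> real"
  where "vol \<equiv> measure lebesgue"

abbreviation dilate :: "real \<Rightarrow> 'a::real_vector set \<Rightarrow> 'a set"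
  where "dilate c X \<equiv> (\<lambda>x. c *\<^sub>R x) ` X"

section \<open>Closure properties of convex bodies\<close>

lemma compact_set_plus:
  fixes A B :: "'a::real_normed_vector set"
  assumes "compact A" "compact B"
  shows "compact (A + B)"
proof -
  have "A + B = {x + y | x y. x \<in> A \<and> y \<in> B}"
    by (auto simp: set_plus_def)
  then show ?thesis
    using compact_sums[OF assms] by simp
qed

lemma convex_body_plus:
  assumes "convex_body A" "convex_body B"
  shows "convex_body (A + B)"
  using assms by (simp add: convex_body_def compact_set_plus convex_set_plus) (auto simp: set_plus_def)

lemma convex_body_dilate:
  assumes "convex_body A"
  shows "convex_body (dilate c A)"
  using assms by (auto simp: convex_body_def compact_scaling convex_scaling)

lemma convex_body_singleton [simp]: "convex_body {x}"
  by (simp add: convex_body_def)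

lemma convex_body_sum:
  assumes "\<And>i. i \<in> I \<Longrightarrow> convex_body (A i)"
  shows "convex_body (sum A I)"
  using assms by (induction I rule: infinite_finite_induct) (auto simp: convex_body_plus)

lemma convex_body_lmeasurable: "convex_body A \<Longrightarrow> A \<in> lmeasurable"
  by (simp add: convex_body_def lmeasurable_compact)

subsection \<open>Volumes of Minkowski sums of polytopes\<close>

text \<open>\<open>softmax V\<close> is the gradient of \<open>\<lambda>x. ln (softmax_weight V x)\<close>, a smooth substitute for the support
  function of the convex hull of \<open>V\<close>.\<close>

definition softmax_weight :: "'a::euclidean_space set \<Rightarrow> 'a \<Rightarrow> real" where
  "softmax_weight V x = (\<Sum>v\<in>V. exp (x \<bullet> v))"

definition softmax :: "'a::euclidean_space set \<Rightarrow> 'a \<Rightarrow> 'a" where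
  "softmax V x = (1 / softmax_weight V x) *\<^sub>R (\<Sum>v\<in>V. exp (x \<bullet> v) *\<^sub>R v)"

text \<open>The Hessian of the logarithm of \<open>softmax_weight V\<close>: the covariance operator
  of the vertices under the probabilities
  \<open>exp (x \<bullet> v) / softmax_weight V x\<close>.\<close>

definition softmax_deriv :: "'a::euclidean_space set \<Rightarrow> 'a \<Rightarrow> 'a \<Rightarrow> 'a" where
  "softmax_deriv V x h =
     (1 / softmax_weight V x) *\<^sub>R (\<Sum>v\<in>V. (exp (x \<bullet> v) * (h \<bullet> v)) *\<^sub>R v)
     - (softmax V x \<bullet> h) *\<^sub>R softmax V x"

lemma softmax_weight_pos: "finite V \<Longrightarrow> V \<noteq> {} \<Longrightarrow> softmax_weight V x > 0"
  unfolding softmax_weight_def by (intro sum_pos) auto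

lemma softmax_weight_has_derivative:
  "(softmax_weight V has_derivative (\<lambda>h. \<Sum>v\<in>V. exp (x \<bullet> v) * (h \<bullet> v))) (at x)"
  unfolding softmax_weight_def[abs_def]
  by (rule has_derivative_eq_rhs, (rule derivative_intros)+) (simp add: mult.commute)

lemma softmax_inner:
  "softmax V x \<bullet> h = (\<Sum>v\<in>V. exp (x \<bullet> v) * (h \<bullet> v)) / softmax_weight V x"
  by (simp add: softmax_def inner_sum_left inner_commute[of h])

lemma softmax_has_derivative:
  assumes V: "finite V" "V \<noteq> {}"
  shows "(softmax V has_derivative softmax_deriv V x) (at x)"
proof -
  let ?Z = "softmax_weight V" and ?N = "\<lambda>x. \<Sum>v\<in>V. exp (x \<bullet> v) *\<^sub>R v"
  have Z: "?Z x \<noteq> 0" using softmax_weight_pos[OF V, of x] by simp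
  have N: "(?N has_derivative (\<lambda>h. \<Sum>v\<in>V. (exp (x \<bullet> v) * (h \<bullet> v)) *\<^sub>R v)) (at x)"
    by (rule has_derivative_eq_rhs, (rule derivative_intros)+) (simp add: mult.commute)
  have I: "((\<lambda>x. 1 / ?Z x) has_derivative
      (\<lambda>h. - (\<Sum>v\<in>V. exp (x \<bullet> v) * (h \<bullet> v)) / (?Z x * ?Z x))) (at x)"
    using has_derivative_divide'[OF has_derivative_const softmax_weight_has_derivative Z, of 1]
    by simp
  show ?thesis
    unfolding softmax_def[abs_def]
    apply (rule has_derivative_eq_rhs[OF has_derivative_scaleR[OF I N]])
    apply (simp add: fun_eq_iff softmax_deriv_def softmax_inner)
    apply (simp add: softmax_def divide_inverse mult.commute mult.left_commute)
    done
qed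

lemma ln_softmax_weight_has_derivative:
  assumes V: "finite V" "V \<noteq> {}"
  shows "((\<lambda>x. ln (softmax_weight V x)) has_derivative (\<lambda>h. softmax V x \<bullet> h)) (at x)"
  by (rule has_derivative_eq_rhs,
      rule has_derivative_ln[OF softmax_weight_pos[OF V] softmax_weight_has_derivative])
    (simp add: softmax_inner divide_inverse)

lemma softmax_in_hull:
  assumes V: "finite V" "V \<noteq> {}"
  shows "softmax V x \<in> convex hull V"
proof -
  have "(\<Sum>v\<in>V. (exp (x \<bullet> v) / softmax_weight V x) *\<^sub>R v) \<in> convex hull V"
  proof (rule convex_sum)
    show "(\<Sum>v\<in>V. exp (x \<bullet> v) / softmax_weight V x) = 1"
      using softmax_weight_pos[OF V, of x]
      by (simp add: softmax_weight_def flip: sum_divide_distrib)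
  qed (use V softmax_weight_pos[OF V, of x] in \<open>auto simp: hull_inc less_imp_le\<close>)
  then show ?thesis
    by (simp add: softmax_def scaleR_sum_right)
qed

text \<open>The soft maximum dominates the true one, because the term of each vertex occurs in the
  sum.\<close>

lemma inner_le_ln_softmax_weight:
  assumes V: "finite V" and q: "q \<in> convex hull V"
  shows "q \<bullet> x \<le> ln (softmax_weight V x)"
proof -
  have "V \<noteq> {}" using q by auto
  have "convex hull V \<subseteq> {q. x \<bullet> q \<le> ln (softmax_weight V x)}"
  proof (rule hull_minimal)
    show "V \<subseteq> {q. x \<bullet> q \<le> ln (softmax_weight V x)}"
    proof
      fix v assume v: "v \<in> V"
      have "exp (x \<bullet> v) \<le> softmax_weight V x"
        unfolding softmax_weight_def using V v by (intro member_le_sum) auto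
      then show "v \<in> {q. x \<bullet> q \<le> ln (softmax_weight V x)}"
        using ln_ge_iff[OF softmax_weight_pos[OF V \<open>V \<noteq> {}\<close>]] by simp
    qed
  qed (simp add: convex_halfspace_le)
  then show ?thesis using q by (auto simp: inner_commute)
qed

lemma softmax_deriv_variance:
  assumes V: "finite V" "V \<noteq> {}"
  shows "h \<bullet> softmax_deriv V x h =
    (\<Sum>v\<in>V. exp (x \<bullet> v) * (h \<bullet> v - softmax V x \<bullet> h)\<^sup>2) / softmax_weight V x"
proof -
  let ?Z = "softmax_weight V x" and ?m = "softmax V x \<bullet> h"
  have Z: "?Z \<noteq> 0" using softmax_weight_pos[OF V, of x] by simp
  have m: "(\<Sum>v\<in>V. exp (x \<bullet> v) * (h \<bullet> v)) = ?m * ?Z"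
    using Z by (simp add: softmax_inner)
  have "(\<Sum>v\<in>V. exp (x \<bullet> v) * (h \<bullet> v - ?m)\<^sup>2) =
     (\<Sum>v\<in>V. exp (x \<bullet> v) * (h \<bullet> v)\<^sup>2 - 2 * ?m * (exp (x \<bullet> v) * (h \<bullet> v)) + ?m\<^sup>2 * exp (x \<bullet> v))"
    by (intro sum.cong) (auto simp: power2_eq_square algebra_simps)
  also have "\<dots> = (\<Sum>v\<in>V. exp (x \<bullet> v) * (h \<bullet> v)\<^sup>2) - 2 * ?m * (?m * ?Z) + ?m\<^sup>2 * ?Z"
    by (simp add: sum.distrib sum_subtractf sum_distrib_left[symmetric] m softmax_weight_def[symmetric])
  finally have "(\<Sum>v\<in>V. exp (x \<bullet> v) * (h \<bullet> v - ?m)\<^sup>2) / ?Z = (\<Sum>v\<in>V. exp (x \<bullet> v) * (h \<bullet> v)\<^sup>2) / ?Z - ?m\<^sup>2"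
    using Z by (simp add: field_simps power2_eq_square)
  then show ?thesis
    by (simp add: softmax_deriv_def inner_diff_right inner_sum_right inner_commute[of h "softmax V x"]
        power2_eq_square mult.assoc)
qed

text \<open>The quadratic form is a variance. If it vanished, all vertices would lie in one
  hyperplane orthogonal to \<open>h\<close>.\<close>

lemma softmax_deriv_pos:
  assumes V: "finite V" and int: "interior (convex hull V) \<noteq> {}" and h: "h \<noteq> 0"
  shows "h \<bullet> softmax_deriv V x h > 0"
proof -
  have V0: "V \<noteq> {}" using int by auto
  have "\<exists>v\<in>V. h \<bullet> v \<noteq> softmax V x \<bullet> h"
  proof (rule ccontr)
    assume "\<not> ?thesis"
    then have "convex hull V \<subseteq> {y. h \<bullet> y = softmax V x \<bullet> h}"
      by (intro hull_minimal) (auto simp: convex_hyperplane)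
    then show False
      using int interior_mono interior_hyperplane[OF h] by blast
  qed
  then obtain v where v: "v \<in> V" "h \<bullet> v \<noteq> softmax V x \<bullet> h" by blast
  then have "(\<Sum>v\<in>V. exp (x \<bullet> v) * (h \<bullet> v - softmax V x \<bullet> h)\<^sup>2) > 0"
    using V by (intro sum_pos2[of _ v]) auto
  then show ?thesis
    using softmax_weight_pos[OF V V0, of x] by (simp add: softmax_deriv_variance[OF V V0])
qed

text \<open>Weights may vanish, but one positive weight already makes the derivative of
  \<open>G\<close> positive definite.\<close>

locale polytope_family =
  fixes I :: "'i set" and V :: "'i \<Rightarrow> 'a::euclidean_space set" and l :: "'i \<Rightarrow> real"
  assumes fin_I: "finite I" and fin_V: "\<And>i. i \<in> I \<Longrightarrow> finite (V i)"
    and int_V: "\<And>i. i \<in> I \<Longrightarrow> interior (convex hull V i) \<noteq> {}"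
    and l_nonneg: "\<And>i. i \<in> I \<Longrightarrow> 0 \<le> l i" and l_pos: "\<exists>i\<in>I. 0 < l i"
begin

definition G where "G x = (\<Sum>i\<in>I. l i *\<^sub>R softmax (V i) x)"
definition G' where "G' x h = (\<Sum>i\<in>I. l i *\<^sub>R softmax_deriv (V i) x h)"
definition S where "S = (\<Sum>i\<in>I. dilate (l i) (convex hull V i))"

lemma V_nonempty: "i \<in> I \<Longrightarrow> V i \<noteq> {}"
  using int_V by fastforce

lemma convex_body_S: "convex_body S"
  unfolding S_def using fin_V V_nonempty
  by (intro convex_body_sum convex_body_dilate)
    (auto simp: convex_body_def finite_imp_compact_convex_hull)

lemma G_deriv: "(G has_derivative G' x) (at x)"
  unfolding G_def[abs_def] G'_def[abs_def] using fin_V V_nonempty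
  by (intro has_derivative_sum has_derivative_scaleR_right softmax_has_derivative) auto

lemma G'_pos:
  assumes "h \<noteq> 0"
  shows "h \<bullet> G' x h > 0"
proof -
  obtain i where i: "i \<in> I" "l i > 0" using l_pos by blast
  have "(\<Sum>i\<in>I. l i * (h \<bullet> softmax_deriv (V i) x h)) > 0"
    using softmax_deriv_pos[OF fin_V int_V assms] i fin_I l_nonneg
    by (intro sum_pos2[of _ i]) (auto simp: less_imp_le)
  then show ?thesis by (simp add: G'_def inner_sum_right)
qed

text \<open>On the line through two points, the component of \<open>G\<close> along the line is
  strictly increasing, since the derivative is positive definite.\<close>

lemma inj_G: "inj G"
proof (rule injI, rule ccontr)
  fix x y assume eq: "G x = G y" and "x \<noteq> y"
  define h where "h = y - x"
  have h: "h \<noteq> 0" using \<open>x \<noteq> y\<close> by (simp add: h_def)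
  have "((\<lambda>t. h \<bullet> G (x + t *\<^sub>R h)) has_real_derivative h \<bullet> G' (x + t *\<^sub>R h) h) (at t)" for t
  proof -
    have "((\<lambda>t. x + t *\<^sub>R h) has_derivative (\<lambda>s. s *\<^sub>R h)) (at t)"
      by (auto intro!: derivative_eq_intros)
    from has_derivative_compose[OF this G_deriv]
    have "((\<lambda>t. h \<bullet> G (x + t *\<^sub>R h)) has_derivative (\<lambda>s. h \<bullet> G' (x + t *\<^sub>R h) (s *\<^sub>R h))) (at t)"
      by (rule has_derivative_inner_right)
    moreover have "G' (x + t *\<^sub>R h) (s *\<^sub>R h) = s *\<^sub>R G' (x + t *\<^sub>R h) h" for s
      using linear_cmul[OF has_derivative_linear[OF G_deriv]] .
    ultimately show ?thesis
      by (simp add: has_field_derivative_def mult.commute[of _ "h \<bullet> _"] fun_eq_iff)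
  qed
  from DERIV_pos_imp_increasing[OF zero_less_one, of "\<lambda>t. h \<bullet> G (x + t *\<^sub>R h)"] this G'_pos[OF h]
  have "h \<bullet> G (x + 0 *\<^sub>R h) < h \<bullet> G (x + 1 *\<^sub>R h)" by blast
  then show False using eq by (simp add: h_def)
qed

lemma range_G: "range G \<subseteq> S"
proof
  fix y assume "y \<in> range G"
  then obtain x where x: "y = G x" by auto
  have "\<forall>i\<in>I. l i *\<^sub>R softmax (V i) x \<in> dilate (l i) (convex hull V i)"
    by (intro ballI imageI softmax_in_hull fin_V V_nonempty)
  then show "y \<in> S"
    unfolding x G_def S_def set_sum_alt[OF fin_I] by blast
qed

text \<open>For \<open>y\<close> in the interior, \<open>\<lambda>x. (\<Sum>i\<in>I. l i * ln (softmax_weight (V i) x)) - x \<bullet> y\<close> is coercive,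
  and its gradient \<open>G x - y\<close> vanishes at a minimiser.\<close>

lemma interior_S_subset: "interior S \<subseteq> range G"
proof
  fix y assume "y \<in> interior S"
  then obtain r where r: "r > 0" "cball y r \<subseteq> S" using mem_interior_cball by blast
  define \<Phi> where "\<Phi> x = (\<Sum>i\<in>I. l i * ln (softmax_weight (V i) x)) - y \<bullet> x" for x
  have D: "(\<Phi> has_derivative (\<lambda>h. (G x - y) \<bullet> h)) (at x)" for x
  proof -
    have "((\<lambda>x. (\<Sum>i\<in>I. l i *\<^sub>R ln (softmax_weight (V i) x)) - y \<bullet> x) has_derivative
      (\<lambda>h. (\<Sum>i\<in>I. l i *\<^sub>R (softmax (V i) x \<bullet> h)) - y \<bullet> h)) (at x)"
      using fin_V V_nonempty
      by (intro has_derivative_diff has_derivative_sum has_derivative_scaleR_right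
          ln_softmax_weight_has_derivative has_derivative_inner_right has_derivative_ident) auto
    then show ?thesis
      by (simp add: \<Phi>_def[abs_def] G_def inner_diff_left inner_sum_left)
  qed
  have coercive: "\<Phi> x \<ge> r * norm x" for x
  proof (cases "x = 0")
    case False
    \<comment> \<open>The point of the ball in \<open>S\<close> that is farthest in direction
      \<open>x\<close>. Splitting it along the Minkowski sum bounds the logarithmic part of \<Phi>
      from below by \<open>z \<bullet> x\<close>.\<close>
    define z where "z = y + (r / norm x) *\<^sub>R x"
    have "z \<in> S" using r False by (intro subsetD[OF r(2)]) (auto simp: z_def dist_norm)
    then obtain s where s: "z = sum s I" "\<forall>i\<in>I. s i \<in> dilate (l i) (convex hull V i)"
      unfolding S_def set_sum_alt[OF fin_I] by blast
    have "z \<bullet> x = (\<Sum>i\<in>I. s i \<bullet> x)" by (simp add: s inner_sum_left)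
    also have "\<dots> \<le> (\<Sum>i\<in>I. l i * ln (softmax_weight (V i) x))"
    proof (rule sum_mono)
      fix i assume i: "i \<in> I"
      then obtain q where "q \<in> convex hull V i" "s i = l i *\<^sub>R q" using s(2) by blast
      then show "s i \<bullet> x \<le> l i * ln (softmax_weight (V i) x)"
        using inner_le_ln_softmax_weight[OF fin_V[OF i]] l_nonneg[OF i] by (simp add: mult_left_mono)
    qed
    finally have "z \<bullet> x - y \<bullet> x \<le> \<Phi> x" by (simp add: \<Phi>_def)
    moreover have "z \<bullet> x - y \<bullet> x = r * norm x"
      using False by (simp add: z_def inner_add_left dot_square_norm power2_eq_square)
    ultimately show ?thesis by simp
  next
    case True
    have "0 \<le> (\<Sum>i\<in>I. l i * ln (softmax_weight (V i) 0))"
    proof (rule sum_nonneg)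
      fix i assume i: "i \<in> I"
      obtain q where "q \<in> convex hull V i" using V_nonempty[OF i] by (force simp flip: ex_in_conv intro: hull_inc)
      then show "0 \<le> l i * ln (softmax_weight (V i) 0)"
        using inner_le_ln_softmax_weight[OF fin_V[OF i], of q 0] l_nonneg[OF i] by simp
    qed
    then show ?thesis by (simp add: True \<Phi>_def)
  qed
  \<comment> \<open>Beyond this radius \<Phi> exceeds \<open>\<Phi> 0\<close>, so a minimum over the
    ball is a global one.\<close>
  define R where "R = \<Phi> 0 / r"
  have R: "0 \<le> R" using coercive[of 0] r by (simp add: R_def)
  have "continuous_on (cball 0 R) \<Phi>"
    using has_derivative_continuous[OF D] by (simp add: continuous_at_imp_continuous_on)
  then obtain x where x: "x \<in> cball 0 R" "\<And>z. z \<in> cball 0 R \<Longrightarrow> \<Phi> x \<le> \<Phi> z"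
    using continuous_attains_inf[of "cball 0 R" \<Phi>] R by auto
  have min: "\<Phi> x \<le> \<Phi> z" for z
  proof (cases "z \<in> cball 0 R")
    case False
    then have "R * r < r * norm z" using r by (simp add: mult.commute)
    then have "\<Phi> 0 < \<Phi> z" using coercive[of z] r by (simp add: R_def)
    moreover have "\<Phi> x \<le> \<Phi> 0" using x(2)[of 0] R by simp
    ultimately show ?thesis by simp
  qed (use x in auto)
  have "(\<lambda>h. (G x - y) \<bullet> h) = (\<lambda>h. 0)"
    by (rule differential_zero_maxmin[of x UNIV \<Phi>, OF _ _ D]) (simp_all add: min)
  then have "(G x - y) \<bullet> (G x - y) = 0" by (rule fun_cong)
  then have "y = G x" by simp
  then show "y \<in> range G" by simp
qed

end

section \<open>Multilinear expansion of determinants and inclusion-exclusion\<close>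

lemma range_subset_PiE: "{f. range f \<subseteq> S} = PiE UNIV (\<lambda>_. S)"
  by (auto simp: PiE_UNIV_domain)

lemma finite_range_subset: "finite S \<Longrightarrow> finite {f :: 'n::finite \<Rightarrow> 'b. range f \<subseteq> S}"
  by (simp add: range_subset_PiE finite_PiE)

lemma det_sum_rows:
  fixes a :: "'n::finite \<Rightarrow> 'k \<Rightarrow> real^'n"
  assumes "finite S"
  shows "det (\<chi> i. \<Sum>k\<in>S. a i k) = (\<Sum>f | range f \<subseteq> S. det (\<chi> i. a i (f i)))"
proof -
  have "det (\<chi> i. \<Sum>k\<in>S. a i k) =
      (\<Sum>p | p permutes UNIV. of_int (sign p) * (\<Prod>i\<in>UNIV. \<Sum>k\<in>S. a i k $ p i))"
    by (simp add: det_def)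
  also have "\<dots> = (\<Sum>p | p permutes UNIV. of_int (sign p) *
      (\<Sum>f | range f \<subseteq> S. \<Prod>i\<in>UNIV. a i (f i) $ p i))"
    by (simp add: range_subset_PiE prod_sum_PiE assms)
  also have "\<dots> = (\<Sum>f | range f \<subseteq> S. det (\<chi> i. a i (f i)))"
    unfolding det_def sum_distrib_left by (subst sum.swap) simp
  finally show ?thesis .
qed

text \<open>The signed sum over the subsets of the complement of \<open>R\<close> factors into terms
  \<open>(-1) + 1\<close>, so it vanishes unless the complement is empty.\<close>

lemma alternating_sum_supersets:
  fixes R :: "'n::finite set"
  shows "(\<Sum>S | R \<subseteq> S. (-1) ^ (CARD('n) - card S)) = (if R = UNIV then 1 else 0 :: real)"
proof -
  have "(\<Sum>S | R \<subseteq> S. (-1) ^ (CARD('n) - card S)) = (\<Sum>T\<in>Pow (- R). (-1) ^ card T :: real)"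
    by (rule sum.reindex_bij_witness[of _ uminus uminus])
      (auto simp: Compl_eq_Diff_UNIV card_Diff_subset)
  also have "\<dots> = (\<Prod>i\<in>- R. (-1) + 1)"
    by (subst prod_add) (simp_all add: prod_constant)
  also have "\<dots> = (if R = UNIV then 1 else 0)"
    by (auto simp: card_eq_0_iff)
  finally show ?thesis .
qed

text \<open>By inclusion-exclusion only the surjective maps survive, and on a finite type these are
  the permutations.\<close>

lemma alternating_sum_range_subset:
  fixes D :: "('n::finite \<Rightarrow> 'n) \<Rightarrow> real"
  shows "(\<Sum>S\<in>UNIV. (-1) ^ (CARD('n) - card S) * (\<Sum>h\<in>{h :: 'n \<Rightarrow> 'n. range h \<subseteq> S}. D h))
    = (\<Sum>p | p permutes UNIV. D p)"
proof -
  have bij: "{h :: 'n \<Rightarrow> 'n. range h = UNIV} = {p. p permutes UNIV}"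
    by (auto simp: permutes_univ bij_def simp flip: bij_iff intro: finite_UNIV_surj_inj)
  have "(\<Sum>S\<in>UNIV. (-1) ^ (CARD('n) - card S) * (\<Sum>h\<in>{h :: 'n \<Rightarrow> 'n. range h \<subseteq> S}. D h))
    = (\<Sum>S\<in>UNIV. \<Sum>h\<in>UNIV. if range h \<subseteq> S then (-1) ^ (CARD('n) - card S) * D h else 0)"
    by (simp add: sum_distrib_left sum.If_cases)
  also have "\<dots> = (\<Sum>h\<in>UNIV. (\<Sum>S | range h \<subseteq> S. (-1) ^ (CARD('n) - card S)) * D h)"
    by (subst sum.swap) (simp add: sum_distrib_right sum.If_cases)
  also have "\<dots> = (\<Sum>h\<in>UNIV. if range h = UNIV then D h else 0)"
    unfolding alternating_sum_supersets by (intro sum.cong) auto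
  also have "\<dots> = (\<Sum>p | p permutes UNIV. D p)"
    by (simp add: sum.If_cases bij)
  finally show ?thesis .
qed

text \<open>The product of the weights is symmetric, so replacing \<open>D\<close> by its average
  over all permutations does not change the sum. The alternating sum is \<open>fact CARD('n)\<close>
  times this average.\<close>

lemma polarization_identity:
  fixes D :: "('n::finite \<Rightarrow> 'i) \<Rightarrow> real" and l :: "'i \<Rightarrow> real"
  assumes I: "finite I"
  shows "(\<Sum>f\<in>{f :: 'n \<Rightarrow> 'i. range f \<subseteq> I}. (\<Sum>S\<in>UNIV. (-1) ^ (CARD('n) - card S) *
            (\<Sum>h\<in>{h :: 'n \<Rightarrow> 'n. range h \<subseteq> S}. D (f \<circ> h))) / fact CARD('n) * (\<Prod>j\<in>UNIV. l (f j)))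
       = (\<Sum>f\<in>{f :: 'n \<Rightarrow> 'i. range f \<subseteq> I}. D f * (\<Prod>j\<in>UNIV. l (f j)))"
proof -
  let ?F = "{f :: 'n \<Rightarrow> 'i. range f \<subseteq> I}" and ?P = "{p :: 'n \<Rightarrow> 'n. p permutes UNIV}"
  have shift: "(\<Sum>f\<in>?F. D (f \<circ> p) * (\<Prod>j\<in>UNIV. l (f j))) = (\<Sum>f\<in>?F. D f * (\<Prod>j\<in>UNIV. l (f j)))"
    if p: "p \<in> ?P" for p
  proof (rule sum.reindex_bij_witness[of _ "\<lambda>f. f \<circ> inv p" "\<lambda>f. f \<circ> p"])
    have pi: "p \<circ> inv p = id" "inv p \<circ> p = id"
      using p by (auto simp: permutes_inv_o)
    show "f \<circ> p \<circ> inv p = f" "f \<circ> inv p \<circ> p = f" for f :: "'n \<Rightarrow> 'i"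
      using pi by (simp_all add: comp_assoc)
    show "D (f \<circ> p) * (\<Prod>j\<in>UNIV. l ((f \<circ> p) j)) = D (f \<circ> p) * (\<Prod>j\<in>UNIV. l (f j))" for f
      using prod.permute[of p UNIV "\<lambda>j. l (f j)"] p by (simp add: o_def)
  qed auto
  have "(\<Sum>f\<in>?F. (\<Sum>p\<in>?P. D (f \<circ> p)) / fact CARD('n) * (\<Prod>j\<in>UNIV. l (f j)))
      = (\<Sum>f\<in>?F. \<Sum>p\<in>?P. (D (f \<circ> p) * (\<Prod>j\<in>UNIV. l (f j)))) / fact CARD('n)"
    by (simp add: sum_divide_distrib sum_distrib_right)
  also have "\<dots> = (\<Sum>p\<in>?P. \<Sum>f\<in>?F. (D (f \<circ> p) * (\<Prod>j\<in>UNIV. l (f j)))) / fact CARD('n)"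
    by (subst sum.swap) simp
  also have "\<dots> = (\<Sum>p\<in>?P. \<Sum>f\<in>?F. D f * (\<Prod>j\<in>UNIV. l (f j))) / fact CARD('n)"
    using shift by simp
  also have "\<dots> = (\<Sum>f\<in>?F. D f * (\<Prod>j\<in>UNIV. l (f j)))"
    by (simp add: card_permutations[OF refl])
  finally show ?thesis
    unfolding alternating_sum_range_subset .
qed

text \<open>All matrices on the segment from the identity to \<open>A\<close> are positive definite
  as well, hence invertible, so the determinant cannot change sign along it.\<close>

lemma det_pos_if_pos_def:
  fixes A :: "real^'n^'n"
  assumes "\<And>h. h \<noteq> 0 \<Longrightarrow> h \<bullet> (A *v h) > 0"
  shows "det A > 0"
proof (rule ccontr)
  define B where "B t = (1 - t) *\<^sub>R mat 1 + t *\<^sub>R A" for t :: real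
  have nz: "det (B t) \<noteq> 0" if t: "0 \<le> t" "t \<le> 1" for t
  proof -
    have "h = 0" if "B t *v h = 0" for h
    proof (rule ccontr)
      assume h: "h \<noteq> 0"
      have "h \<bullet> (B t *v h) = (1 - t) * (h \<bullet> h) + t * (h \<bullet> (A *v h))"
        by (simp add: B_def matrix_vector_mult_add_rdistrib scaleR_matrix_vector_assoc[symmetric] inner_add_right)
      moreover have "(1 - t) * (h \<bullet> h) + t * (h \<bullet> (A *v h)) > 0"
        using assms[OF h] h t by (cases "t = 0") (auto intro: add_nonneg_pos)
      ultimately show False using that by simp
    qed
    then show ?thesis
      using matrix_left_invertible_ker[of "B t"] invertible_left_inverse invertible_det_nz by metis
  qed
  assume "\<not> det A > 0"
  then have "det (B 1) \<le> 0" "0 \<le> det (B 0)" by (simp_all add: B_def)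
  moreover have "continuous_on {0..1} (\<lambda>t. det (B t))"
    unfolding B_def det_def by (auto intro!: continuous_intros)
  ultimately obtain t where "0 \<le> t" "t \<le> 1" "det (B t) = 0"
    using IVT2'[of "\<lambda>t. det (B t)" 1 0 0] by auto
  then show False using nz by simp
qed

context
  fixes I :: "'i set" and V :: "'i \<Rightarrow> (real^'n::{finite,wellorder}) set"
  assumes fin_V: "\<And>i. i \<in> I \<Longrightarrow> finite (V i)"
    and int_V: "\<And>i. i \<in> I \<Longrightarrow> interior (convex hull V i) \<noteq> {}"
begin

text \<open>\<open>G\<close> maps the whole space injectively onto the Minkowski sum up to its
  negligible frontier, so a change of variables applies. The map \<open>f\<close> lets the same
  polytope occur several times, as in the sums behind \<open>polar\<close>.\<close>

lemma volume_eq_integral_det: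
  assumes J: "finite J" "f ` J \<subseteq> I" "\<And>j. j \<in> J \<Longrightarrow> 0 \<le> l j" "\<exists>j\<in>J. 0 < l j"
  shows "((\<lambda>x. det (\<chi> r. \<Sum>j\<in>J. l j *\<^sub>R matrix (softmax_deriv (V (f j)) x) $ r)) has_integral
    vol (\<Sum>j\<in>J. dilate (l j) (convex hull V (f j)))) UNIV"
proof -
  interpret polytope_family J "\<lambda>j. V (f j)" l
    by unfold_locales (use J fin_V int_V in auto)
  have M: "matrix (G' x) = (\<chi> r. \<Sum>j\<in>J. l j *\<^sub>R matrix (softmax_deriv (V (f j)) x) $ r)" for x
    by (simp add: matrix_def G'_def vec_eq_iff)
  have lin: "linear (G' x)" for x
    using G_deriv has_derivative_linear by blast
  have pos: "det (matrix (G' x)) > 0" for x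
    by (rule det_pos_if_pos_def) (simp add: matrix_vector_mul(2)[OF lin, THEN fun_cong] G'_pos)
  have neg: "negligible (S - interior S)"
    using negligible_convex_frontier[of S] convex_body_S closure_subset[of S]
    by (auto simp: convex_body_def frontier_def intro: negligible_subset)
  have S: "S \<in> lmeasurable" using convex_body_S by (rule convex_body_lmeasurable)
  have R: "range G \<in> lmeasurable" "vol (range G) = vol S"
  proof -
    have sd: "negligible (sym_diff S (range G))"
      by (rule negligible_subset[OF neg]) (use range_G interior_S_subset in auto)
    show "range G \<in> lmeasurable" "vol (range G) = vol S"
      using lmeasurable_negligible_symdiff[OF S sd] measure_negligible_symdiff[OF S sd] by auto
  qed
  \<comment> \<open>The change of variables concerns vector-valued functions, so the constant one is
    written as a vector of dimension one.\<close>
  have "(\<lambda>x. vec 1 :: real^1) absolutely_integrable_on range G \<and> integral (range G) (\<lambda>x. vec 1 :: real^1) = vec (vol S)"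
  proof -
    have "(\<lambda>x. 1::real) integrable_on range G" "integral (range G) (\<lambda>x. 1::real) = vol S"
      using R lmeasurable_iff_integrable_on lmeasure_integral by metis+
    then have "(\<lambda>x. 1::real) absolutely_integrable_on range G" "integral (range G) (\<lambda>x. 1::real) = vol S"
      by (auto simp: absolutely_integrable_on_iff_nonneg)
    then show ?thesis
      by (simp add: absolutely_integrable_on_1_iff integral_on_1_eq)
  qed
  then have "(\<lambda>x. \<bar>det (matrix (G' x))\<bar> *\<^sub>R (vec 1 :: real^1)) absolutely_integrable_on UNIV \<and>
      integral UNIV (\<lambda>x. \<bar>det (matrix (G' x))\<bar> *\<^sub>R (vec 1 :: real^1)) = vec (vol S)"
    by (subst has_absolute_integral_change_of_variables[OF _ G_deriv inj_G]) simp_all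
  then have "(\<lambda>x. \<bar>det (matrix (G' x))\<bar>) integrable_on UNIV \<and> integral UNIV (\<lambda>x. \<bar>det (matrix (G' x))\<bar>) = vol S"
    unfolding absolutely_integrable_on_1_iff integral_on_1_eq
    by (auto simp: absolutely_integrable_on_iff_nonneg)
  then show ?thesis
    using pos by (simp add: has_integral_iff abs_of_pos M S_def)
qed

end

text \<open>The classical alternating formula for the mixed volume of \<open>n\<close> bodies. As a
  definition it makes symmetry and continuity immediate; the expansion of the volume is what remains
  to be proved.\<close>

definition polar :: "('n::finite \<Rightarrow> 'a::euclidean_space set) \<Rightarrow> real" where
  "polar K = (\<Sum>S\<in>UNIV. (-1) ^ (CARD('n) - card S) * vol (\<Sum>j\<in>S. K j)) / fact CARD('n)"

lemma dilate_0: "X \<noteq> {} \<Longrightarrow> dilate 0 X = (0 :: 'a::real_vector set)"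
  by auto

text \<open>The case that \<open>l_pos\<close> excludes in \<open>polytope_family\<close>: the sum
  is a single point, and every product of weights has a zero factor.\<close>

lemma volume_expansion_zero:
  fixes K :: "'i \<Rightarrow> (real^'n) set"
  assumes "\<And>i. i \<in> I \<Longrightarrow> K i \<noteq> {}" and "\<And>i. i \<in> I \<Longrightarrow> l i = 0"
  shows "vol (\<Sum>i\<in>I. dilate (l i) (K i)) =
    (\<Sum>f\<in>{f :: 'n \<Rightarrow> 'i. range f \<subseteq> I}. polar (\<lambda>j. K (f j)) * (\<Prod>j\<in>UNIV. l (f j)))"
proof -
  have "(\<Sum>i\<in>I. dilate (l i) (K i)) = 0"
    using assms by (intro sum.neutral ballI) (metis dilate_0)
  moreover have "l (f j) = 0" if "range f \<subseteq> I" for f :: "'n \<Rightarrow> 'i" and j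
    using that assms(2) by blast
  then have "(\<Prod>j\<in>UNIV. l (f j)) = 0" if "range f \<subseteq> I" for f :: "'n \<Rightarrow> 'i"
    using that by (simp add: prod_zero_iff)
  ultimately show ?thesis by (auto intro!: sum.neutral)
qed

lemma det_zero_matrix: "det (0 :: real^'n^'n) = 0"
  by (rule det_zero_row(1)[of undefined]) (simp add: row_def zero_vec_def)

text \<open>The determinant under the integral is multilinear in the weighted rows. After
  polarization its coefficients are alternating sums of determinants that integrate to volumes of
  partial sums of the polytopes.\<close>

lemma volume_expansion_polytopes:
  fixes V :: "'i \<Rightarrow> (real^'n::{finite,wellorder}) set"
  assumes I: "finite I" and fin_V: "\<And>i. i \<in> I \<Longrightarrow> finite (V i)"
    and int_V: "\<And>i. i \<in> I \<Longrightarrow> interior (convex hull V i) \<noteq> {}"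
    and l: "\<And>i. i \<in> I \<Longrightarrow> 0 \<le> l i"
  shows "vol (\<Sum>i\<in>I. dilate (l i) (convex hull V i)) =
    (\<Sum>f\<in>{f :: 'n \<Rightarrow> 'i. range f \<subseteq> I}.
       polar (\<lambda>j. convex hull V (f j)) * (\<Prod>j\<in>UNIV. l (f j)))"
proof (cases "\<exists>i\<in>I. 0 < l i")
  case False
  then show ?thesis
    using l int_V by (intro volume_expansion_zero) (fastforce intro: antisym)+
next
  case True
  define H where "H i x = matrix (softmax_deriv (V i) x)" for i x
  let ?F = "{f :: 'n \<Rightarrow> 'i. range f \<subseteq> I}"
  define D where "D x f = det (\<chi> r. H (f r) x $ r)" for x and f :: "'n \<Rightarrow> 'i"
  note int = volume_eq_integral_det[OF fin_V int_V]
  have LHS: "((\<lambda>x. det (\<chi> r. \<Sum>i\<in>I. l i *\<^sub>R H i x $ r)) has_integral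
      vol (\<Sum>i\<in>I. dilate (l i) (convex hull V i))) UNIV"
    using int[where J = I and f = "\<lambda>i. i" and l = l] I l True by (simp add: H_def)
  have sub: "((\<lambda>x. det (\<chi> r. \<Sum>j\<in>S. H (f j) x $ r)) has_integral
      vol (\<Sum>j\<in>S. convex hull V (f j))) UNIV" if f: "f \<in> ?F" for S and f :: "'n \<Rightarrow> 'i"
  proof (cases "S = {}")
    case True
    \<comment> \<open>The empty Minkowski sum is the origin; its volume zero agrees with the
      determinant of the zero matrix.\<close>
    show ?thesis by (simp add: True zero_vec_def[symmetric] det_zero_matrix)
  next
    case False
    from f have "f ` S \<subseteq> I" by auto
    then show ?thesis
      using volume_eq_integral_det[of I V S f "\<lambda>_. 1", OF fin_V int_V] False by (auto simp: H_def)
  qed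
  have pt: "det (\<chi> r. \<Sum>i\<in>I. l i *\<^sub>R H i x $ r) =
      (\<Sum>f\<in>?F. (\<Sum>S\<in>UNIV. (-1) ^ (CARD('n) - card S) * det (\<chi> r. \<Sum>j\<in>S. H (f j) x $ r))
        / fact CARD('n) * (\<Prod>j\<in>UNIV. l (f j)))" for x
  proof -
    have "det (\<chi> r. \<Sum>i\<in>I. l i *\<^sub>R H i x $ r) = (\<Sum>f\<in>?F. det (\<chi> r. l (f r) *s (H (f r) x $ r)))"
      by (simp add: det_sum_rows[OF I] scalar_mult_eq_scaleR)
    also have "\<dots> = (\<Sum>f\<in>?F. D x f * (\<Prod>j\<in>UNIV. l (f j)))"
      by (simp add: det_rows_mul D_def mult.commute)
    also have "\<dots> = (\<Sum>f\<in>?F. (\<Sum>S\<in>UNIV. (-1) ^ (CARD('n) - card S) *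
            (\<Sum>h\<in>{h :: 'n \<Rightarrow> 'n. range h \<subseteq> S}. D x (f \<circ> h))) / fact CARD('n) * (\<Prod>j\<in>UNIV. l (f j)))"
      by (rule polarization_identity[OF I, symmetric])
    finally show ?thesis
      by (simp add: D_def det_sum_rows)
  qed
  have "((\<lambda>x. \<Sum>f\<in>?F. (\<Sum>S\<in>UNIV. (-1) ^ (CARD('n) - card S) * det (\<chi> r. \<Sum>j\<in>S. H (f j) x $ r))
        / fact CARD('n) * (\<Prod>j\<in>UNIV. l (f j))) has_integral
      (\<Sum>f\<in>?F. (\<Sum>S\<in>UNIV. (-1) ^ (CARD('n) - card S) * vol (\<Sum>j\<in>S. convex hull V (f j)))
        / fact CARD('n) * (\<Prod>j\<in>UNIV. l (f j)))) UNIV"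
    by (intro has_integral_sum has_integral_mult_left has_integral_divide has_integral_mult_right sub
        finite_range_subset I finite)
  then show ?thesis
    using LHS unfolding pt polar_def by (rule has_integral_unique[symmetric])
qed

subsection \<open>Approximation by polytopes\<close>

text \<open>The hull of a finite net in \<open>K\<close> plus a small cube: the cube fills the mesh
  of the net and provides interior points.\<close>

lemma convex_body_outer_polytope:
  fixes K :: "'a::euclidean_space set"
  assumes K: "convex_body K" and e: "e > 0"
  obtains V where "finite V" "interior (convex hull V) \<noteq> {}"
    "K \<subseteq> convex hull V" "convex hull V \<subseteq> K + cball 0 e"
proof -
  \<comment> \<open>The cube of half side \<open>d\<close> contains the ball of radius
    \<open>d\<close>, so a net of mesh \<open>d\<close> suffices; its points have norm at most
    \<open>DIM('a) * d\<close>, which is \<open>e / 2\<close>.\<close>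
  define d where "d = e / (2 * DIM('a))"
  have d: "d > 0" using e by (simp add: d_def)
  define c :: 'a where "c = (\<Sum>i\<in>Basis. d *\<^sub>R i)"
  obtain X where X: "finite X" "cbox (0 - c) (0 + c) = convex hull X"
    using cube_convex_hull[OF d, of 0] unfolding c_def by metis
  have c_comp: "c \<bullet> i = d" if "i \<in> Basis" for i
    using that by (simp add: c_def)
  have small: "ball 0 d \<subseteq> convex hull X"
  proof
    fix x :: 'a assume "x \<in> ball 0 d"
    then have "\<bar>x \<bullet> i\<bar> \<le> d" if "i \<in> Basis" for i
      using Basis_le_norm[OF that, of x] by simp
    then show "x \<in> convex hull X"
      unfolding X(2)[symmetric] by (force simp: mem_box c_comp abs_le_iff)
  qed
  have big: "convex hull X \<subseteq> cball 0 e"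
  proof
    fix x assume "x \<in> convex hull X"
    then have "\<bar>x \<bullet> i\<bar> \<le> d" if "i \<in> Basis" for i
      using that unfolding X(2)[symmetric] by (force simp: mem_box c_comp abs_le_iff)
    then have "norm x \<le> DIM('a) * d"
      using norm_le_l1[of x] sum_bounded_above[of Basis "\<lambda>i. \<bar>x \<bullet> i\<bar>" d] by fastforce
    then show "x \<in> cball 0 e" using e by (simp add: d_def)
  qed
  obtain C where C: "finite C" "C \<subseteq> K" "K \<subseteq> (\<Union>x\<in>C. ball x d)"
    using compactE_image[of K K "\<lambda>x. ball x d"] K d
    by (force simp: convex_body_def)
  have hull: "convex hull (C + X) = convex hull C + convex hull X"
    by (rule convex_hull_set_plus)
  show thesis
  proof
    show "finite (C + X)" using C X by (simp add: finite_set_plus)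
    show K_sub: "K \<subseteq> convex hull (C + X)"
    proof
      fix x assume "x \<in> K"
      then obtain y where "y \<in> C" "x - y \<in> ball 0 d" using C(3) by (auto simp: dist_norm norm_minus_commute)
      then have "y + (x - y) \<in> convex hull C + convex hull X"
        using small by (intro set_plus_intro[OF hull_inc subsetD]) auto
      then show "x \<in> convex hull (C + X)" by (simp add: hull)
    qed
    obtain y where y: "y \<in> C" using C(3) K by (auto simp: convex_body_def)
    have "ball y d \<subseteq> convex hull (C + X)"
    proof
      fix x assume "x \<in> ball y d"
      then have "y + (x - y) \<in> convex hull C + convex hull X"
        using small y by (intro set_plus_intro[OF hull_inc subsetD]) (auto simp: dist_norm norm_minus_commute)
      then show "x \<in> convex hull (C + X)" by (simp add: hull)
    qed
    then show "interior (convex hull (C + X)) \<noteq> {}"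
      using d by (metis ball_eq_empty interior_maximal not_less open_ball subset_empty)
    have "convex hull C \<subseteq> K" using C K by (simp add: convex_body_def hull_minimal)
    then show "convex hull (C + X) \<subseteq> K + cball 0 e"
      unfolding hull using big by (rule set_plus_mono2)
  qed
qed

text \<open>The thickenings are compact and decrease to \<open>X\<close>, so the measure is
  continuous from above along them.\<close>

lemma vol_thickening_LIMSEQ:
  fixes X :: "'a::euclidean_space set"
  assumes X: "compact X" and c: "c \<ge> 0"
  shows "(\<lambda>k. vol (X + cball 0 (c / Suc k))) \<longlonglongrightarrow> vol X"
proof -
  let ?A = "\<lambda>k::nat. X + cball 0 (c / Suc k)"
  have cp: "compact (?A k)" for k using X by (simp add: compact_set_plus)
  have "(\<lambda>k. vol (?A k)) \<longlonglongrightarrow> vol (\<Inter>k. ?A k)"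
  proof (rule Lim_measure_decseq)
    show "range ?A \<subseteq> sets lebesgue" using cp by (auto intro: lmeasurable_compact fmeasurableD)
    show "decseq ?A"
    proof (rule decseq_SucI, rule set_plus_mono2)
      fix k show "cball (0::'a) (c / Suc (Suc k)) \<subseteq> cball 0 (c / Suc k)"
        using c by (intro subset_cball divide_left_mono) auto
    qed simp
    show "emeasure lebesgue (?A k) \<noteq> \<infinity>" for k
      using fmeasurableD2[OF lmeasurable_compact[OF cp[of k]]] by simp
  qed
  moreover have "(\<Inter>k. ?A k) = X"
  proof (intro equalityI INT_greatest subsetI)
    fix x assume x: "x \<in> (\<Inter>k. ?A k)"
    show "x \<in> X"
    proof (rule ccontr)
      assume "x \<notin> X"
      then obtain e where e: "e > 0" "ball x e \<subseteq> - X"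
        using compact_imp_closed[OF X] by (meson ComplI open_Compl open_contains_ball)
      obtain k where k: "c / Suc k < e"
        using LIMSEQ_D[OF tendsto_mult_right_zero[OF LIMSEQ_inverse_real_of_nat], of e c] e(1) c
        by (force simp: divide_inverse)
      obtain y b where "x = y + b" "y \<in> X" "norm b \<le> c / Suc k"
        using x by (auto elim!: set_plus_elim dest!: spec[of _ k])
      then have "y \<in> ball x e" using k by (simp add: dist_norm)
      then show False using e(2) \<open>y \<in> X\<close> by auto
    qed
  next
    fix x k assume "x \<in> X"
    then have "x + 0 \<in> ?A k" using c by (intro set_plus_intro) auto
    then show "x \<in> ?A k" by simp
  qed
  ultimately show ?thesis by simp
qed

lemma vol_mono: "A \<subseteq> B \<Longrightarrow> convex_body A \<Longrightarrow> convex_body B \<Longrightarrow> vol A \<le> vol B"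
  by (intro measure_mono_fmeasurable) (auto dest: convex_body_lmeasurable intro: fmeasurableD)

lemma vol_outer_LIMSEQ:
  fixes K :: "'i \<Rightarrow> 'a::euclidean_space set"
  assumes J: "finite J" and K: "\<And>j. j \<in> J \<Longrightarrow> convex_body (K j)"
    and Q: "\<And>k j. j \<in> J \<Longrightarrow> convex_body (Q k j)"
    and sub: "\<And>k j. j \<in> J \<Longrightarrow> K j \<subseteq> Q k j"
    and sup: "\<And>k j. j \<in> J \<Longrightarrow> Q k j \<subseteq> K j + cball 0 (1 / Suc k)"
    and l: "\<And>j. j \<in> J \<Longrightarrow> 0 \<le> l j"
  shows "(\<lambda>k. vol (\<Sum>j\<in>J. dilate (l j) (Q k j))) \<longlonglongrightarrow> vol (\<Sum>j\<in>J. dilate (l j) (K j))"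
proof -
  let ?X = "\<Sum>j\<in>J. dilate (l j) (K j)" and ?Q = "\<lambda>k. \<Sum>j\<in>J. dilate (l j) (Q k j)"
  \<comment> \<open>Errors of size \<open>1 / Suc k\<close> in the single bodies add up with their
    weights to at most \<open>L / Suc k\<close>.\<close>
  define L where "L = sum l J"
  have L: "L \<ge> 0" using l by (simp add: L_def sum_nonneg)
  have X: "convex_body ?X" using K by (intro convex_body_sum convex_body_dilate)
  have QB: "convex_body (?Q k)" for k using Q by (intro convex_body_sum convex_body_dilate)
  have lower: "?X \<subseteq> ?Q k" for k
    using sub unfolding set_sum_alt[OF J] by blast
  have upper: "?Q k \<subseteq> ?X + cball 0 (L / Suc k)" for k
  proof
    fix x assume "x \<in> ?Q k"
    then obtain s where s: "x = sum s J" "\<forall>j\<in>J. s j \<in> dilate (l j) (Q k j)"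
      unfolding set_sum_alt[OF J] by blast
    have "\<forall>j\<in>J. \<exists>a b. s j = l j *\<^sub>R a + l j *\<^sub>R b \<and> a \<in> K j \<and> norm b \<le> 1 / Suc k"
    proof
      fix j assume j: "j \<in> J"
      then obtain q where "s j = l j *\<^sub>R q" "q \<in> Q k j" using s(2) by auto
      moreover obtain a b where "q = a + b" "a \<in> K j" "b \<in> cball 0 (1 / Suc k)"
        using sup[OF j, of k] \<open>q \<in> Q k j\<close> by (meson set_plus_elim subsetD)
      ultimately show "\<exists>a b. s j = l j *\<^sub>R a + l j *\<^sub>R b \<and> a \<in> K j \<and> norm b \<le> 1 / Suc k"
        by (auto simp: scaleR_add_right)
    qed
    then obtain a b where ab: "\<And>j. j \<in> J \<Longrightarrow> s j = l j *\<^sub>R a j + l j *\<^sub>R b j"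
        "\<And>j. j \<in> J \<Longrightarrow> a j \<in> K j" "\<And>j. j \<in> J \<Longrightarrow> norm (b j) \<le> 1 / Suc k"
      by metis
    have "x = (\<Sum>j\<in>J. l j *\<^sub>R a j) + (\<Sum>j\<in>J. l j *\<^sub>R b j)"
      using ab(1) by (simp add: s(1) sum.distrib)
    moreover have "(\<Sum>j\<in>J. l j *\<^sub>R a j) \<in> ?X"
      unfolding set_sum_alt[OF J] using ab(2) by blast
    moreover have "norm (\<Sum>j\<in>J. l j *\<^sub>R b j) \<le> (\<Sum>j\<in>J. l j * (1 / Suc k))"
    proof (intro order_trans[OF norm_sum] sum_mono)
      fix j assume "j \<in> J"
      then show "norm (l j *\<^sub>R b j) \<le> l j * (1 / Suc k)"
        using mult_left_mono[OF ab(3) l] l by (simp del: of_nat_Suc)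
    qed
    then have "(\<Sum>j\<in>J. l j *\<^sub>R b j) \<in> cball 0 (L / Suc k)"
      by (simp add: L_def sum_divide_distrib del: of_nat_Suc)
    ultimately show "x \<in> ?X + cball 0 (L / Suc k)" by blast
  qed
  have TB: "convex_body (?X + cball 0 (L / Suc k))" for k
  proof -
    have "0 \<le> L / Suc k" using L by simp
    then have "convex_body (cball (0::'a) (L / Suc k))"
      by (auto simp: convex_body_def simp del: of_nat_Suc)
    then show ?thesis using X by (rule convex_body_plus[rotated])
  qed
  show ?thesis
  proof (rule tendsto_sandwich[OF _ _ tendsto_const vol_thickening_LIMSEQ[of ?X L]])
    show "\<forall>\<^sub>F k in sequentially. vol ?X \<le> vol (?Q k)"
      using lower X QB by (intro always_eventually allI vol_mono)
    show "\<forall>\<^sub>F k in sequentially. vol (?Q k) \<le> vol (?X + cball 0 (L / Suc k))"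
      using upper TB QB by (intro always_eventually allI vol_mono)
  qed (use X L in \<open>auto simp: convex_body_def\<close>)
qed

text \<open>Both sides involve only volumes of finitely many weighted sums, and these converge when
  all bodies are approximated from outside by polytopes.\<close>

lemma volume_expansion_wellorder:
  fixes K :: "'i \<Rightarrow> (real^'n::{finite,wellorder}) set"
  assumes I: "finite I" and K: "\<And>i. i \<in> I \<Longrightarrow> convex_body (K i)"
    and l: "\<And>i. i \<in> I \<Longrightarrow> 0 \<le> l i"
  shows "vol (\<Sum>i\<in>I. dilate (l i) (K i)) =
    (\<Sum>f\<in>{f :: 'n \<Rightarrow> 'i. range f \<subseteq> I}. polar (\<lambda>j. K (f j)) * (\<Prod>j\<in>UNIV. l (f j)))"
proof -
  have "\<exists>V. finite V \<and> interior (convex hull V) \<noteq> {} \<and> K i \<subseteq> convex hull V \<and>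
      convex hull V \<subseteq> K i + cball 0 (1 / Suc k)" if "i \<in> I" for i k
    by (rule convex_body_outer_polytope[OF K[OF that], of "1 / Suc k"]) auto
  then have "\<exists>V. \<forall>k. \<forall>i\<in>I. finite (V k i) \<and> interior (convex hull V k i) \<noteq> {} \<and>
      K i \<subseteq> convex hull V k i \<and> convex hull V k i \<subseteq> K i + cball 0 (1 / Suc k)"
    by (intro choice allI bchoice ballI) blast
  then obtain V where V: "\<And>k i. i \<in> I \<Longrightarrow> finite (V k i)"
      "\<And>k i. i \<in> I \<Longrightarrow> interior (convex hull V k i) \<noteq> {}"
      "\<And>k i. i \<in> I \<Longrightarrow> K i \<subseteq> convex hull V k i"
      "\<And>k i. i \<in> I \<Longrightarrow> convex hull V k i \<subseteq> K i + cball 0 (1 / Suc k)"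
    by blast
  have Q: "convex_body (convex hull V k i)" if "i \<in> I" for k i
    using V(1)[OF that, of k] V(2)[OF that, of k]
    by (auto simp: convex_body_def finite_imp_compact_convex_hull)
  have "(\<lambda>k. vol (\<Sum>i\<in>I. dilate (l i) (convex hull V k i))) \<longlonglongrightarrow> vol (\<Sum>i\<in>I. dilate (l i) (K i))"
    using vol_outer_LIMSEQ[of I K "\<lambda>k i. convex hull V k i" l] I K l V Q by blast
  moreover have "(\<lambda>k. vol (\<Sum>i\<in>I. dilate (l i) (convex hull V k i))) \<longlonglongrightarrow>
    (\<Sum>f\<in>{f :: 'n \<Rightarrow> 'i. range f \<subseteq> I}. polar (\<lambda>j. K (f j)) * (\<Prod>j\<in>UNIV. l (f j)))"
  proof -
    have "(\<lambda>k. vol (\<Sum>j\<in>S. convex hull V k (f j))) \<longlonglongrightarrow> vol (\<Sum>j\<in>S. K (f j))"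
      if "range f \<subseteq> I" for f :: "'n \<Rightarrow> 'i" and S
    proof -
      have "(\<lambda>k. vol (\<Sum>j\<in>S. dilate 1 (convex hull V k (f j)))) \<longlonglongrightarrow> vol (\<Sum>j\<in>S. dilate 1 (K (f j)))"
        by (rule vol_outer_LIMSEQ) (use that in \<open>auto intro!: K Q V(3,4)[THEN subsetD] simp del: of_nat_Suc\<close>)
      then show ?thesis by simp
    qed
    then have "(\<lambda>k. polar (\<lambda>j. convex hull V k (f j))) \<longlonglongrightarrow> polar (\<lambda>j. K (f j))"
      if "range f \<subseteq> I" for f :: "'n \<Rightarrow> 'i"
      unfolding polar_def using that by (intro tendsto_intros) auto
    then show ?thesis
      by (subst volume_expansion_polytopes[OF I V(1,2) l]) (auto intro!: tendsto_intros)
  qed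
  ultimately show ?thesis by (rule LIMSEQ_unique)
qed

text \<open>The change of variables theorem of the library needs a well-ordered index type for the
  coordinates, so it is applied to a copy of the index type.\<close>

typedef (overloaded) ('a::finite) idx = "{..<CARD('a)}"
  by (rule exI[of _ 0]) simp

instantiation idx :: (finite) wellorder
begin

definition less_eq_idx :: "'a idx \<Rightarrow> 'a idx \<Rightarrow> bool" where "x \<le> y \<longleftrightarrow> Rep_idx x \<le> Rep_idx y"
definition less_idx :: "'a idx \<Rightarrow> 'a idx \<Rightarrow> bool" where "x < y \<longleftrightarrow> Rep_idx x < Rep_idx y"

instance
proof
  fix P :: "'a idx \<Rightarrow> bool" and a
  assume "\<And>x. (\<And>y. y < x \<Longrightarrow> P y) \<Longrightarrow> P x"
  then show "P a"
    unfolding less_idx_def by (rule measure_induct_rule)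
qed (auto simp: less_eq_idx_def less_idx_def Rep_idx_inject)

end

instance idx :: (finite) finite
proof
  have "finite (range (Rep_idx :: 'a idx \<Rightarrow> nat))"
    using Rep_idx by (rule_tac finite_subset[of _ "{..<CARD('a)}"]) auto
  then show "finite (UNIV :: 'a idx set)"
    by (rule finite_imageD) (auto simp: inj_on_def Rep_idx_inject)
qed

lemma card_idx: "CARD('a::finite idx) = CARD('a)"
  using type_definition.card[OF type_definition_idx] by simp

text \<open>Lebesgue measure is determined by its values on boxes, and a relabelling of coordinates
  maps boxes to boxes with the same side lengths.\<close>

lemma vol_relabel:
  fixes b :: "'m::finite \<Rightarrow> 'n::finite" and X :: "(real^'n) set"
  assumes b: "bij b" and X: "X \<in> sets borel"
  shows "vol ((\<lambda>x. \<chi> i. x $ b i) ` X) = vol X"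
proof -
  define T :: "real^'n \<Rightarrow> real^'m" where "T x = (\<chi> i. x $ b i)" for x
  define U :: "real^'m \<Rightarrow> real^'n" where "U y = (\<chi> i. y $ inv b i)" for y
  have TU: "T (U y) = y" and UT: "U (T x) = x" for x y
    using b by (auto simp: T_def U_def vec_eq_iff bij_is_inj bij_is_surj surj_f_inv_f)
  have "continuous_on UNIV U" "continuous_on UNIV T"
    unfolding U_def T_def by (intro continuous_intros)+
  then have Tm: "T \<in> borel_measurable borel" and Um: "U \<in> borel_measurable borel"
    by (auto intro: borel_measurable_continuous_onI)
  have "T ` X = U -` X" by (auto simp: UT) (metis TU image_eqI)
  then have TX: "T ` X \<in> sets borel"
    using measurable_sets[OF Um X] by simp
  have "lborel = distr (lborel :: (real^'n) measure) borel T"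
  proof (rule lborel_eqI)
    fix l u :: "real^'m" assume le: "\<And>k. k \<in> Basis \<Longrightarrow> l \<bullet> k \<le> u \<bullet> k"
    have le': "l $ i \<le> u $ i" for i using le[of "axis i 1"] by (simp add: cart_eq_inner_axis axis_in_Basis_iff)
    have "T -` box l u = box (U l) (U u)"
      using b by (auto simp: mem_box_cart T_def U_def) (metis bij_inv_eq_iff)+
    then have "emeasure (distr lborel borel T) (box l u) = emeasure lborel (box (U l) (U u))"
      using Tm by (simp add: emeasure_distr)
    also have "\<dots> = (\<Prod>k\<in>Basis. (U u - U l) \<bullet> k)"
      using le' by (subst emeasure_lborel_box) (auto simp: Basis_vec_def U_def cart_eq_inner_axis[symmetric])
    also have "(\<Prod>k\<in>Basis. (U u - U l) \<bullet> k) = (\<Prod>i\<in>UNIV. (U u - U l) $ i)"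
      by (rule prod.reindex_bij_witness[of _ "\<lambda>i. axis i 1" "\<lambda>k. SOME i. k = axis i 1"])
        (auto simp: Basis_vec_def cart_eq_inner_axis axis_eq_axis)
    also have "\<dots> = (\<Prod>i\<in>UNIV. (u - l) $ i)"
      using prod.reindex_bij_betw[OF bij_imp_bij_inv[OF b], of "\<lambda>i. (u - l) $ i"] by (simp add: U_def)
    also have "\<dots> = (\<Prod>k\<in>Basis. (u - l) \<bullet> k)"
      by (rule prod.reindex_bij_witness[of _ "\<lambda>k. SOME i. k = axis i 1" "\<lambda>i. axis i 1"])
        (auto simp: Basis_vec_def cart_eq_inner_axis axis_eq_axis)
    finally show "emeasure (distr lborel borel T) (box l u) = (\<Prod>k\<in>Basis. (u - l) \<bullet> k)" .
  qed simp
  then have "emeasure lborel (T ` X) = emeasure (distr (lborel :: (real^'n) measure) borel T) (T ` X)"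
    by simp
  also have "\<dots> = emeasure lborel (T -` T ` X)"
    using Tm TX by (simp add: emeasure_distr)
  also have "T -` T ` X = X" using UT by (metis inj_on_def inj_vimage_image_eq)
  finally show ?thesis
    using X TX by (simp add: measure_def emeasure_completion T_def[abs_def] sets_completionI_sets[of _ lborel])
qed

lemma polar_reindex:
  fixes K :: "'m::finite \<Rightarrow> 'a::euclidean_space set" and b :: "'n::finite \<Rightarrow> 'm"
  assumes b: "bij b"
  shows "polar (\<lambda>j. K (b j)) = polar K"
proof -
  have inj: "inj b" using b by (rule bij_is_inj)
  have card: "CARD('n) = CARD('m)" using bij_betw_same_card[OF b] .
  have "(\<Sum>S\<in>UNIV. (-1) ^ (CARD('m) - card S) * vol (\<Sum>j\<in>S. K (b j)))
     = (\<Sum>S\<in>UNIV. (-1) ^ (CARD('m) - card S) * vol (\<Sum>j\<in>S. K j))"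
  proof (rule sum.reindex_bij_witness[of _ "\<lambda>S. b -` S" "\<lambda>S. b ` S"])
    fix S
    show "(-1) ^ (CARD('m) - card (b ` S)) * vol (\<Sum>j\<in>b ` S. K j) = (-1) ^ (CARD('m) - card S) * vol (\<Sum>j\<in>S. K (b j))"
      using inj by (simp add: card_image inj_on_subset sum.reindex)
    show "b -` (b ` S) = S" "b ` (b -` T) = T" for T
      using b by (auto simp: inj_vimage_image_eq bij_is_inj bij_is_surj)
  qed auto
  then show ?thesis by (simp add: polar_def card)
qed

lemma convex_body_borel: "convex_body K \<Longrightarrow> K \<in> sets borel"
  by (simp add: convex_body_def compact_imp_closed borel_closed)

theorem volume_expansion:
  fixes K :: "'i \<Rightarrow> (real^'n) set"
  assumes I: "finite I" and K: "\<And>i. i \<in> I \<Longrightarrow> convex_body (K i)"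
    and l: "\<And>i. i \<in> I \<Longrightarrow> 0 \<le> l i"
  shows "vol (\<Sum>i\<in>I. dilate (l i) (K i)) =
    (\<Sum>f\<in>{f :: 'n \<Rightarrow> 'i. range f \<subseteq> I}. polar (\<lambda>j. K (f j)) * (\<Prod>j\<in>UNIV. l (f j)))"
proof -
  obtain b :: "'n idx \<Rightarrow> 'n" where b: "bij b"
    using finite_same_card_bij[of "UNIV :: 'n idx set" "UNIV :: 'n set"] by (auto simp: card_idx)
  have bb: "inv b \<circ> b = id" "b \<circ> inv b = id"
    using b by (simp_all add: bij_is_inj bij_is_surj surj_iff[symmetric])
  define T :: "real^'n \<Rightarrow> real^'n idx" where "T x = (\<chi> i. x $ b i)" for x
  have lin: "linear T" by (auto simp: T_def linear_iff vec_eq_iff)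
  have plus: "T ` (A + B) = T ` A + T ` B" for A B
    by (force simp: set_plus_def linear_add[OF lin] image_iff)
  have sum: "T ` (sum A J) = (\<Sum>j\<in>J. T ` A j)" for A :: "'k \<Rightarrow> _" and J
    using sum_set_linear[of "(`) T" A J] plus linear_0[OF lin] by simp
  have vol_T: "vol (T ` X) = vol X" if "convex_body X" for X
    unfolding T_def by (rule vol_relabel[OF b convex_body_borel[OF that]])
  have TK: "convex_body (T ` K i)" if "i \<in> I" for i
    using K[OF that] lin linear_continuous_on[of T]
    by (auto simp: convex_body_def convex_linear_image compact_continuous_image linear_conv_bounded_linear)
  have "vol (\<Sum>i\<in>I. dilate (l i) (K i)) = vol (T ` (\<Sum>i\<in>I. dilate (l i) (K i)))"
    using K by (intro vol_T[symmetric] convex_body_sum convex_body_dilate)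
  also have "T ` (\<Sum>i\<in>I. dilate (l i) (K i)) = (\<Sum>i\<in>I. dilate (l i) (T ` K i))"
    by (simp add: sum image_image linear_cmul[OF lin])
  also have "vol \<dots> = (\<Sum>f\<in>{f :: 'n idx \<Rightarrow> 'i. range f \<subseteq> I}. polar (\<lambda>j. T ` K (f j)) * (\<Prod>j\<in>UNIV. l (f j)))"
    by (rule volume_expansion_wellorder[OF I TK l])
  also have "\<dots> = (\<Sum>f\<in>{f :: 'n \<Rightarrow> 'i. range f \<subseteq> I}. polar (\<lambda>j. K (f j)) * (\<Prod>j\<in>UNIV. l (f j)))"
  proof (rule sum.reindex_bij_witness[of _ "\<lambda>f. f \<circ> b" "\<lambda>f. f \<circ> inv b"])
    fix f :: "'n idx \<Rightarrow> 'i" assume f: "f \<in> {f. range f \<subseteq> I}"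
    have "polar (\<lambda>j. T ` K (f j)) = polar (\<lambda>j. K (f j))"
    proof -
      have "vol (\<Sum>j\<in>S. T ` K (f j)) = vol (\<Sum>j\<in>S. K (f j))" for S
        using vol_T[of "\<Sum>j\<in>S. K (f j)"] K f by (auto simp: sum intro!: convex_body_sum)
      then show ?thesis by (simp add: polar_def)
    qed
    also have "\<dots> = polar (\<lambda>j. K (f (inv b j)))"
      using polar_reindex[OF bij_imp_bij_inv[OF b], of "\<lambda>j. K (f j)"] by simp
    finally have "polar (\<lambda>j. T ` K (f j)) = polar (\<lambda>j. K (f (inv b j)))" .
    moreover have "(\<Prod>j\<in>UNIV. l (f j)) = (\<Prod>j\<in>UNIV. l (f (inv b j)))"
      using prod.reindex_bij_betw[OF bij_imp_bij_inv[OF b], of "\<lambda>j. l (f j)"] by simp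
    ultimately show "polar (\<lambda>j. K ((f \<circ> inv b) j)) * (\<Prod>j\<in>UNIV. l ((f \<circ> inv b) j)) =
        polar (\<lambda>j. T ` K (f j)) * (\<Prod>j\<in>UNIV. l (f j))"
      by simp
  qed (use bb in \<open>auto simp: comp_assoc\<close>)
  finally show ?thesis .
qed

section \<open>Mixed volumes as functions of lists of bodies\<close>

definition coord :: "'n::finite \<Rightarrow> nat" where
  "coord = (SOME f. bij_betw f UNIV {..<CARD('n)})"

lemma bij_coord: "bij_betw (coord :: 'n::finite \<Rightarrow> nat) UNIV {..<CARD('n)}"
proof -
  have "\<exists>f :: 'n \<Rightarrow> nat. bij_betw f UNIV {..<CARD('n)}"
    using finite_same_card_bij[of "UNIV :: 'n set" "{..<CARD('n)}"] by simp
  then show ?thesis unfolding coord_def by (rule someI_ex)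
qed

definition uncoord :: "nat \<Rightarrow> 'n::finite" where
  "uncoord = inv_into UNIV coord"

lemma bij_uncoord: "bij_betw (uncoord :: nat \<Rightarrow> 'n::finite) {..<CARD('n)} UNIV"
  unfolding uncoord_def by (rule bij_betw_inv_into[OF bij_coord])

lemma uncoord_coord [simp]: "uncoord (coord j) = (j :: 'n::finite)"
  unfolding uncoord_def using bij_betw_imp_inj_on[OF bij_coord[where 'n = 'n]] by (rule inv_into_f_f) simp

lemma coord_uncoord [simp]: "i < CARD('n) \<Longrightarrow> coord (uncoord i :: 'n::finite) = i"
  unfolding uncoord_def using bij_betw_inv_into_right[OF bij_coord[where 'n = 'n]] by simp

lemma coord_less [simp]: "coord (j :: 'n::finite) < CARD('n)"
  using bij_coord[where 'n = 'n] by (auto simp: bij_betw_def)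

lemma inj_coord: "inj (coord :: 'n::finite \<Rightarrow> nat)"
  by (rule bij_betw_imp_inj_on[OF bij_coord])

definition bodies :: "(real^'n) set list \<Rightarrow> bool" where
  "bodies Ks \<longleftrightarrow> length Ks = CARD('n) \<and> (\<forall>K\<in>set Ks. convex_body K)"

text \<open>The numbering \<open>coord\<close> translates positions in a list into the indices that
  \<open>polar\<close> expects. The default value is forced by
  \<open>is_mixed_volume\<close>.\<close>

definition mvol :: "(real^'n) set list \<Rightarrow> real" where
  "mvol Ks = (if bodies Ks then polar (\<lambda>j :: 'n. Ks ! coord j) else 0)"

text \<open>A permutation of the positions is conjugate under \<open>coord\<close> to a permutation
  of the index type, under which \<open>polar\<close> is invariant.\<close>

lemma mvol_mset:
  fixes Ks :: "(real^'n) set list"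
  assumes "mset Ks = mset Ls"
  shows "mvol Ks = mvol Ls"
proof -
  have b: "bodies Ks \<longleftrightarrow> bodies Ls"
    using mset_eq_length[OF assms] mset_eq_setD[OF assms] by (simp add: bodies_def)
  show ?thesis
  proof (cases "bodies Ls")
    case True
    then have len: "length Ls = CARD('n)" by (simp add: bodies_def)
    obtain p where p: "p permutes {..<length Ls}" "permute_list p Ls = Ks"
      using mset_eq_permutation[OF assms] .
    let ?c = "coord :: 'n \<Rightarrow> nat"
    define q :: "'n \<Rightarrow> 'n" where "q = uncoord \<circ> p \<circ> ?c"
    have "bij_betw p {..<CARD('n)} {..<CARD('n)}" using p(1) len by (simp add: permutes_imp_bij)
    then have q: "bij q"
      using bij_betw_trans[OF bij_betw_trans[OF bij_coord] bij_uncoord] by (simp add: q_def comp_assoc)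
    have cq: "?c (q j) = p (?c j)" for j
      using permutes_in_image[OF p(1), of "?c j"] by (simp add: q_def len)
    have "Ks ! ?c j = Ls ! ?c (q j)" for j
      using p by (simp add: cq permute_list_nth len flip: p(2))
    then have "polar (\<lambda>j. Ks ! ?c j) = polar (\<lambda>j. Ls ! ?c j)"
      using polar_reindex[OF q, of "\<lambda>j. Ls ! ?c j"] by simp
    then show ?thesis using True b by (simp add: mvol_def)
  qed (use b in \<open>simp add: mvol_def\<close>)
qed

lemma sum_lists_eq_sum_funs:
  fixes F :: "'i list \<Rightarrow> real"
  shows "(\<Sum>is\<in>{is. length is = CARD('n) \<and> set is \<subseteq> I}. F is) =
    (\<Sum>f\<in>{f :: 'n::finite \<Rightarrow> 'i. range f \<subseteq> I}. F (map (\<lambda>i. f (uncoord i)) [0..<CARD('n)]))"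
proof (rule sum.reindex_bij_witness[of _ "\<lambda>f. map (\<lambda>i. f (uncoord i)) [0..<CARD('n)]"
      "\<lambda>is j. is ! coord (j :: 'n)"])
  fix xs :: "'i list" assume xs: "xs \<in> {is. length is = CARD('n) \<and> set is \<subseteq> I}"
  show eq: "map (\<lambda>i. xs ! coord (uncoord i :: 'n)) [0..<CARD('n)] = xs"
    using xs by (intro nth_equalityI) auto
  then show "F (map (\<lambda>i. xs ! coord (uncoord i :: 'n)) [0..<CARD('n)]) = F xs" by simp
  show "(\<lambda>j::'n. xs ! coord j) \<in> {f. range f \<subseteq> I}"
    using xs by (auto intro!: subsetD[OF _ nth_mem, of xs I])
next
  fix f :: "'n \<Rightarrow> 'i" assume f: "f \<in> {f. range f \<subseteq> I}"
  show "(\<lambda>j. map (\<lambda>i. f (uncoord i)) [0..<CARD('n)] ! coord j) = f"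
    by (auto simp: fun_eq_iff)
  show "map (\<lambda>i. f (uncoord i)) [0..<CARD('n)] \<in> {is. length is = CARD('n) \<and> set is \<subseteq> I}"
    using f by auto
qed

lemma prod_list_map_coord:
  "prod_list (map (\<lambda>i. g (uncoord i)) [0..<CARD('n)]) = (\<Prod>j\<in>(UNIV :: 'n::finite set). g j :: real)"
  using prod.reindex_bij_betw[OF bij_uncoord, of g]
  by (simp add: prod.list_conv_set_nth atLeast0LessThan)

lemma is_mixed_volume_mvol: "is_mixed_volume (mvol :: (real^'n) set list \<Rightarrow> real)"
  unfolding is_mixed_volume_def
proof (intro conjI allI impI)
  fix m :: nat and K :: "nat \<Rightarrow> (real^'n) set" and l :: "nat \<Rightarrow> real"
  assume a: "\<forall>i<m. convex_body (K i) \<and> 0 \<le> l i"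
  have "vol (\<Sum>i<m. dilate (l i) (K i)) =
    (\<Sum>f\<in>{f :: 'n \<Rightarrow> nat. range f \<subseteq> {..<m}}. polar (\<lambda>j. K (f j)) * (\<Prod>j\<in>UNIV. l (f j)))"
    using a by (intro volume_expansion) auto
  also have "\<dots> = (\<Sum>f\<in>{f :: 'n \<Rightarrow> nat. range f \<subseteq> {..<m}}.
       mvol (map K (map (\<lambda>i. f (uncoord i)) [0..<CARD('n)]))
         * prod_list (map l (map (\<lambda>i. f (uncoord i)) [0..<CARD('n)])))"
  proof (intro sum.cong refl arg_cong2[of _ _ _ _ "(*)"])
    fix f :: "'n \<Rightarrow> nat" assume f: "f \<in> {f. range f \<subseteq> {..<m}}"
    have eq: "map K (map (\<lambda>i. f (uncoord i)) [0..<CARD('n)]) = map (\<lambda>i. (K \<circ> f) (uncoord i)) [0..<CARD('n)]"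
      by simp
    have "bodies (map (\<lambda>i. (K \<circ> f) (uncoord i)) [0..<CARD('n)])"
      using a f by (auto simp: bodies_def)
    then show "polar (\<lambda>j. K (f j)) = mvol (map K (map (\<lambda>i. f (uncoord i)) [0..<CARD('n)]))"
      unfolding eq mvol_def by simp
    show "(\<Prod>j\<in>UNIV. l (f j)) = prod_list (map l (map (\<lambda>i. f (uncoord i)) [0..<CARD('n)]))"
      using prod_list_map_coord[of "\<lambda>j. l (f j)"] by (simp add: o_def)
  qed
  also have "\<dots> = (\<Sum>is\<in>{is. length is = CARD('n) \<and> set is \<subseteq> {..<m}}. mvol (map K is) * prod_list (map l is))"
    by (rule sum_lists_eq_sum_funs[symmetric])
  finally show "vol (\<Sum>i<m. dilate (l i) (K i)) =
      (\<Sum>is\<in>{is. length is = DIM(real^'n) \<and> set is \<subseteq> {..<m}}. mvol (map K is) * prod_list (map l is))"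
    by simp
next
  fix Ks :: "(real^'n) set list"
  assume "\<not> (length Ks = DIM(real^'n) \<and> (\<forall>K\<in>set Ks. convex_body K))"
  then show "mvol Ks = 0" by (auto simp: mvol_def bodies_def)
qed (rule mvol_mset)

text \<open>Weights zero and one express the volumes of all partial sums through \<open>V\<close>.
  In the alternating formula only the rearrangements of \<open>Ks\<close> remain, and by symmetry
  each of them contributes \<open>V Ks\<close>.\<close>

lemma is_mixed_volume_unique:
  assumes V: "is_mixed_volume (V :: (real^'n) set list \<Rightarrow> real)"
  shows "V = mvol"
proof
  fix Ks :: "(real^'n) set list"
  show "V Ks = mvol Ks"
  proof (cases "bodies Ks")
    case False
    then show ?thesis using V by (auto simp: is_mixed_volume_def mvol_def bodies_def)
  next
    case True
    then have len: "length Ks = CARD('n)" and bd: "\<And>i. i < CARD('n) \<Longrightarrow> convex_body (Ks ! i)"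
      by (auto simp: bodies_def)
    let ?c = "coord :: 'n \<Rightarrow> nat"
    let ?L = "\<lambda>f :: 'n \<Rightarrow> 'n. map (\<lambda>i. Ks ! ?c (f (uncoord i))) [0..<CARD('n)]"
    have expand: "vol (\<Sum>j\<in>S. Ks ! ?c j) = (\<Sum>h\<in>{h. range h \<subseteq> S}. V (?L h))" for S
    proof -
      \<comment> \<open>These weights switch on exactly the bodies indexed by
        \<open>S\<close>.\<close>
      let ?l = "\<lambda>i. if i \<in> ?c ` S then 1 else 0 :: real"
      have "(\<Sum>i<CARD('n). dilate (?l i) (Ks ! i)) = (\<Sum>i\<in>?c ` S. Ks ! i)"
      proof (rule sum.mono_neutral_cong_right)
        show "\<forall>i\<in>{..<CARD('n)} - ?c ` S. dilate (?l i) (Ks ! i) = 0"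
          using bd by (auto simp: convex_body_def)
      qed auto
      also have "\<dots> = (\<Sum>j\<in>S. Ks ! ?c j)"
        using inj_coord by (subst sum.reindex) (auto intro: inj_on_subset)
      finally have "vol (\<Sum>j\<in>S. Ks ! ?c j) = vol (\<Sum>i<CARD('n). dilate (?l i) (Ks ! i))" by simp
      also have "\<dots> = (\<Sum>is\<in>{is. length is = CARD('n) \<and> set is \<subseteq> {..<CARD('n)}}.
          V (map ((!) Ks) is) * prod_list (map ?l is))"
        using V bd unfolding is_mixed_volume_def by simp
      also have "\<dots> = (\<Sum>f\<in>{f :: 'n \<Rightarrow> nat. range f \<subseteq> {..<CARD('n)}}.
         V (map ((!) Ks) (map (\<lambda>i. f (uncoord i)) [0..<CARD('n)]))
         * prod_list (map ?l (map (\<lambda>i. f (uncoord i)) [0..<CARD('n)])))"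
        by (rule sum_lists_eq_sum_funs)
      also have "\<dots> = (\<Sum>f\<in>{f :: 'n \<Rightarrow> nat. range f \<subseteq> {..<CARD('n)}}.
         if range f \<subseteq> ?c ` S then V (map (\<lambda>i. Ks ! f (uncoord i)) [0..<CARD('n)]) else 0)"
      proof (intro sum.cong refl)
        fix f :: "'n \<Rightarrow> nat"
        have "prod_list (map ?l (map (\<lambda>i. f (uncoord i)) [0..<CARD('n)])) = (\<Prod>j\<in>UNIV. ?l (f j))"
          using prod_list_map_coord[of "\<lambda>j. ?l (f j)"] by (simp add: o_def)
        also have "\<dots> = (if range f \<subseteq> ?c ` S then 1 else 0)"
          by (auto simp: image_subset_iff intro: prod.neutral)
        finally show "V (map ((!) Ks) (map (\<lambda>i. f (uncoord i)) [0..<CARD('n)]))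
         * prod_list (map ?l (map (\<lambda>i. f (uncoord i)) [0..<CARD('n)])) =
         (if range f \<subseteq> ?c ` S then V (map (\<lambda>i. Ks ! f (uncoord i)) [0..<CARD('n)]) else 0)"
          by (simp add: o_def)
      qed
      also have "\<dots> = (\<Sum>f\<in>{f :: 'n \<Rightarrow> nat. range f \<subseteq> ?c ` S}. V (map (\<lambda>i. Ks ! f (uncoord i)) [0..<CARD('n)]))"
      proof (rule sum.mono_neutral_cong_right)
        show "finite {f :: 'n \<Rightarrow> nat. range f \<subseteq> {..<CARD('n)}}" by (rule finite_range_subset) simp
      qed (auto simp: image_subset_iff, metis coord_less imageE)
      also have "(\<Sum>f\<in>{f :: 'n \<Rightarrow> nat. range f \<subseteq> ?c ` S}. V (map (\<lambda>i. Ks ! f (uncoord i)) [0..<CARD('n)]))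
        = (\<Sum>h\<in>{h. range h \<subseteq> S}. V (?L h))"
      proof (rule sum.reindex_bij_witness[of _ "\<lambda>h. ?c \<circ> h" "\<lambda>f. uncoord \<circ> f"])
        fix f :: "'n \<Rightarrow> nat" assume f: "f \<in> {f. range f \<subseteq> ?c ` S}"
        have fS: "\<exists>s\<in>S. f j = ?c s" for j using f by auto
        have cf: "?c (uncoord (f j)) = f j" for j using fS[of j] by auto
        show eq: "?c \<circ> (uncoord \<circ> f) = f"
          by (simp add: fun_eq_iff cf)
        show "uncoord \<circ> f \<in> {h. range h \<subseteq> S}"
        proof -
          have "uncoord (f j) \<in> S" for j using fS[of j] by auto
          then show ?thesis by auto
        qed
        show "V (?L (uncoord \<circ> f)) = V (map (\<lambda>i. Ks ! f (uncoord i)) [0..<CARD('n)])"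
          by (simp add: cf)
      next
        fix h :: "'n \<Rightarrow> 'n" assume "h \<in> {h. range h \<subseteq> S}"
        then show "uncoord \<circ> (?c \<circ> h) = h" "?c \<circ> h \<in> {f. range f \<subseteq> ?c ` S}"
          by (auto simp: fun_eq_iff)
      qed
      finally show ?thesis .
    qed
    have sym: "V (?L p) = V Ks" if p: "p permutes UNIV" for p :: "'n \<Rightarrow> 'n"
    proof -
      define q where "q i = (if i < CARD('n) then ?c (p (uncoord i)) else i)" for i
      have "bij_betw (\<lambda>i. ?c (p (uncoord i))) {..<CARD('n)} {..<CARD('n)}"
        using bij_betw_trans[OF bij_betw_trans[OF bij_uncoord permutes_imp_bij[OF p]] bij_coord]
        by (simp add: o_def)
      then have "bij_betw q {..<CARD('n)} {..<CARD('n)}"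
        by (subst bij_betw_cong[of _ _ "\<lambda>i. ?c (p (uncoord i))"]) (auto simp: q_def)
      then have "q permutes {..<length Ks}"
        by (intro bij_imp_permutes) (auto simp: len q_def)
      then have "mset (permute_list q Ks) = mset Ks" by simp
      moreover have "permute_list q Ks = ?L p"
        by (auto simp: permute_list_def len q_def)
      ultimately show ?thesis using V unfolding is_mixed_volume_def by metis
    qed
    have "polar (\<lambda>j. Ks ! ?c j) = (\<Sum>p | p permutes (UNIV :: 'n set). V (?L p)) / fact CARD('n)"
      unfolding polar_def expand by (simp only: alternating_sum_range_subset)
    also have "\<dots> = V Ks"
      by (simp add: sym card_permutations[OF refl])
    finally show ?thesis using True by (simp add: mvol_def)
  qed
qed

lemma mixed_volume_eq_mvol: "(mixed_volume :: (real^'n) set list \<Rightarrow> real) = mvol"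
  unfolding mixed_volume_def using is_mixed_volume_mvol is_mixed_volume_unique by (rule the_equality)

lemma is_mixed_volume_mixed_volume: "is_mixed_volume (mixed_volume :: (real^'n) set list \<Rightarrow> real)"
  by (simp add: mixed_volume_eq_mvol is_mixed_volume_mvol)

lemma polar_translation:
  fixes K :: "'n::finite \<Rightarrow> 'a::euclidean_space set"
  shows "polar (\<lambda>j. (+) (c j) ` K j) = polar K"
proof -
  have "(\<Sum>j\<in>S. (+) (c j) ` K j) = (+) (sum c S) ` sum K S" for S
  proof (induction S rule: infinite_finite_induct)
    case (insert j S)
    have "(+) (c j) ` K j + (+) (sum c S) ` sum K S = (+) (c j + sum c S) ` (K j + sum K S)"
      by (auto simp: set_plus_def image_iff algebra_simps) (metis add.assoc add.left_commute)+
    then show ?case using insert by simp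
  qed auto
  then show ?thesis by (simp add: polar_def measure_translation)
qed

subsection \<open>Expansion of the volume along a fixed body\<close>

lemma lists_Suc_conv:
  "{xs. length xs = Suc n \<and> set xs \<subseteq> B} = (\<lambda>(b, xs). b # xs) ` (B \<times> {xs. length xs = n \<and> set xs \<subseteq> B})"
  by (auto simp: length_Suc_conv image_iff)

lemma sum_lists_Suc:
  fixes F :: "'i list \<Rightarrow> real"
  assumes "finite B"
  shows "(\<Sum>xs\<in>{xs. length xs = Suc n \<and> set xs \<subseteq> B}. F xs) =
    (\<Sum>b\<in>B. \<Sum>xs\<in>{xs. length xs = n \<and> set xs \<subseteq> B}. F (b # xs))"
  unfolding lists_Suc_conv
  by (subst sum.reindex) (auto simp: inj_on_def sum.cartesian_product case_prod_beta)

lemma pascal_sum: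
  fixes a :: "nat \<Rightarrow> real"
  shows "(\<Sum>k\<le>n. of_nat (n choose k) * a (Suc k)) + (\<Sum>k\<le>n. of_nat (n choose k) * a k) =
    (\<Sum>k\<le>Suc n. of_nat (Suc n choose k) * a k)"
proof -
  have "(\<Sum>k\<le>n. of_nat (n choose k) * a k) = (\<Sum>k\<le>Suc n. of_nat (n choose k) * a k)"
    by simp
  also have "\<dots> = a 0 + (\<Sum>k\<le>n. of_nat (n choose Suc k) * a (Suc k))"
    by (subst sum.atMost_Suc_shift) simp
  finally have "(\<Sum>k\<le>n. of_nat (n choose k) * a k) = a 0 + (\<Sum>k\<le>n. of_nat (n choose Suc k) * a (Suc k))" .
  moreover have "(\<Sum>k\<le>Suc n. of_nat (Suc n choose k) * a k) =
      a 0 + (\<Sum>k\<le>n. of_nat (Suc n choose Suc k) * a (Suc k))"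
    by (subst sum.atMost_Suc_shift) simp
  ultimately show ?thesis
    by (simp add: sum.distrib[symmetric] algebra_simps del: sum.atMost_Suc)
qed

text \<open>A function of multisets does not see where \<open>m\<close> occurs, so lists are grouped
  by the number of its occurrences. The induction splits off the head of the list and uses Pascal's
  rule.\<close>

lemma sum_symmetric_binomial:
  fixes G :: "'i multiset \<Rightarrow> real" and l :: "'i \<Rightarrow> real"
  assumes A: "finite A" "m \<notin> A"
  shows "(\<Sum>xs\<in>{xs. length xs = n \<and> set xs \<subseteq> insert m A}. G (mset xs) * prod_list (map l xs)) =
    (\<Sum>k\<le>n. of_nat (n choose k) * (l m ^ (n - k) *
       (\<Sum>xs\<in>{xs. length xs = k \<and> set xs \<subseteq> A}. G (mset xs + replicate_mset (n - k) m) * prod_list (map l xs))))"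
proof (induction n arbitrary: G)
  case 0
  have "{xs. xs = [] \<and> set xs \<subseteq> B} = {[]}" for B :: "'i set" by auto
  then show ?case by simp
next
  case (Suc n)
  let ?L = "\<lambda>k B. {xs :: 'i list. length xs = k \<and> set xs \<subseteq> B}"
  define S where "S N k G = (\<Sum>xs\<in>?L k A. G (mset xs + replicate_mset (N - k) m) * prod_list (map l xs))"
    for N k and G :: "'i multiset \<Rightarrow> real"
  define a where "a k = l m ^ (Suc n - k) * S (Suc n) k G" for k
  have fin: "finite (insert m A)" using A by simp
  have "(\<Sum>xs\<in>?L (Suc n) (insert m A). G (mset xs) * prod_list (map l xs)) =
     (\<Sum>b\<in>insert m A. l b * (\<Sum>xs\<in>?L n (insert m A). G (add_mset b (mset xs)) * prod_list (map l xs)))"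
    by (subst sum_lists_Suc[OF fin]) (simp add: sum_distrib_left mult_ac)
  also have "\<dots> = (\<Sum>b\<in>insert m A. l b * (\<Sum>k\<le>n. of_nat (n choose k) * (l m ^ (n - k) * S n k (\<lambda>X. G (add_mset b X)))))"
    unfolding S_def by (subst Suc.IH) simp
  also have "\<dots> = l m * (\<Sum>k\<le>n. of_nat (n choose k) * (l m ^ (n - k) * S n k (\<lambda>X. G (add_mset m X)))) +
     (\<Sum>b\<in>A. l b * (\<Sum>k\<le>n. of_nat (n choose k) * (l m ^ (n - k) * S n k (\<lambda>X. G (add_mset b X)))))"
    using A by simp
  also have "l m * (\<Sum>k\<le>n. of_nat (n choose k) * (l m ^ (n - k) * S n k (\<lambda>X. G (add_mset m X)))) =
      (\<Sum>k\<le>n. of_nat (n choose k) * a k)"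
    unfolding sum_distrib_left
  proof (rule sum.cong[OF refl])
    fix k assume "k \<in> {..n}"
    then have k: "Suc n - k = Suc (n - k)" by auto
    show "l m * (of_nat (n choose k) * (l m ^ (n - k) * S n k (\<lambda>X. G (add_mset m X)))) = of_nat (n choose k) * a k"
      by (simp add: a_def S_def k)
  qed
  also have "(\<Sum>b\<in>A. l b * (\<Sum>k\<le>n. of_nat (n choose k) * (l m ^ (n - k) * S n k (\<lambda>X. G (add_mset b X))))) =
      (\<Sum>k\<le>n. of_nat (n choose k) * (l m ^ (n - k) * (\<Sum>b\<in>A. l b * S n k (\<lambda>X. G (add_mset b X)))))"
    unfolding sum_distrib_left by (subst sum.swap) (simp add: mult_ac)
  also have "\<dots> = (\<Sum>k\<le>n. of_nat (n choose k) * a (Suc k))"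
  proof (rule sum.cong[OF refl])
    fix k
    have "(\<Sum>b\<in>A. l b * S n k (\<lambda>X. G (add_mset b X))) = S (Suc n) (Suc k) G"
      unfolding S_def by (subst sum_lists_Suc[OF A(1)]) (simp add: sum_distrib_left mult_ac)
    then show "of_nat (n choose k) * (l m ^ (n - k) * (\<Sum>b\<in>A. l b * S n k (\<lambda>X. G (add_mset b X)))) =
        of_nat (n choose k) * a (Suc k)"
      by (simp add: a_def)
  qed
  finally show ?case
    by (simp only: pascal_sum[of n a, symmetric] a_def[symmetric] S_def[symmetric] add.commute)
qed

text \<open>\<open>M\<close> becomes one more body with index \<open>m\<close>. Seen as a polynomial
  in \<open>t\<close>, the volume has as coefficients the mixed volumes with a fixed number of
  copies of \<open>M\<close>.\<close>

lemma volume_binomial_expansion: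
  fixes A :: "nat \<Rightarrow> (real^'n) set" and x :: "nat \<Rightarrow> real"
  assumes A: "\<And>i. i < m \<Longrightarrow> convex_body (A i)" and M: "convex_body M"
    and x: "\<And>i. i < m \<Longrightarrow> 0 \<le> x i" and t: "0 \<le> t"
  shows "vol ((\<Sum>i<m. dilate (x i) (A i)) + dilate t M) =
    (\<Sum>k\<le>CARD('n). of_nat (CARD('n) choose k) * (t ^ (CARD('n) - k) *
       (\<Sum>js\<in>{js. length js = k \<and> set js \<subseteq> {..<m}}.
          mixed_volume (map A js @ replicate (CARD('n) - k) M) * prod_list (map x js))))"
proof -
  define K where "K i = (if i < m then A i else M)" for i
  define l where "l i = (if i < m then x i else t)" for i
  let ?V = "mixed_volume :: (real^'n) set list \<Rightarrow> real"
  \<comment> \<open>Any ordering of the multiset will do, because \<open>mixed_volume\<close> is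
    symmetric.\<close>
  define G where "G X = ?V (SOME Ks. mset Ks = image_mset K X)" for X
  have sym: "?V Ks = ?V Ls" if "mset Ks = mset Ls" for Ks Ls
    using is_mixed_volume_mixed_volume that unfolding is_mixed_volume_def by blast
  have G: "?V Ks = G X" if "mset Ks = image_mset K X" for Ks X
    unfolding G_def by (rule sym) (use that someI[of "\<lambda>Ks. mset Ks = image_mset K X" Ks] in simp)
  have ins: "{..<Suc m} = insert m {..<m}" by auto
  have "(\<Sum>i<m. dilate (x i) (A i)) + dilate t M = (\<Sum>i<Suc m. dilate (l i) (K i))"
    by (simp add: K_def l_def)
  also have "vol \<dots> = (\<Sum>is\<in>{is. length is = CARD('n) \<and> set is \<subseteq> {..<Suc m}}. ?V (map K is) * prod_list (map l is))"
  proof -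
    have "\<forall>i<Suc m. convex_body (K i) \<and> 0 \<le> l i"
      using A M x t by (simp add: K_def l_def)
    then have "vol (\<Sum>i<Suc m. dilate (l i) (K i)) =
        (\<Sum>is\<in>{is. length is = DIM(real^'n) \<and> set is \<subseteq> {..<Suc m}}. ?V (map K is) * prod_list (map l is))"
      using is_mixed_volume_mixed_volume[where 'n = 'n] unfolding is_mixed_volume_def by blast
    then show ?thesis by simp
  qed
  also have "\<dots> = (\<Sum>is\<in>{is. length is = CARD('n) \<and> set is \<subseteq> insert m {..<m}}. G (mset is) * prod_list (map l is))"
    unfolding ins by (intro sum.cong refl arg_cong2[of _ _ _ _ "(*)"] G) simp
  also have "\<dots> = (\<Sum>k\<le>CARD('n). of_nat (CARD('n) choose k) * (l m ^ (CARD('n) - k) *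
       (\<Sum>xs\<in>{xs. length xs = k \<and> set xs \<subseteq> {..<m}}. G (mset xs + replicate_mset (CARD('n) - k) m) * prod_list (map l xs))))"
    by (rule sum_symmetric_binomial) auto
  also have "\<dots> = (\<Sum>k\<le>CARD('n). of_nat (CARD('n) choose k) * (t ^ (CARD('n) - k) *
       (\<Sum>js\<in>{js. length js = k \<and> set js \<subseteq> {..<m}}.
          ?V (map A js @ replicate (CARD('n) - k) M) * prod_list (map x js))))"
  proof (intro sum.cong refl arg_cong2[of _ _ _ _ "(*)"])
    show "l m ^ (CARD('n) - k) = t ^ (CARD('n) - k)" for k by (simp add: l_def)
    fix k js assume "js \<in> {js. length js = k \<and> set js \<subseteq> {..<m}}"
    then have js: "\<forall>j\<in>set js. j < m" by auto
    then show "prod_list (map l js) = prod_list (map x js)"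
      by (intro arg_cong[of _ _ prod_list] map_cong) (auto simp: l_def)
    have "map K js = map A js" using js by (auto simp: K_def)
    then have "image_mset K (mset js) = mset (map A js)" by (metis mset_map)
    then show "G (mset js + replicate_mset (CARD('n) - k) m) = ?V (map A js @ replicate (CARD('n) - k) M)"
      by (intro G[symmetric]) (simp add: K_def mset_replicate image_replicate_mset)
  qed
  finally show ?thesis .
qed

text \<open>Lagrange interpolation at the nodes \<open>0, ..., n\<close>: the weights are the
  coefficients of the basis polynomials \<open>L j\<close> and are the same for all
  \<open>c\<close>.\<close>

lemma ex_coefficient_functional:
  "\<exists>\<gamma> :: nat \<Rightarrow> nat \<Rightarrow> real. \<forall>c i. i \<le> n \<longrightarrow> c i = (\<Sum>j\<le>n. \<gamma> i j * (\<Sum>l\<le>n. c l * real j ^ l))"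
proof -
  define L :: "nat \<Rightarrow> real poly" where
    "L j = smult (1 / (\<Prod>k\<in>{..n} - {j}. real j - real k)) (\<Prod>k\<in>{..n} - {j}. [:- real k, 1:])" for j
  have deg: "degree (L j) \<le> n" if "j \<le> n" for j
  proof -
    have "degree (\<Prod>k\<in>{..n} - {j}. [:- real k, 1:]) \<le> sum (degree \<circ> (\<lambda>k. [:- real k, 1:])) ({..n} - {j})"
      by (rule degree_prod_sum_le) simp
    also have "\<dots> = n" using that by (simp add: card_Diff_singleton)
    finally show ?thesis unfolding L_def by (meson degree_smult_le order_trans)
  qed
  have val: "poly (L j) (real i) = (if i = j then 1 else 0)" if "i \<le> n" "j \<le> n" for i j
    using that by (auto simp: L_def poly_prod prod_zero_iff)
  have "c i = (\<Sum>j\<le>n. coeff (L j) i * (\<Sum>l\<le>n. c l * real j ^ l))" if "i \<le> n" for c :: "nat \<Rightarrow> real" and i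
  proof -
    define p where "p = (\<Sum>l\<le>n. monom (c l) l)"
    have pv: "poly p y = (\<Sum>l\<le>n. c l * y ^ l)" for y by (simp add: p_def poly_sum poly_monom)
    have dp: "degree p \<le> n" unfolding p_def
      by (intro degree_sum_le) (auto intro: order_trans[OF degree_monom_le])
    define q where "q = (\<Sum>j\<le>n. smult (poly p (real j)) (L j))"
    have dq: "degree q \<le> n" unfolding q_def
      by (intro degree_sum_le) (auto simp: deg)
    have "poly q (real i) = poly p (real i)" if "i \<le> n" for i
      using that by (simp add: q_def poly_sum val if_distrib[of "(*) _"] cong: if_cong)
    then have "p = q"
      by (intro poly_eqI_degree[of "real ` {..n}"])
        (use dp dq in \<open>auto simp: card_image inj_on_def\<close>)
    then have "coeff p i = coeff q i" by simp
    moreover have "coeff p i = c i" using that by (simp add: p_def coeff_sum)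
    moreover have "coeff q i = (\<Sum>j\<le>n. coeff (L j) i * (\<Sum>l\<le>n. c l * real j ^ l))"
      by (simp add: q_def coeff_sum pv mult.commute)
    ultimately show ?thesis by simp
  qed
  then show ?thesis by (intro exI[of _ "\<lambda>i j. coeff (L j) i"]) blast
qed

text \<open>Up to binomial factors, the coefficients of \<open>vol (A + dilate t M)\<close> as a
  polynomial in \<open>t\<close>; \<open>k = 2\<close> gives the quadratic form of the
  theorem.\<close>

definition mvk :: "(real^'n) set \<Rightarrow> nat \<Rightarrow> (real^'n) set \<Rightarrow> real" where
  "mvk M k A = mixed_volume (replicate k A @ replicate (CARD('n) - k) M)"

lemma volume_mvk_expansion:
  fixes A M :: "(real^'n) set"
  assumes "convex_body A" "convex_body M" "0 \<le> t"
  shows "vol (A + dilate t M) =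
    (\<Sum>k\<le>CARD('n). of_nat (CARD('n) choose k) * (t ^ (CARD('n) - k) * mvk M k A))"
proof -
  have "{js. length js = k \<and> set js \<subseteq> {..<1}} = {replicate k (0::nat)}" for k
    by (auto intro!: replicate_eqI)
  then show ?thesis
    using volume_binomial_expansion[of 1 "\<lambda>_. A" M "\<lambda>_. 1" t] assms
    by (simp add: mvk_def)
qed

lemma ex_mvk_functional:
  "\<exists>\<gamma> :: nat \<Rightarrow> nat \<Rightarrow> real. \<forall>p q. (\<forall>t\<ge>0. p t =
      (\<Sum>k\<le>n. of_nat (n choose k) * (t ^ (n - k) * q k))) \<longrightarrow>
      (\<forall>k\<le>n. q k = (\<Sum>j\<le>n. \<gamma> k j * p (real j)))"
proof -
  obtain \<gamma> :: "nat \<Rightarrow> nat \<Rightarrow> real" where \<gamma>: "\<And>c i. i \<le> n \<Longrightarrow> c i = (\<Sum>j\<le>n. \<gamma> i j * (\<Sum>l\<le>n. c l * real j ^ l))"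
    using ex_coefficient_functional[of n] by blast
  have "q k = (\<Sum>j\<le>n. \<gamma> (n - k) j / of_nat (n choose k) * p (real j))"
    if p: "\<forall>t\<ge>0. p t = (\<Sum>k\<le>n. of_nat (n choose k) * (t ^ (n - k) * q k))" and k: "k \<le> n"
    for p q :: "_ \<Rightarrow> real" and k
  proof -
    define c where "c l = of_nat (n choose l) * q (n - l)" for l
    have "p (real j) = (\<Sum>l\<le>n. c l * real j ^ l)" for j
    proof -
      have "p (real j) = (\<Sum>k\<le>n. of_nat (n choose k) * (real j ^ (n - k) * q k))" using p by simp
      also have "\<dots> = (\<Sum>l\<le>n. c l * real j ^ l)"
        by (rule sum.reindex_bij_witness[of _ "\<lambda>l. n - l" "\<lambda>l. n - l"])
          (auto simp: c_def binomial_symmetric[symmetric])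
      finally show ?thesis .
    qed
    then have "c (n - k) = (\<Sum>j\<le>n. \<gamma> (n - k) j * p (real j))"
      using \<gamma>[of "n - k" c] by simp
    moreover have "c (n - k) = of_nat (n choose k) * q k"
      using k by (simp add: c_def binomial_symmetric[symmetric])
    ultimately have "q k = (\<Sum>j\<le>n. \<gamma> (n - k) j * p (real j)) / of_nat (n choose k)"
      using k by (simp add: eq_divide_eq mult.commute)
    then show ?thesis by (simp add: sum_divide_distrib)
  qed
  then show ?thesis by (intro exI[of _ "\<lambda>k j. \<gamma> (n - k) j / of_nat (n choose k)"] allI impI) simp
qed

text \<open>Weights that recover the coefficients of a polynomial of degree at most \<open>n\<close> in \<open>t\<close> from its
  values at \<open>0, \<dots>, n\<close>.\<close>

definition mv_coeff :: "nat \<Rightarrow> nat \<Rightarrow> nat \<Rightarrow> real" where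
  "mv_coeff n = (SOME \<gamma>. \<forall>p q. (\<forall>t\<ge>0. p t =
      (\<Sum>k\<le>n. of_nat (n choose k) * (t ^ (n - k) * q k))) \<longrightarrow>
      (\<forall>k\<le>n. q k = (\<Sum>j\<le>n. \<gamma> k j * p (real j))))"

lemma mv_coeff:
  assumes "\<And>t. t \<ge> 0 \<Longrightarrow> p t = (\<Sum>k\<le>n. of_nat (n choose k) * (t ^ (n - k) * q k))" and "k \<le> n"
  shows "q k = (\<Sum>j\<le>n. mv_coeff n k j * p (real j))"
  using someI_ex[OF ex_mvk_functional[of n], folded mv_coeff_def, rule_format, of p q k] assms by simp

text \<open>A mixed volume with copies of \<open>M\<close> is a fixed linear combination of volumes.
  This is how translation invariance, slicing and limits pass from volumes to mixed volumes.\<close>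

lemma mvk_eq_mv_coeff:
  fixes A M :: "(real^'n) set"
  assumes "convex_body A" "convex_body M" "k \<le> CARD('n)"
  shows "mvk M k A = (\<Sum>j\<le>CARD('n). mv_coeff CARD('n) k j * vol (A + dilate (real j) M))"
  by (rule mv_coeff[OF volume_mvk_expansion[OF assms(1,2)] assms(3)])

lemma mvk_sum:
  fixes A :: "nat \<Rightarrow> (real^'n) set" and x :: "nat \<Rightarrow> real"
  assumes A: "\<And>i. i < m \<Longrightarrow> convex_body (A i)" and M: "convex_body M"
    and x: "\<And>i. i < m \<Longrightarrow> 0 \<le> x i" and k: "k \<le> CARD('n)"
  shows "mvk M k (\<Sum>i<m. dilate (x i) (A i)) =
    (\<Sum>js\<in>{js. length js = k \<and> set js \<subseteq> {..<m}}.
          mixed_volume (map A js @ replicate (CARD('n) - k) M) * prod_list (map x js))"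
proof -
  have "convex_body (\<Sum>i<m. dilate (x i) (A i))"
    using A by (intro convex_body_sum convex_body_dilate) auto
  then show ?thesis
    using mvk_eq_mv_coeff[OF _ M k] by (subst mv_coeff[OF volume_binomial_expansion[OF A M x] k]) simp_all
qed

subsection \<open>Slicing\<close>

definition slice :: "'a::euclidean_space \<Rightarrow> 'a set \<Rightarrow> real \<Rightarrow> 'a set" where
  "slice w X s = {x \<in> X. x \<bullet> w = s}"

abbreviation seg :: "'a::euclidean_space \<Rightarrow> 'a set" where
  "seg w \<equiv> closed_segment 0 w"

lemma mem_slice_plus_seg:
  assumes w: "norm w = 1"
  shows "y \<in> slice w X s + seg w \<longleftrightarrow> s \<le> y \<bullet> w \<and> y \<bullet> w \<le> s + 1 \<and> y - (y \<bullet> w - s) *\<^sub>R w \<in> X"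
proof
  have ww: "w \<bullet> w = 1" using w by (simp add: norm_eq_1)
  show "s \<le> y \<bullet> w \<and> y \<bullet> w \<le> s + 1 \<and> y - (y \<bullet> w - s) *\<^sub>R w \<in> X" if "y \<in> slice w X s + seg w"
    using that by (auto elim!: set_plus_elim simp: slice_def in_segment inner_add_left ww)
  assume a: "s \<le> y \<bullet> w \<and> y \<bullet> w \<le> s + 1 \<and> y - (y \<bullet> w - s) *\<^sub>R w \<in> X"
  then have "y - (y \<bullet> w - s) *\<^sub>R w \<in> slice w X s" by (simp add: slice_def inner_diff_left ww)
  moreover have "(y \<bullet> w - s) *\<^sub>R w \<in> seg w" using a by (auto simp: in_segment intro!: exI[of _ "y \<bullet> w - s"])
  ultimately have "(y - (y \<bullet> w - s) *\<^sub>R w) + (y \<bullet> w - s) *\<^sub>R w \<in> slice w X s + seg w" by (rule set_plus_intro)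
  then show "y \<in> slice w X s + seg w" by simp
qed

lemma emeasure_lborel_translate:
  fixes A :: "'a::euclidean_space set"
  assumes A: "A \<in> sets borel"
  shows "emeasure lborel {x. x + a \<in> A} = emeasure lborel A"
proof -
  have "emeasure lborel A = emeasure (distr lborel borel ((+) a)) A"
    by (simp add: lborel_distr_plus)
  also have "\<dots> = emeasure lborel {x. x + a \<in> A}"
    using A by (subst emeasure_distr) (auto simp: vimage_def add.commute)
  finally show ?thesis by simp
qed

text \<open>Cavalieri's principle without a measure on the hyperplane: thickening a slice by the
  unit segment turns its area into a volume. After Fubini, a shift of \<open>s\<close> for fixed
  \<open>y\<close> and a shift of \<open>y\<close> for fixed \<open>s\<close> leave, for each point
  of \<open>X\<close>, an interval of heights of length one.\<close>

lemma emeasure_slices: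
  fixes X :: "'a::euclidean_space set"
  assumes w: "norm w = 1" and X [measurable]: "X \<in> sets borel"
  shows "(\<lambda>s. emeasure lborel (slice w X s + seg w)) \<in> borel_measurable borel"
    and "(\<integral>\<^sup>+ s. emeasure lborel (slice w X s + seg w) \<partial>lborel) = emeasure lborel X"
proof -
  have ww: "w \<bullet> w = 1" using w by (simp add: norm_eq_1)
  let ?A = "\<lambda>y s. of_bool (0 \<le> y \<bullet> w \<and> y \<bullet> w \<le> 1) * indicator X (y + (s - y \<bullet> w) *\<^sub>R w) :: ennreal"
  have e1: "emeasure lborel (slice w X s + seg w) = (\<integral>\<^sup>+ y. ?A y s \<partial>lborel)" for s
  proof -
    have S: "slice w X s + seg w = {y. s \<le> y \<bullet> w \<and> y \<bullet> w \<le> s + 1 \<and> y - (y \<bullet> w - s) *\<^sub>R w \<in> X}"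
      using mem_slice_plus_seg[OF w] by auto
    have B: "slice w X s + seg w \<in> sets borel"
      unfolding S by measurable
    have "emeasure lborel (slice w X s + seg w) = emeasure lborel {y. y + s *\<^sub>R w \<in> slice w X s + seg w}"
      by (rule emeasure_lborel_translate[symmetric, OF B])
    also have "{y. y + s *\<^sub>R w \<in> slice w X s + seg w} = {y. (0 \<le> y \<bullet> w \<and> y \<bullet> w \<le> 1) \<and> y + (s - y \<bullet> w) *\<^sub>R w \<in> X}"
      unfolding S by (auto simp: inner_add_left ww algebra_simps)
    also have "emeasure lborel \<dots> = (\<integral>\<^sup>+ y. indicator {y. (0 \<le> y \<bullet> w \<and> y \<bullet> w \<le> 1) \<and> y + (s - y \<bullet> w) *\<^sub>R w \<in> X} y \<partial>lborel)"
      by (rule nn_integral_indicator[symmetric]) (use X in measurable)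
    also have "\<dots> = (\<integral>\<^sup>+ y. ?A y s \<partial>lborel)"
      by (intro nn_integral_cong) (auto simp: indicator_def)
    finally show ?thesis .
  qed
  show "(\<lambda>s. emeasure lborel (slice w X s + seg w)) \<in> borel_measurable borel"
    unfolding e1 by measurable
  have "(\<integral>\<^sup>+ s. emeasure lborel (slice w X s + seg w) \<partial>lborel) = (\<integral>\<^sup>+ s. \<integral>\<^sup>+ y. ?A y s \<partial>lborel \<partial>lborel)"
    unfolding e1 ..
  also have "\<dots> = (\<integral>\<^sup>+ y. \<integral>\<^sup>+ s. ?A y s \<partial>lborel \<partial>lborel)"
    by (rule lborel_pair.Fubini') measurable
  also have "\<dots> = (\<integral>\<^sup>+ y. \<integral>\<^sup>+ s. of_bool (0 \<le> y \<bullet> w \<and> y \<bullet> w \<le> 1) * indicator X (y + s *\<^sub>R w) \<partial>lborel \<partial>lborel)"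
  proof (rule nn_integral_cong)
    fix y
    show "(\<integral>\<^sup>+ s. ?A y s \<partial>lborel) = (\<integral>\<^sup>+ s. of_bool (0 \<le> y \<bullet> w \<and> y \<bullet> w \<le> 1) * indicator X (y + s *\<^sub>R w) \<partial>lborel)"
      by (subst nn_integral_real_affine[where c = 1 and t = "y \<bullet> w"]) simp_all
  qed
  also have "\<dots> = (\<integral>\<^sup>+ s. \<integral>\<^sup>+ y. of_bool (0 \<le> y \<bullet> w \<and> y \<bullet> w \<le> 1) * indicator X (y + s *\<^sub>R w) \<partial>lborel \<partial>lborel)"
    by (rule lborel_pair.Fubini') measurable
  also have "\<dots> = (\<integral>\<^sup>+ s. \<integral>\<^sup>+ y. of_bool (s \<le> y \<bullet> w \<and> y \<bullet> w \<le> s + 1) * indicator X y \<partial>lborel \<partial>lborel)"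
  proof (rule nn_integral_cong)
    fix s
    have "(\<integral>\<^sup>+ y. of_bool (0 \<le> y \<bullet> w \<and> y \<bullet> w \<le> 1) * indicator X (y + s *\<^sub>R w) \<partial>lborel)
        = (\<integral>\<^sup>+ y. indicator {y. y + s *\<^sub>R w \<in> {z \<in> X. s \<le> z \<bullet> w \<and> z \<bullet> w \<le> s + 1}} y \<partial>lborel)"
      by (intro nn_integral_cong) (auto simp: indicator_def inner_add_left ww)
    also have "\<dots> = emeasure lborel {y. y + s *\<^sub>R w \<in> {z \<in> X. s \<le> z \<bullet> w \<and> z \<bullet> w \<le> s + 1}}"
      by (rule nn_integral_indicator) measurable
    also have "\<dots> = emeasure lborel {z \<in> X. s \<le> z \<bullet> w \<and> z \<bullet> w \<le> s + 1}"
      by (rule emeasure_lborel_translate) measurable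
    also have "\<dots> = (\<integral>\<^sup>+ y. indicator {z \<in> X. s \<le> z \<bullet> w \<and> z \<bullet> w \<le> s + 1} y \<partial>lborel)"
      by (rule nn_integral_indicator[symmetric]) measurable
    also have "\<dots> = (\<integral>\<^sup>+ y. of_bool (s \<le> y \<bullet> w \<and> y \<bullet> w \<le> s + 1) * indicator X y \<partial>lborel)"
      by (intro nn_integral_cong) (auto simp: indicator_def)
    finally show "(\<integral>\<^sup>+ y. of_bool (0 \<le> y \<bullet> w \<and> y \<bullet> w \<le> 1) * indicator X (y + s *\<^sub>R w) \<partial>lborel)
        = (\<integral>\<^sup>+ y. of_bool (s \<le> y \<bullet> w \<and> y \<bullet> w \<le> s + 1) * indicator X y \<partial>lborel)" .
  qed
  also have "\<dots> = (\<integral>\<^sup>+ y. \<integral>\<^sup>+ s. of_bool (s \<le> y \<bullet> w \<and> y \<bullet> w \<le> s + 1) * indicator X y \<partial>lborel \<partial>lborel)"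
    by (rule lborel_pair.Fubini') measurable
  also have "\<dots> = (\<integral>\<^sup>+ y. indicator X y \<partial>lborel)"
  proof (rule nn_integral_cong)
    fix y
    have "(\<integral>\<^sup>+ s. of_bool (s \<le> y \<bullet> w \<and> y \<bullet> w \<le> s + 1) * indicator X y \<partial>lborel)
        = (\<integral>\<^sup>+ s. indicator X y * indicator {y \<bullet> w - 1..y \<bullet> w} s \<partial>lborel)"
      by (intro nn_integral_cong) (auto simp: indicator_def)
    also have "\<dots> = indicator X y"
      by (subst nn_integral_cmult_indicator) auto
    finally show "(\<integral>\<^sup>+ s. of_bool (s \<le> y \<bullet> w \<and> y \<bullet> w \<le> s + 1) * indicator X y \<partial>lborel) = indicator X y" .
  qed
  finally show "(\<integral>\<^sup>+ s. emeasure lborel (slice w X s + seg w) \<partial>lborel) = emeasure lborel X" by simp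
qed

lemma vol_eq_lborel: "X \<in> sets borel \<Longrightarrow> vol X = measure lborel X"
  by (simp add: measure_completion)

lemma emeasure_bounded:
  fixes X :: "'a::euclidean_space set"
  assumes "X \<in> sets borel" "bounded X"
  shows "emeasure lborel X = ennreal (vol X)"
proof -
  have "emeasure lborel X \<noteq> \<infinity>" using emeasure_bounded_finite[OF assms(2)] by simp
  then show ?thesis using assms(1) by (simp add: vol_eq_lborel emeasure_eq_ennreal_measure)
qed

lemma slice_plus_seg_borel:
  fixes X :: "'a::euclidean_space set"
  assumes w: "norm w = 1" and X [measurable]: "X \<in> sets borel"
  shows "slice w X s + seg w \<in> sets borel"
proof -
  have S: "slice w X s + seg w = {y. s \<le> y \<bullet> w \<and> y \<bullet> w \<le> s + 1 \<and> y - (y \<bullet> w - s) *\<^sub>R w \<in> X}"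
    using mem_slice_plus_seg[OF w] by auto
  show ?thesis unfolding S by measurable
qed

lemma bounded_set_plus: "bounded A \<Longrightarrow> bounded B \<Longrightarrow> bounded (A + B)"
  for A B :: "'a::real_normed_vector set"
  using bounded_plus[of A B] by (simp add: set_plus_image case_prod_beta)

lemma vol_slices:
  fixes X :: "'a::euclidean_space set"
  assumes w: "norm w = 1" and X: "X \<in> sets borel" "bounded X"
  shows "has_bochner_integral lborel (\<lambda>s. vol (slice w X s + seg w)) (vol X)"
proof (rule has_bochner_integral_nn_integral)
  have e: "emeasure lborel (slice w X s + seg w) = ennreal (vol (slice w X s + seg w))" for s
    using X by (intro emeasure_bounded slice_plus_seg_borel w bounded_set_plus)
      (auto simp: slice_def compact_imp_bounded intro: bounded_subset)
  have v: "vol (slice w X s + seg w) = enn2real (emeasure lborel (slice w X s + seg w))" for s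
    by (simp add: e)
  show "(\<lambda>s. vol (slice w X s + seg w)) \<in> borel_measurable lborel"
    unfolding v using emeasure_slices(1)[OF w X(1)] by simp
  show "(\<integral>\<^sup>+ s. ennreal (vol (slice w X s + seg w)) \<partial>lborel) = ennreal (vol X)"
    using emeasure_slices(2)[OF w X(1)] by (simp add: e[symmetric] emeasure_bounded[OF X])
qed auto

lemma slice_plus_horizontal:
  assumes "\<And>x. x \<in> M \<Longrightarrow> x \<bullet> w = 0"
  shows "slice w (K + M) s = slice w K s + M"
proof (intro equalityI subsetI)
  fix y assume "y \<in> slice w (K + M) s"
  then obtain k m where "y = k + m" "k \<in> K" "m \<in> M" "(k + m) \<bullet> w = s"
    by (auto simp: slice_def elim: set_plus_elim)
  then show "y \<in> slice w K s + M"
    using assms by (auto simp: slice_def inner_add_left)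
next
  fix y assume "y \<in> slice w K s + M"
  then show "y \<in> slice w (K + M) s"
    using assms by (auto simp: slice_def inner_add_left elim!: set_plus_elim)
qed

lemma compact_slice: "compact K \<Longrightarrow> compact (slice w K s)"
  unfolding slice_def by (rule compact_Int_closed[of K "{x. x \<bullet> w = s}", simplified Int_def mem_Collect_eq])
    (auto intro!: closed_Collect_eq continuous_intros)

lemma convex_slice: "convex K \<Longrightarrow> convex (slice w K s)"
proof -
  assume "convex K"
  then have "convex (K \<inter> {x. w \<bullet> x = s})" by (intro convex_Int convex_hyperplane)
  then show ?thesis by (simp add: slice_def Int_def inner_commute)
qed

lemma convex_body_slice: "convex_body K \<Longrightarrow> slice w K s \<noteq> {} \<Longrightarrow> convex_body (slice w K s)"
  by (simp add: convex_body_def compact_slice convex_slice)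

lemma convex_body_seg [simp]: "convex_body (seg w)"
  by (simp add: convex_body_def)

lemma mixed_volume_not_body:
  fixes K :: "(real^'n) set"
  assumes "K \<in> set Ks" "\<not> convex_body K"
  shows "mixed_volume Ks = 0"
  using assms is_mixed_volume_mixed_volume[where 'n = 'n] unfolding is_mixed_volume_def by blast

text \<open>The default value of \<open>mixed_volume\<close> agrees with the volume of an empty
  slice, so integrals over slices may range over all heights.\<close>

lemma mvk_empty: "k > 0 \<Longrightarrow> mvk M k {} = 0"
  unfolding mvk_def by (rule mixed_volume_not_body[of "{}"]) (auto simp: convex_body_def)

text \<open>As \<open>M\<close> is horizontal, adding dilates of \<open>M\<close> commutes with
  slicing, and the linear functional \<open>mv_coeff\<close> carries the slicing formula from
  volumes to \<open>mvk\<close>.\<close>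

lemma mvk_slices:
  fixes K M :: "(real^'n) set"
  assumes w: "norm w = 1" and M: "convex_body M" "\<And>x. x \<in> M \<Longrightarrow> x \<bullet> w = 0"
    and K: "convex_body K" and k: "0 < k" "k \<le> CARD('n)"
  shows "has_bochner_integral lborel (\<lambda>s. mvk M k (slice w K s + seg w)) (mvk M k K)"
proof -
  have B: "convex_body (K + dilate t M)" for t using K M by (intro convex_body_plus convex_body_dilate)
  have eq: "mvk M k (slice w K s + seg w) =
     (\<Sum>j\<le>CARD('n). mv_coeff CARD('n) k j * vol (slice w (K + dilate (real j) M) s + seg w))" for s
  proof (cases "slice w K s = {}")
    case True
    have "slice w (K + dilate t M) s = {}" for t
      using M by (subst slice_plus_horizontal) (auto simp: True)
    then show ?thesis using True k by (simp add: mvk_empty)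
  next
    case False
    have sl: "slice w (K + dilate t M) s + seg w = (slice w K s + seg w) + dilate t M" for t
      using M by (subst slice_plus_horizontal) (auto simp: ac_simps)
    show ?thesis
      unfolding sl using convex_body_slice[OF K False] M k
      by (intro mvk_eq_mv_coeff convex_body_plus) auto
  qed
  show ?thesis
    unfolding eq mvk_eq_mv_coeff[OF K M(1) k(2)]
    by (intro has_bochner_integral_sum has_bochner_integral_mult_right vol_slices w convex_body_borel B)
      (use B in \<open>auto simp: convex_body_def compact_imp_bounded\<close>)
qed

lemma vol_translation: "vol ((+) a ` X) = vol X"
  by (rule measure_translation)

lemma plus_translation: "(+) a ` A + B = (+) a ` (A + B)" "B + (+) a ` A = (+) a ` (B + A)"
  for A B :: "'a::ab_group_add set"
  by (auto simp: set_plus_def image_iff ac_simps) (metis add.left_commute add.assoc)+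

lemma convex_body_translation: "convex_body A \<Longrightarrow> convex_body ((+) a ` A)"
  by (simp add: convex_body_def compact_translation)

lemma mvk_translation:
  fixes A M :: "(real^'n) set"
  assumes "convex_body A" "convex_body M" "k \<le> CARD('n)"
  shows "mvk M k ((+) a ` A) = mvk M k A"
  using assms by (simp add: mvk_eq_mv_coeff convex_body_translation plus_translation vol_translation)

lemma lists_0_conv: "{js. js = [] \<and> set js \<subseteq> B} = {[]}"
  by auto

lemma sum_lists_1:
  fixes F :: "'i list \<Rightarrow> real"
  shows "finite B \<Longrightarrow> (\<Sum>js\<in>{js. length js = 1 \<and> set js \<subseteq> B}. F js) = (\<Sum>i\<in>B. F [i])"
  using sum_lists_Suc[where B = B and n = 0 and F = F] by (simp add: lists_0_conv)

lemma sum_lists_2: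
  fixes F :: "'i list \<Rightarrow> real"
  shows "finite B \<Longrightarrow> (\<Sum>js\<in>{js. length js = 2 \<and> set js \<subseteq> B}. F js) = (\<Sum>i\<in>B. \<Sum>j\<in>B. F [i, j])"
  using sum_lists_Suc[where B = B and n = 1 and F = F] sum_lists_1[where B = B] by (simp add: numeral_2_eq_2)

lemma V2_commute: "V2 A B M = V2 B A (M :: (real^'n) set)"
  unfolding V2_def mixed_volume_eq_mvol by (rule mvol_mset) simp

lemma V2_self: "V2 A A M = mvk M 2 (A :: (real^'n) set)"
  by (simp add: V2_def mvk_def numeral_2_eq_2)

lemma mvk_2_sum:
  fixes A :: "nat \<Rightarrow> (real^'n) set" and x :: "nat \<Rightarrow> real"
  assumes "\<And>i. i < m \<Longrightarrow> convex_body (A i)" "convex_body M"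
    "\<And>i. i < m \<Longrightarrow> 0 \<le> x i" "2 \<le> CARD('n)"
  shows "mvk M 2 (\<Sum>i<m. dilate (x i) (A i)) = (\<Sum>i<m. \<Sum>j<m. x i * x j * V2 (A i) (A j) M)"
  using mvk_sum[of m A M x 2] assms by (simp add: sum_lists_2 V2_def mult_ac)

lemma mvk_1_sum:
  fixes A :: "nat \<Rightarrow> (real^'n) set" and x :: "nat \<Rightarrow> real"
  assumes "\<And>i. i < m \<Longrightarrow> convex_body (A i)" "convex_body M"
    "\<And>i. i < m \<Longrightarrow> 0 \<le> x i"
  shows "mvk M 1 (\<Sum>i<m. dilate (x i) (A i)) = (\<Sum>i<m. x i * mvk M 1 (A i))"
  using mvk_sum[of m A M x 1] assms by (simp add: sum_lists_1[unfolded One_nat_def] mvk_def mult_ac)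

text \<open>Without the terms for \<open>k = 0\<close> and \<open>k = 1\<close>, the polynomial
  grows like \<open>t ^ (n - 2)\<close>. Estimates of volumes for large \<open>t\<close> thereby
  become estimates of the coefficient \<open>q 2\<close>.\<close>

lemma leading_coefficient_limit:
  fixes q :: "nat \<Rightarrow> real"
  assumes q: "q 0 = 0" "q 1 = 0" and n: "2 \<le> n"
    and p: "\<And>t. t \<ge> 0 \<Longrightarrow> p t = (\<Sum>k\<le>n. of_nat (n choose k) * (t ^ (n - k) * q k))"
  shows "((\<lambda>t. p t / t ^ (n - 2)) \<longlongrightarrow> of_nat (n choose 2) * q 2) at_top"
proof -
  have lim: "((\<lambda>t. of_nat (n choose k) * (t ^ (n - k) * q k) / t ^ (n - 2)) \<longlongrightarrow>
      (if k = 2 then of_nat (n choose 2) * q 2 else 0)) at_top" if "k \<le> n" for k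
  proof -
    consider "k < 2" | "k = 2" | "k > 2" by linarith
    then show ?thesis
    proof cases
      case 1
      then have "q k = 0" using q by (auto simp: less_2_cases_iff)
      then show ?thesis using 1 by simp
    next
      case 2
      have "\<forall>\<^sub>F t in at_top. of_nat (n choose 2) * q 2 = of_nat (n choose k) * (t ^ (n - k) * q k) / t ^ (n - 2)"
        using eventually_gt_at_top[of "0::real"] by eventually_elim (simp add: 2)
      then have "((\<lambda>t. of_nat (n choose k) * (t ^ (n - k) * q k) / t ^ (n - 2)) \<longlongrightarrow> of_nat (n choose 2) * q 2) at_top"
        by (rule Lim_transform_eventually[OF tendsto_const])
      then show ?thesis using 2 by simp
    next
      case 3
      have "((\<lambda>t. of_nat (n choose k) * q k * inverse (t ^ (k - 2))) \<longlongrightarrow> of_nat (n choose k) * q k * 0) (at_top :: real filter)"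
        using 3 by (intro tendsto_mult tendsto_const tendsto_inverse_0_at_top filterlim_pow_at_top filterlim_ident) auto
      moreover have "\<forall>\<^sub>F t in at_top. of_nat (n choose k) * q k * inverse (t ^ (k - 2)) = of_nat (n choose k) * (t ^ (n - k) * q k) / t ^ (n - 2)"
        using eventually_gt_at_top[of "0::real"]
      proof eventually_elim
        case (elim t)
        have "t ^ (n - 2) = t ^ (n - k) * t ^ (k - 2)" using 3 that by (simp flip: power_add)
        then show ?case using elim by (simp add: field_simps)
      qed
      ultimately show ?thesis using 3 by (auto intro: Lim_transform_eventually)
    qed
  qed
  have "((\<lambda>t. \<Sum>k\<le>n. of_nat (n choose k) * (t ^ (n - k) * q k) / t ^ (n - 2)) \<longlongrightarrow>
      (\<Sum>k\<le>n. if k = 2 then of_nat (n choose 2) * q 2 else 0)) at_top"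
    using lim by (intro tendsto_sum) auto
  then have "((\<lambda>t. \<Sum>k\<le>n. of_nat (n choose k) * (t ^ (n - k) * q k) / t ^ (n - 2)) \<longlongrightarrow>
      of_nat (n choose 2) * q 2) at_top"
    using n by simp
  then show ?thesis
    by (rule Lim_transform_eventually)
      (use eventually_ge_at_top[of "0::real"] in \<open>eventually_elim, simp add: p sum_divide_distrib\<close>)
qed

section \<open>The quadratic form given by \<open>M\<close> and the functional \<phi> on flat
  bodies\<close>

definition flat :: "'a::euclidean_space \<Rightarrow> 'a set \<Rightarrow> bool" where
  "flat w A \<longleftrightarrow> convex_body A \<and> (\<exists>c. \<forall>x\<in>A. x \<bullet> w = c)"

lemma flat_plus: "flat w A \<Longrightarrow> flat w B \<Longrightarrow> flat w (A + B)"
  unfolding flat_def by (auto simp: convex_body_plus elim!: set_plus_elim simp: inner_add_left)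

lemma flat_dilate: "flat w A \<Longrightarrow> flat w (dilate c A)"
  unfolding flat_def by (auto simp: convex_body_dilate)

lemma flat_translation: "flat w A \<Longrightarrow> flat w ((+) a ` A)"
  unfolding flat_def by (auto simp: convex_body_translation inner_add_left)

lemma flat_singleton: "flat w {x}"
  by (simp add: flat_def)

lemma flat_slice: "convex_body K \<Longrightarrow> slice w K s \<noteq> {} \<Longrightarrow> flat w (slice w K s)"
  unfolding flat_def by (auto simp: convex_body_slice) (auto simp: slice_def)

lemma vol_flat: "flat w A \<Longrightarrow> w \<noteq> 0 \<Longrightarrow> vol A = 0"
proof -
  assume a: "flat w A" "w \<noteq> 0"
  then obtain c where "A \<subseteq> {x. w \<bullet> x = c}" by (auto simp: flat_def inner_commute)
  then have "negligible A" using negligible_hyperplane[of w c] a(2) negligible_subset by blast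
  then show ?thesis by (rule negligible_imp_measure0)
qed

locale flat_body =
  fixes M :: "(real^'n) set" and w :: "real^'n"
  assumes dim: "3 \<le> CARD('n)" and M: "convex_body M" and w: "norm w = 1"
    and Mw: "\<And>x. x \<in> M \<Longrightarrow> x \<bullet> w = 0"
begin

abbreviation W where "W \<equiv> mvk M 2"
abbreviation J where "J \<equiv> seg w"
text \<open>The segment supplies the dimension that a flat body lacks; on flat bodies the value is
  \<open>2 * V2 A J M\<close>, by \<open>\<phi>_eq\<close>.\<close>

definition \<phi> where "\<phi> A = W (A + J)"

lemma w0: "w \<noteq> 0" using w by auto
lemma ww: "w \<bullet> w = 1" using w by (simp add: norm_eq_1)

lemma flat_M: "flat w M" using M Mw by (auto simp: flat_def)

text \<open>\<open>A\<close> and the dilates of \<open>M\<close> lie in parallel hyperplanes, so all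
  the volumes that determine \<open>mvk\<close> vanish.\<close>

lemma mvk_flat: "flat w A \<Longrightarrow> k \<le> CARD('n) \<Longrightarrow> mvk M k A = 0"
  using M by (simp add: mvk_eq_mv_coeff flat_def[of w A] vol_flat[OF flat_plus[OF _ flat_dilate[OF flat_M]] w0] flat_def)

lemma mvk_0: "mvk M 0 A = 0"
  using mvk_flat[OF flat_M, of 0] by (simp add: mvk_def)

lemma W_lincomb:
  assumes "convex_body A" "convex_body B" "0 \<le> a" "0 \<le> b"
  shows "W (dilate a A + dilate b B) = a\<^sup>2 * W A + 2 * a * b * V2 A B M + b\<^sup>2 * W B"
proof -
  define K where "K i = (if i = (0::nat) then A else B)" for i
  define x where "x i = (if i = (0::nat) then a else b)" for i
  have "W (\<Sum>i<2. dilate (x i) (K i)) = (\<Sum>i<2. \<Sum>j<2. x i * x j * V2 (K i) (K j) M)"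
    using assms M dim by (intro mvk_2_sum) (auto simp: K_def x_def)
  then show ?thesis
    by (simp add: numeral_2_eq_2 K_def x_def V2_self[unfolded numeral_2_eq_2] V2_commute[of B A] algebra_simps)
qed

lemma W_plus:
  assumes "convex_body A" "convex_body B"
  shows "W (A + B) = W A + 2 * V2 A B M + W B"
  using W_lincomb[OF assms, of 1 1] by simp

lemma W_dilate:
  assumes "convex_body A" "0 \<le> a"
  shows "W (dilate a A) = a\<^sup>2 * W A"
  using W_lincomb[OF assms(1) convex_body_singleton[of 0] assms(2), of 0] by simp

lemma V2_dilate:
  assumes "convex_body A" "convex_body B" "0 \<le> b"
  shows "V2 A (dilate b B) M = b * V2 A B M"
  using W_lincomb[OF assms(1,2), of 1 b] W_plus[OF assms(1) convex_body_dilate[OF assms(2), of b]]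
    W_dilate[OF assms(2,3)] assms(3) by simp

lemma W_plus3:
  assumes "convex_body A" "convex_body B" "convex_body C"
  shows "W (A + B + C) = W A + W B + W C + 2 * V2 A B M + 2 * V2 A C M + 2 * V2 B C M"
proof -
  define K where "K i = (if i = (0::nat) then A else if i = 1 then B else C)" for i
  have "W (\<Sum>i<3. dilate 1 (K i)) = (\<Sum>i<3. \<Sum>j<3. 1 * 1 * V2 (K i) (K j) M)"
    using assms M dim by (intro mvk_2_sum) (auto simp: K_def)
  then show ?thesis
    by (simp add: numeral_3_eq_3 K_def V2_self V2_commute[of B A] V2_commute[of C] algebra_simps)
qed

lemma U_plus:
  assumes "convex_body A" "convex_body B"
  shows "mvk M 1 (A + B) = mvk M 1 A + mvk M 1 B"
proof -
  define K where "K i = (if i = (0::nat) then A else B)" for i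
  have "mvk M 1 (\<Sum>i<2. dilate 1 (K i)) = (\<Sum>i<2. 1 * mvk M 1 (K i))"
    using assms M by (intro mvk_1_sum) (auto simp: K_def)
  then show ?thesis
    by (simp add: numeral_2_eq_2 K_def)
qed

lemma \<phi>_empty: "\<phi> {} = 0" by (simp add: \<phi>_def mvk_empty)

lemma W_slices: "convex_body K \<Longrightarrow> has_bochner_integral lborel (\<lambda>s. \<phi> (slice w K s)) (W K)"
  unfolding \<phi>_def using M Mw w dim by (intro mvk_slices) auto

text \<open>Slicing makes \<open>W\<close> linear, and Minkowski addition makes it quadratic, along multiples of \<open>J\<close>.\<close>

lemma W_J: "W J = 0"
proof -
  \<comment> \<open>The slices of the doubled segment are single points over an interval of length
    two, and \<phi> takes the value \<open>W J\<close> at each of them.\<close>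
  have sl: "slice w (dilate 2 J) s = (if 0 \<le> s \<and> s \<le> 2 then {s *\<^sub>R w} else {})" for s
    using ww by (auto simp: slice_def in_segment intro!: image_eqI[of _ _ "(s / 2) *\<^sub>R w"] exI[of _ "s / 2"])
  have "\<phi> {s *\<^sub>R w} = W J" for s
    using mvk_translation[OF convex_body_seg M, of 2 "s *\<^sub>R w" w] dim
    by (simp add: \<phi>_def insert_set_plus)
  then have "\<phi> (slice w (dilate 2 J) s) = W J * indicator {0..2} s" for s
    by (auto simp: sl \<phi>_empty indicator_def)
  then have "has_bochner_integral lborel (\<lambda>s. W J * indicator {0..2::real} s) (W (dilate 2 J))"
    using W_slices[OF convex_body_dilate[OF convex_body_seg[of w], of 2]] by simp
  moreover have "has_bochner_integral lborel (\<lambda>s. W J * indicator {0..2::real} s) (W J * 2)"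
    using has_bochner_integral_real_indicator[of "{0..2::real}" lborel]
    by (intro has_bochner_integral_mult_right) simp
  ultimately have "W (dilate 2 J) = W J * 2" by (rule has_bochner_integral_eq)
  moreover have "W (dilate 2 J) = 4 * W J" by (subst W_dilate) auto
  ultimately show ?thesis by simp
qed

lemma \<phi>_eq: "flat w A \<Longrightarrow> \<phi> A = 2 * V2 A J M"
  unfolding \<phi>_def using dim W_plus[of A J] by (simp add: mvk_flat W_J flat_def[of w A])

text \<open>Bilinearity expands \<open>W (A + B + J)\<close>, and the mixed term of \<open>A\<close>
  and \<open>B\<close> vanishes because their sum is flat.\<close>

lemma \<phi>_plus:
  assumes "flat w A" "flat w B"
  shows "\<phi> (A + B) = \<phi> A + \<phi> B"
proof -
  have b: "convex_body A" "convex_body B" using assms by (auto simp: flat_def)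
  have "W (A + B) = 0" "W A = 0" "W B = 0"
    using assms dim by (auto simp: mvk_flat flat_plus)
  moreover have "V2 A B M = 0" using W_plus[OF b] calculation by simp
  ultimately show ?thesis
    using W_plus3[OF b convex_body_seg] \<phi>_eq assms by (simp add: \<phi>_def[of "A + B"] W_J)
qed

lemma \<phi>_singleton: "\<phi> {x} = 0"
  using mvk_translation[OF convex_body_seg M, of 2 x w] dim by (simp add: \<phi>_def insert_set_plus W_J)

lemma \<phi>_dilate:
  assumes "flat w A" "0 \<le> c"
  shows "\<phi> (dilate c A) = c * \<phi> A"
  using assms V2_dilate[of J A c] by (simp add: \<phi>_eq flat_dilate V2_commute[of _ J]) (simp add: flat_def)

lemma \<phi>_translation:
  assumes "flat w A"
  shows "\<phi> ((+) a ` A) = \<phi> A"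
  using \<phi>_plus[OF flat_singleton assms, of a] by (simp add: insert_set_plus \<phi>_singleton)

text \<open>In the difference of the volumes the terms for \<open>k = 0\<close> and
  \<open>k = 1\<close> cancel: \<open>mvk M 1\<close> is additive and zero on flat bodies, so only
  its value at \<open>J\<close> remains on both sides.\<close>

lemma \<phi>_limit:
  assumes "flat w A" "flat w B"
  shows "((\<lambda>t. (vol (B + J + dilate t M) - vol (A + J + dilate t M)) / t ^ (CARD('n) - 2)) \<longlongrightarrow>
    of_nat (CARD('n) choose 2) * (\<phi> B - \<phi> A)) at_top"
  unfolding \<phi>_def
proof (rule leading_coefficient_limit[where q = "\<lambda>k. mvk M k (B + J) - mvk M k (A + J)"])
  have b: "convex_body A" "convex_body B" using assms by (auto simp: flat_def)
  show "mvk M 0 (B + J) - mvk M 0 (A + J) = 0" by (simp add: mvk_0)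
  show "mvk M 1 (B + J) - mvk M 1 (A + J) = 0"
    using dim assms b by (simp add: U_plus mvk_flat del: One_nat_def)
  show "2 \<le> CARD('n)" using dim by simp
  fix t :: real assume "0 \<le> t"
  then show "vol (B + J + dilate t M) - vol (A + J + dilate t M) =
      (\<Sum>k\<le>CARD('n). of_nat (CARD('n) choose k) * (t ^ (CARD('n) - k) * (mvk M k (B + J) - mvk M k (A + J))))"
    using b M by (simp only: volume_mvk_expansion convex_body_plus convex_body_seg right_diff_distrib sum_subtractf)
qed

lemma binom_pos: "0 < real (CARD('n) choose 2)" using dim by simp

lemma \<phi>_mono:
  assumes "flat w A" "flat w B" "A \<subseteq> B"
  shows "\<phi> A \<le> \<phi> B"
proof -
  have b: "convex_body A" "convex_body B" using assms by (auto simp: flat_def)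
  have "0 \<le> real (CARD('n) choose 2) * (\<phi> B - \<phi> A)"
  proof (rule tendsto_lowerbound[OF \<phi>_limit[OF assms(1,2)]])
    show "\<forall>\<^sub>F t in at_top. 0 \<le> (vol (B + J + dilate t M) - vol (A + J + dilate t M)) / t ^ (CARD('n) - 2)"
      using eventually_ge_at_top[of "0::real"]
    proof eventually_elim
      case (elim t)
      have "vol (A + J + dilate t M) \<le> vol (B + J + dilate t M)"
        using b M assms(3) by (intro vol_mono convex_body_plus convex_body_dilate set_plus_mono2) auto
      then show ?case using elim by simp
    qed
  qed simp
  then show ?thesis using binom_pos by (simp add: zero_le_mult_iff)
qed

lemma \<phi>_nonneg: "flat w A \<Longrightarrow> 0 \<le> \<phi> A"
  using \<phi>_mono[OF flat_singleton, of A] \<phi>_singleton by (auto simp: flat_def convex_body_def)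

end

subsection \<open>Support functions\<close>

definition supp :: "'a::euclidean_space set \<Rightarrow> 'a \<Rightarrow> real" where
  "supp X u = (SUP x\<in>X. x \<bullet> u)"

lemma supp_attained:
  assumes "convex_body X"
  obtains x where "x \<in> X" "x \<bullet> u = supp X u" "\<And>y. y \<in> X \<Longrightarrow> y \<bullet> u \<le> x \<bullet> u"
proof -
  have "compact X" "X \<noteq> {}" using assms by (auto simp: convex_body_def)
  then obtain x where x: "x \<in> X" "\<And>y. y \<in> X \<Longrightarrow> y \<bullet> u \<le> x \<bullet> u"
    using continuous_attains_sup[of X "\<lambda>x. x \<bullet> u", OF _ _ continuous_on_inner[OF continuous_on_id continuous_on_const]]
    by auto
  moreover have "supp X u = x \<bullet> u"
    unfolding supp_def using x by (intro cSup_eq_maximum) auto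
  ultimately show thesis using that by simp
qed

lemma supp_ge: "convex_body X \<Longrightarrow> x \<in> X \<Longrightarrow> x \<bullet> u \<le> supp X u"
  by (metis supp_attained)

lemma supp_le_iff: "convex_body X \<Longrightarrow> supp X u \<le> c \<longleftrightarrow> (\<forall>x\<in>X. x \<bullet> u \<le> c)"
  by (metis supp_attained supp_ge order_trans)

lemma supp_eqI: "convex_body X \<Longrightarrow> x \<in> X \<Longrightarrow> (\<And>y. y \<in> X \<Longrightarrow> y \<bullet> u \<le> x \<bullet> u) \<Longrightarrow> supp X u = x \<bullet> u"
  by (meson antisym supp_ge supp_le_iff)

lemma supp_mono: "convex_body X \<Longrightarrow> convex_body Y \<Longrightarrow> X \<subseteq> Y \<Longrightarrow> supp X u \<le> supp Y u"
  by (auto simp: supp_le_iff intro: supp_ge)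

lemma supp_plus:
  assumes "convex_body X" "convex_body Y"
  shows "supp (X + Y) u = supp X u + supp Y u"
proof -
  obtain x where x: "x \<in> X" "x \<bullet> u = supp X u" using supp_attained[OF assms(1)] by metis
  obtain y where y: "y \<in> Y" "y \<bullet> u = supp Y u" using supp_attained[OF assms(2)] by metis
  have "supp (X + Y) u = (x + y) \<bullet> u"
  proof (rule supp_eqI[OF convex_body_plus[OF assms]])
    fix z assume "z \<in> X + Y"
    then show "z \<bullet> u \<le> (x + y) \<bullet> u"
      using x y supp_ge[OF assms(1), of _ u] supp_ge[OF assms(2), of _ u]
      by (auto elim!: set_plus_elim simp: inner_add_left intro!: add_mono)
  qed (use x y in auto)
  then show ?thesis by (simp add: inner_add_left x y)
qed

lemma supp_dilate:
  assumes "convex_body X" "0 \<le> c"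
  shows "supp (dilate c X) u = c * supp X u"
proof -
  obtain x where x: "x \<in> X" "x \<bullet> u = supp X u" using supp_attained[OF assms(1)] by metis
  have "supp (dilate c X) u = (c *\<^sub>R x) \<bullet> u"
    using x assms supp_ge[OF assms(1), of _ u]
    by (intro supp_eqI convex_body_dilate) (auto intro!: mult_left_mono)
  then show ?thesis by (simp add: x)
qed

lemma supp_scale:
  assumes "convex_body X" "0 \<le> c"
  shows "supp X (c *\<^sub>R u) = c * supp X u"
proof -
  obtain x where x: "x \<in> X" "x \<bullet> u = supp X u" using supp_attained[OF assms(1)] by metis
  have "supp X (c *\<^sub>R u) = x \<bullet> (c *\<^sub>R u)"
    using x assms supp_ge[OF assms(1), of _ u] by (intro supp_eqI) (auto intro!: mult_left_mono)
  then show ?thesis by (simp add: x)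
qed

lemma subset_if_supp_le:
  assumes A: "convex_body A" and B: "convex_body B" and le: "\<And>u. supp A u \<le> supp B u"
  shows "A \<subseteq> B"
proof
  fix x assume x: "x \<in> A"
  show "x \<in> B"
  proof (rule ccontr)
    assume "x \<notin> B"
    then obtain u b where "u \<bullet> x < b" "\<forall>y\<in>B. u \<bullet> y > b"
      using separating_hyperplane_closed_point[of B x] B by (auto simp: convex_body_def compact_imp_closed)
    then have "supp B (- u) \<le> - b" "- b < x \<bullet> (- u)"
      using B by (auto simp: supp_le_iff inner_commute less_imp_le)
    then show False using supp_ge[OF A x, of "- u"] le[of "- u"] by linarith
  qed
qed

lemma supp_flat:
  assumes "convex_body A" "\<And>x. x \<in> A \<Longrightarrow> x \<bullet> w = c"
  shows "supp A (v + s *\<^sub>R w) = supp A v + s * c"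
proof -
  obtain x where x: "x \<in> A" "x \<bullet> v = supp A v" using supp_attained[OF assms(1)] by metis
  have "supp A (v + s *\<^sub>R w) = x \<bullet> (v + s *\<^sub>R w)"
    using x assms supp_ge[OF assms(1), of _ v] by (intro supp_eqI) (auto simp: inner_add_right)
  then show ?thesis by (simp add: x assms inner_add_right)
qed

lemma supp_hyperplane_conv:
  assumes "convex_body X"
  shows "supp_hyperplane X u = {x. x \<bullet> u = supp X u}"
proof -
  obtain x where x: "x \<in> X" "x \<bullet> u = supp X u" "\<And>y. y \<in> X \<Longrightarrow> y \<bullet> u \<le> x \<bullet> u"
    using supp_attained[OF assms] by metis
  have F: "y \<in> face_dir X u \<longleftrightarrow> y \<in> X \<and> y \<bullet> u = supp X u" for y
  proof
    assume y: "y \<in> face_dir X u"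
    then have "y \<in> X" "x \<bullet> u \<le> y \<bullet> u" using x(1) by (auto simp: face_dir_def)
    then show "y \<in> X \<and> y \<bullet> u = supp X u" using supp_ge[OF assms, of y u] x(2) by simp
  next
    assume "y \<in> X \<and> y \<bullet> u = supp X u"
    then show "y \<in> face_dir X u" using supp_ge[OF assms, of _ u] by (simp add: face_dir_def)
  qed
  show ?thesis
  proof (intro equalityI subsetI)
    fix z assume "z \<in> supp_hyperplane X u"
    then show "z \<in> {x. x \<bullet> u = supp X u}"
      by (auto simp: supp_hyperplane_def F inner_add_left elim!: set_plus_elim)
  next
    fix z assume "z \<in> {x. x \<bullet> u = supp X u}"
    then have "x + (z - x) \<in> supp_hyperplane X u"
      unfolding supp_hyperplane_def using x by (intro set_plus_intro) (auto simp: F inner_diff_left)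
    then show "z \<in> supp_hyperplane X u" by simp
  qed
qed

text \<open>Translates the geometric condition of the theorem into an equation between support
  functions.\<close>

lemma supp_hyperplane_eq_iff:
  assumes "convex_body X" "convex_body Y"
  shows "supp_hyperplane X u = supp_hyperplane Y u \<longleftrightarrow> supp X u = supp Y u"
proof
  assume "supp_hyperplane X u = supp_hyperplane Y u"
  moreover obtain x where "x \<in> X" "x \<bullet> u = supp X u" using supp_attained[OF assms(1)] by metis
  ultimately show "supp X u = supp Y u"
    using assms by (force simp: supp_hyperplane_conv)
qed (use assms in \<open>simp add: supp_hyperplane_conv\<close>)

subsection \<open>Degenerate bodies\<close>

lemma convex_body_disc: "0 \<le> R \<Longrightarrow> convex_body {q. q \<bullet> e = 0 \<and> q \<bullet> w = 0 \<and> norm q \<le> R}"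
proof -
  assume "0 \<le> R"
  have "{q. q \<bullet> e = 0 \<and> q \<bullet> w = 0 \<and> norm q \<le> R} = {q. e \<bullet> q = 0} \<inter> {q. w \<bullet> q = 0} \<inter> cball 0 R"
    by (auto simp: inner_commute)
  moreover have "compact ({q. e \<bullet> q = 0} \<inter> {q. w \<bullet> q = 0} \<inter> cball 0 R)"
    by (intro closed_Int_compact closed_Int closed_hyperplane) auto
  moreover have "convex ({q. e \<bullet> q = 0} \<inter> {q. w \<bullet> q = 0} \<inter> cball 0 R)"
    by (intro convex_Int convex_hyperplane) auto
  moreover have "0 \<in> {q. q \<bullet> e = 0 \<and> q \<bullet> w = 0 \<and> norm q \<le> R}" using \<open>0 \<le> R\<close> by simp
  ultimately show ?thesis unfolding convex_body_def by (simp only: ex_in_conv[symmetric]) blast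
qed

lemma flat_seg: "e \<bullet> w = 0 \<Longrightarrow> flat w (seg e)"
  by (auto simp: flat_def in_segment intro!: exI[of _ 0])

locale flat_body_2 = flat_body +
  fixes e assumes e: "norm e = 1" "e \<bullet> w = 0" and Me: "\<And>x. x \<in> M \<Longrightarrow> x \<bullet> e = 0"
begin

lemma flat_body_e: "flat_body M e"
  using dim M e Me by unfold_locales

lemma ee: "e \<bullet> e = 1" using e by (simp add: norm_eq_1)

text \<open>\<open>Q + J\<close> lies in a hyperplane orthogonal to \<open>e\<close>, so
  \<open>mvk_flat\<close> applies with \<open>e\<close> in place of \<open>w\<close>.\<close>

lemma \<phi>_orthogonal:
  assumes "flat w Q" "\<And>q. q \<in> Q \<Longrightarrow> q \<bullet> e = 0"
  shows "\<phi> Q = 0"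
proof -
  interpret E: flat_body M e by (rule flat_body_e)
  have "flat e Q" using assms by (auto simp: flat_def)
  moreover have "flat e J" using e(2) by (intro flat_seg) (simp add: inner_commute)
  ultimately show ?thesis
    unfolding \<phi>_def using dim by (intro E.mvk_flat flat_plus) auto
qed

text \<open>Up to summands orthogonal to \<open>e\<close>, which \<phi> ignores, \<open>A\<close>
  and a segment along \<open>e\<close> of the same width contain each other. Monotonicity and
  additivity turn the two inclusions into an equation.\<close>

lemma \<phi>_width:
  assumes A: "flat w A"
  shows "\<phi> A = (supp A e + supp A (- e)) * \<phi> (seg e)"
proof -
  obtain c where c: "\<And>x. x \<in> A \<Longrightarrow> x \<bullet> w = c" and bA: "convex_body A" using A by (auto simp: flat_def)
  obtain a1 where a1: "a1 \<in> A" "a1 \<bullet> e = supp A e" using supp_attained[OF bA] by metis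
  obtain a2 where a2: "a2 \<in> A" "a2 \<bullet> (- e) = supp A (- e)" using supp_attained[OF bA] by metis
  define d where "d = supp A e + supp A (- e)"
  have le1: "x \<bullet> e \<le> a1 \<bullet> e" and le2: "a2 \<bullet> e \<le> x \<bullet> e" if "x \<in> A" for x
    using supp_ge[OF bA that, of e] supp_ge[OF bA that, of "- e"] a1 a2 by auto
  have d: "d = a1 \<bullet> e - a2 \<bullet> e" "0 \<le> d" using a1 a2 le1[of a2] by (auto simp: d_def)
  obtain R where R: "\<And>x. x \<in> A \<Longrightarrow> norm x \<le> R" "0 < R"
    using bA by (metis bounded_pos compact_imp_bounded convex_body_def)
  \<comment> \<open>The radius accommodates the error in both inclusions: two points of norm at most
    \<open>R\<close> and a vector along \<open>e\<close> of length at most \<open>d\<close>.\<close>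
  define Q where "Q = {q. q \<bullet> e = 0 \<and> q \<bullet> w = 0 \<and> norm q \<le> 2 * R + d}"
  have Q: "flat w Q"
    unfolding flat_def Q_def using R d by (auto intro!: convex_body_disc exI[of _ 0])
  have \<phi>Q: "\<phi> Q = 0" using Q by (rule \<phi>_orthogonal) (auto simp: Q_def)
  have se: "flat w (seg e)" using e by (intro flat_seg)
  define S where "S = (+) a2 ` dilate d (seg e)"
  have S: "flat w S" unfolding S_def by (intro flat_translation flat_dilate se)
  have \<phi>S: "\<phi> S = d * \<phi> (seg e)"
    unfolding S_def using se d by (simp add: \<phi>_translation \<phi>_dilate flat_dilate)
  have normS: "norm (t *\<^sub>R e) \<le> d" if "0 \<le> t" "t \<le> d" for t using that e by simp
  have AS: "A \<subseteq> S + Q"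
  proof
    fix x assume x: "x \<in> A"
    define t where "t = x \<bullet> e - a2 \<bullet> e"
    have t: "0 \<le> t" "t \<le> d" using le1[OF x] le2[OF x] by (auto simp: t_def d)
    have "t *\<^sub>R e \<in> dilate d (seg e)"
    proof (cases "d = 0")
      case True
      then show ?thesis using t by (auto intro!: image_eqI[of _ _ 0])
    next
      case False
      then show ?thesis using t d(2)
        by (intro image_eqI[of _ _ "(t / d) *\<^sub>R e"]) (auto simp: in_segment intro!: exI[of _ "t / d"])
    qed
    then have 1: "a2 + t *\<^sub>R e \<in> S" by (simp add: S_def)
    have "norm (x - a2 - t *\<^sub>R e) \<le> norm x + norm a2 + norm (t *\<^sub>R e)"
      using norm_triangle_ineq4[of "x - a2" "t *\<^sub>R e"] norm_triangle_ineq4[of x a2] by linarith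
    also have "\<dots> \<le> 2 * R + d" using R(1)[OF x] R(1)[OF a2(1)] normS[OF t] by linarith
    finally have 2: "x - a2 - t *\<^sub>R e \<in> Q"
      using c[OF x] c[OF a2(1)] e ee by (simp add: Q_def inner_diff_left t_def)
    show "x \<in> S + Q" using set_plus_intro[OF 1 2] by (simp add: algebra_simps)
  qed
  have SA: "S \<subseteq> A + Q"
  proof
    fix y assume "y \<in> S"
    then obtain s where s: "0 \<le> s" "s \<le> 1" "y = a2 + (d * s) *\<^sub>R e"
      by (auto simp: S_def in_segment)
    have 1: "a2 + s *\<^sub>R (a1 - a2) \<in> A"
      using convexD_alt[of A a2 a1 s] bA a1 a2 s by (simp add: convex_body_def algebra_simps)
    have eq: "y - (a2 + s *\<^sub>R (a1 - a2)) = (d * s) *\<^sub>R e - s *\<^sub>R (a1 - a2)" by (simp add: s)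
    have "norm (y - (a2 + s *\<^sub>R (a1 - a2))) \<le> norm ((d * s) *\<^sub>R e) + s * norm (a1 - a2)"
      unfolding eq using s norm_triangle_ineq4[of "(d * s) *\<^sub>R e" "s *\<^sub>R (a1 - a2)"] by simp
    also have "s * norm (a1 - a2) \<le> 1 * (R + R)"
      using s R(1)[OF a1(1)] R(1)[OF a2(1)] norm_triangle_ineq4[of a1 a2] by (intro mult_mono) auto
    also have "norm ((d * s) *\<^sub>R e) \<le> d" using s d by (intro normS) (auto simp: mult_left_le)
    finally have 2: "y - (a2 + s *\<^sub>R (a1 - a2)) \<in> Q"
      using c[OF a1(1)] c[OF a2(1)] e ee by (simp add: Q_def s inner_diff_left inner_add_left d algebra_simps)
    show "y \<in> A + Q" using set_plus_intro[OF 1 2] by (simp add: algebra_simps)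
  qed
  have "\<phi> A \<le> \<phi> (S + Q)" by (rule \<phi>_mono[OF A flat_plus[OF S Q] AS])
  moreover have "\<phi> S \<le> \<phi> (A + Q)" by (rule \<phi>_mono[OF S flat_plus[OF A Q] SA])
  ultimately show ?thesis
    using \<phi>_plus[OF S Q] \<phi>_plus[OF A Q] \<phi>Q \<phi>S by (simp add: d_def)
qed

end

locale flat_body_3 = flat_body_2 +
  fixes f assumes f: "norm f = 1" "f \<bullet> w = 0" "f \<bullet> e = 0" and Mf: "\<And>x. x \<in> M \<Longrightarrow> x \<bullet> f = 0"
begin

text \<open>\<open>seg e\<close> and \<open>J\<close> are both orthogonal to \<open>f\<close>, so
  \<open>\<phi> (seg e) = 0\<close>, and every value of \<phi> is a multiple of this one.\<close>

lemma \<phi>_zero: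
  assumes "flat w A" shows "\<phi> A = 0"
proof -
  interpret F: flat_body M f using dim M f Mf by unfold_locales
  have "flat f (seg e)" "flat f J" using f by (auto intro!: flat_seg simp: inner_commute)
  then have "\<phi> (seg e) = 0"
    unfolding \<phi>_def using dim by (intro F.mvk_flat flat_plus) auto
  then show ?thesis using \<phi>_width[OF assms] by simp
qed

lemma W_zero:
  assumes "convex_body A" shows "W A = 0"
proof -
  have "\<phi> (slice w A s) = 0" for s
    using \<phi>_zero[OF flat_slice[OF assms]] \<phi>_empty by (cases "slice w A s = {}") auto
  then show ?thesis
    using has_bochner_integral_eq[OF W_slices[OF assms]] has_bochner_integral_zero[of lborel] by simp
qed

text \<open>Slicing leaves sums of a flat slice and \<open>J\<close>. \<open>mvk M 1\<close> is
  additive and vanishes on both, on \<open>J\<close> because \<open>J\<close> is flat with respect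
  to \<open>e\<close>.\<close>

lemma mvk_1_zero:
  assumes A: "convex_body A" shows "mvk M 1 A = 0"
proof -
  interpret E: flat_body M e by (rule flat_body_e)
  have "flat e J" using e(2) by (intro flat_seg) (simp add: inner_commute)
  then have J: "mvk M 1 J = 0" using dim by (intro E.mvk_flat) auto
  have "mvk M 1 (slice w A s + J) = 0" for s
  proof (cases "slice w A s = {}")
    case False
    then show ?thesis
      using U_plus[OF convex_body_slice[OF A False] convex_body_seg, of w] mvk_flat[OF flat_slice[OF A False], of 1] J dim
      by simp
  qed (simp add: mvk_empty)
  then show ?thesis
    using has_bochner_integral_eq[OF mvk_slices[OF w M Mw A, of 1]] has_bochner_integral_zero[of lborel] dim by simp
qed

text \<open>In codimension three the coefficients for \<open>k = 0, 1, 2\<close> all vanish, so the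
  volume is of lower order than \<open>t ^ (n - 2)\<close>.\<close>

lemma thickening_limit:
  assumes A: "convex_body A"
  shows "((\<lambda>t. vol (A + dilate t M) / t ^ (CARD('a) - 2)) \<longlongrightarrow> 0) at_top"
proof -
  have "((\<lambda>t. vol (A + dilate t M) / t ^ (CARD('a) - 2)) \<longlongrightarrow> of_nat (CARD('a) choose 2) * mvk M 2 A) at_top"
    using mvk_0 mvk_1_zero[OF A] dim volume_mvk_expansion[OF A M]
    by (intro leading_coefficient_limit) auto
  then show ?thesis by (simp add: W_zero[OF A])
qed

end

subsection \<open>Bodies with finitely many facets\<close>

text \<open>In a polytope scaled by \<open>t\<close>, the points within bounded distance of a face of codimension two
  occupy a volume of lower order.\<close>

lemma near_codim_2_negligible:
  fixes v v' w :: "real^'n"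
  assumes dim: "3 \<le> CARD('n)" and w: "norm w = 1" and vw: "v \<bullet> w = 0" "v' \<bullet> w = 0"
    and neq: "v \<noteq> v'" and C: "0 \<le> C"
  obtains Z :: "real \<Rightarrow> (real^'n) set" where "\<And>t. convex_body (Z t)"
    "((\<lambda>t. vol (Z t) / t ^ (CARD('n) - 2)) \<longlongrightarrow> 0) at_top"
    "\<forall>\<^sub>F t in at_top. \<forall>y. \<bar>y \<bullet> v - t\<bar> \<le> C \<and> \<bar>y \<bullet> v' - t\<bar> \<le> C \<and> \<bar>y \<bullet> w\<bar> \<le> C \<and> norm y \<le> C * (1 + t) \<longrightarrow> y \<in> Z t"
proof (cases "v = 0 \<or> (\<exists>c. v' = c *\<^sub>R v)")
  case True
  \<comment> \<open>In this case no point is close to both scaled hyperplanes once \<open>t\<close>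
    is large: one of them is empty, or they are parallel and move apart.\<close>
  have "\<forall>\<^sub>F t in at_top. \<forall>y. \<not> (\<bar>y \<bullet> v - t\<bar> \<le> C \<and> \<bar>y \<bullet> v' - t\<bar> \<le> C)"
    using True
  proof
    assume v: "v = 0"
    show ?thesis
      using eventually_gt_at_top[of C] by eventually_elim (use C v in auto)
  next
    assume "\<exists>c. v' = c *\<^sub>R v"
    then obtain c where c: "v' = c *\<^sub>R v" by blast
    with neq have c1: "c \<noteq> 1" by auto
    show ?thesis
      using eventually_gt_at_top[of "(\<bar>c\<bar> + 1) * C / \<bar>c - 1\<bar>"]
    proof eventually_elim
      case (elim t)
      show ?case
      proof (intro allI notI)
        fix y assume a: "\<bar>y \<bullet> v - t\<bar> \<le> C \<and> \<bar>y \<bullet> v' - t\<bar> \<le> C"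
        have "\<bar>c * (y \<bullet> v - t)\<bar> \<le> \<bar>c\<bar> * C" using a by (simp add: abs_mult mult_left_mono)
        then have "\<bar>(c * (y \<bullet> v) - t) - c * (y \<bullet> v - t)\<bar> \<le> C + \<bar>c\<bar> * C"
          using a c by (simp add: abs_le_iff)
        then have "\<bar>(c - 1) * t\<bar> \<le> (\<bar>c\<bar> + 1) * C" by (simp add: algebra_simps)
        moreover have "\<bar>c - 1\<bar> * \<bar>t\<bar> > (\<bar>c\<bar> + 1) * C"
        proof -
          have "(\<bar>c\<bar> + 1) * C < \<bar>c - 1\<bar> * t" using elim c1 by (simp add: pos_divide_less_eq mult.commute)
          also have "\<dots> \<le> \<bar>c - 1\<bar> * \<bar>t\<bar>" by (intro mult_left_mono) auto
          finally show ?thesis .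
        qed
        ultimately show False by (simp add: abs_mult)
      qed
    qed
  qed
  then show thesis
    by (intro that[of "\<lambda>_. {0}"]) (auto elim: eventually_mono)
next
  case False
  define e where "e = (1 / norm v) *\<^sub>R v"
  define f' where "f' = v' - (v' \<bullet> e) *\<^sub>R e"
  define f where "f = (1 / norm f') *\<^sub>R f'"
  have v: "norm v > 0" using False by simp
  have e: "norm e = 1" "e \<bullet> w = 0" using v vw by (auto simp: e_def)
  have ee: "e \<bullet> e = 1" and ww: "w \<bullet> w = 1" using e w by (simp_all add: norm_eq_1)
  have "f' \<noteq> 0" using False by (auto simp: f'_def e_def)
  then have f'0: "norm f' > 0" by simp
  have f'e: "f' \<bullet> e = 0" by (simp add: f'_def inner_diff_left ee)
  have f: "norm f = 1" "f \<bullet> w = 0" "f \<bullet> e = 0"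
    using f'0 f'e vw e by (auto simp: f_def f'_def inner_diff_left)
  have ff: "f \<bullet> f = 1" using f by (simp add: norm_eq_1)
  have sym: "w \<bullet> e = 0" "w \<bullet> f = 0" "e \<bullet> f = 0" using e f by (simp_all add: inner_commute)
  have ve: "v = norm v *\<^sub>R e" using v by (simp add: e_def)
  have v'f: "v' = (v' \<bullet> e) *\<^sub>R e + norm f' *\<^sub>R f" using f'0 by (simp add: f_def f'_def)
  \<comment> \<open>The coefficients solve \<open>y0 \<bullet> v = 1\<close> and
    \<open>y0 \<bullet> v' = 1\<close> in the plane of \<open>e\<close> and \<open>f\<close>, so
    that \<open>t\<close> times \<open>y0\<close> lies on both scaled hyperplanes.\<close>
  define \<alpha> where "\<alpha> = 1 / norm v"
  define \<beta> where "\<beta> = (1 - (v' \<bullet> e) * \<alpha>) / norm f'"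
  define y0 where "y0 = \<alpha> *\<^sub>R e + \<beta> *\<^sub>R f"
  have y0v: "y0 \<bullet> v = 1" by (subst ve) (use v in \<open>simp add: y0_def \<alpha>_def inner_add_left ee f\<close>)
  have y0v': "y0 \<bullet> v' = 1"
    by (subst v'f) (use f'0 in \<open>simp add: y0_def \<beta>_def inner_add_left inner_add_right ee ff f sym\<close>)
  have y0w: "y0 \<bullet> w = 0" by (simp add: y0_def inner_add_left e f)
  \<comment> \<open>Bounds for the offset of \<open>y\<close> from \<open>t\<close> times
    \<open>y0\<close>: \<open>C1\<close> and \<open>C2\<close> along \<open>e\<close> and
    \<open>f\<close>, \<open>C3\<close> for the part spanned by \<open>w\<close>, \<open>e\<close>
    and \<open>f\<close>, and \<open>t * C4\<close> for the rest when
    \<open>t \<ge> 1\<close>.\<close>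
  define C1 where "C1 = C / norm v"
  define C2 where "C2 = (C + \<bar>v' \<bullet> e\<bar> * C1) / norm f'"
  define C3 where "C3 = C + C1 + C2"
  define C4 where "C4 = 2 * (C + norm y0 + C3)"
  have pos: "0 \<le> C1" "0 \<le> C2" "0 \<le> C3" "0 \<le> C4"
    using C v f'0 by (auto simp: C1_def C2_def C3_def C4_def)
  \<comment> \<open>A disc orthogonal to \<open>w\<close>, \<open>e\<close> and \<open>f\<close>; it
    takes the role of \<open>M\<close> in \<open>flat_body_3\<close>.\<close>
  define G where "G = {g. g \<bullet> w = 0 \<and> g \<bullet> e = 0 \<and> g \<bullet> f = 0 \<and> norm g \<le> C4}"
  have "{g. g \<bullet> w = 0 \<and> g \<bullet> e = 0 \<and> g \<bullet> f = 0 \<and> norm g \<le> C4} =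
      {g. g \<bullet> w = 0 \<and> g \<bullet> e = 0 \<and> norm g \<le> C4} \<inter> {g. f \<bullet> g = 0}"
    by (auto simp: inner_commute)
  then have "compact G" "convex G"
    unfolding G_def using convex_body_disc[of C4 w e] pos
    by (auto simp: convex_body_def intro!: compact_Int_closed closed_hyperplane convex_Int convex_hyperplane)
  then have bG: "convex_body G" using pos by (auto simp: convex_body_def G_def intro!: exI[of _ 0])
  interpret G: flat_body_3 G w e f
    by unfold_locales (use dim bG w e f in \<open>auto simp: G_def\<close>)
  have bC: "convex_body (cball (0 :: real^'n) C3)" using pos by (simp add: convex_body_def)
  define Z where "Z t = (+) (t *\<^sub>R y0) ` (cball 0 C3 + dilate t G)" for t
  show thesis
  proof (rule that)
    show "convex_body (Z t)" for t
      unfolding Z_def by (intro convex_body_translation convex_body_plus convex_body_dilate bC bG)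
    show "((\<lambda>t. vol (Z t) / t ^ (CARD('n) - 2)) \<longlongrightarrow> 0) at_top"
      unfolding Z_def vol_translation by (rule G.thickening_limit[OF bC])
    show "\<forall>\<^sub>F t in at_top. \<forall>y. \<bar>y \<bullet> v - t\<bar> \<le> C \<and> \<bar>y \<bullet> v' - t\<bar> \<le> C \<and> \<bar>y \<bullet> w\<bar> \<le> C \<and> norm y \<le> C * (1 + t) \<longrightarrow> y \<in> Z t"
      using eventually_ge_at_top[of 1]
    proof eventually_elim
      case (elim t)
      show ?case
      proof (intro allI impI)
        fix y assume y: "\<bar>y \<bullet> v - t\<bar> \<le> C \<and> \<bar>y \<bullet> v' - t\<bar> \<le> C \<and> \<bar>y \<bullet> w\<bar> \<le> C \<and> norm y \<le> C * (1 + t)"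
        define z where "z = y - t *\<^sub>R y0"
        have zv: "\<bar>z \<bullet> v\<bar> \<le> C" and zv': "\<bar>z \<bullet> v'\<bar> \<le> C" and zw: "\<bar>z \<bullet> w\<bar> \<le> C"
          using y by (simp_all add: z_def inner_diff_left y0v y0v' y0w)
        have "z \<bullet> v = norm v * (z \<bullet> e)" by (subst ve) simp
        then have ze: "\<bar>z \<bullet> e\<bar> \<le> C1" using zv v by (simp add: C1_def field_simps abs_mult)
        have "z \<bullet> v' = (v' \<bullet> e) * (z \<bullet> e) + norm f' * (z \<bullet> f)" by (subst v'f) (simp add: inner_add_right)
        then have "norm f' * \<bar>z \<bullet> f\<bar> = \<bar>z \<bullet> v' - (v' \<bullet> e) * (z \<bullet> e)\<bar>" using f'0 by (simp add: abs_mult)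
        also have "\<dots> \<le> C + \<bar>v' \<bullet> e\<bar> * C1"
          using zv' mult_left_mono[OF ze, of "\<bar>v' \<bullet> e\<bar>"] abs_triangle_ineq4[of "z \<bullet> v'" "(v' \<bullet> e) * (z \<bullet> e)"]
          by (simp add: abs_mult)
        finally have zf: "\<bar>z \<bullet> f\<bar> \<le> C2" using f'0 by (simp add: C2_def field_simps)
        define z1 where "z1 = (z \<bullet> w) *\<^sub>R w + (z \<bullet> e) *\<^sub>R e + (z \<bullet> f) *\<^sub>R f"
        define z2 where "z2 = z - z1"
        have "norm z1 \<le> \<bar>z \<bullet> w\<bar> + \<bar>z \<bullet> e\<bar> + \<bar>z \<bullet> f\<bar>"
          unfolding z1_def using w e f by (intro norm_triangle_le add_mono) auto
        then have n1: "norm z1 \<le> C3" using zw ze zf by (simp add: C3_def)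
        have "norm z2 \<le> norm y + t * norm y0 + norm z1"
          using norm_triangle_ineq4[of z z1] norm_triangle_ineq4[of y "t *\<^sub>R y0"] elim
          by (simp add: z2_def z_def)
        also have "\<dots> \<le> C * (1 + t) + t * norm y0 + C3" using y n1 by simp
        also have "\<dots> \<le> t * C4"
        proof -
          have "C \<le> C * t" "C3 \<le> C3 * t" using C pos elim by (simp_all add: mult_le_cancel_left1)
          moreover have "0 \<le> t * norm y0" "0 \<le> C3 * t" using elim pos by auto
          ultimately show ?thesis by (simp add: C4_def algebra_simps)
        qed
        finally have n2: "norm z2 \<le> t * C4" .
        have "z2 \<bullet> w = 0" "z2 \<bullet> e = 0" "z2 \<bullet> f = 0"
          by (simp_all add: z2_def z1_def inner_diff_left inner_add_left ww ee ff e f sym)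
        then have "(1 / t) *\<^sub>R z2 \<in> G"
          using n2 elim by (simp add: G_def field_simps)
        then have "z2 \<in> dilate t G" using elim by (intro image_eqI[of _ _ "(1 / t) *\<^sub>R z2"]) auto
        then have "z1 + z2 \<in> cball 0 C3 + dilate t G" using n1 by (intro set_plus_intro) auto
        then have "t *\<^sub>R y0 + (z1 + z2) \<in> Z t" unfolding Z_def by (rule imageI)
        then show "y \<in> Z t" by (simp add: z2_def z_def)
      qed
    qed
  qed
qed

text \<open>Take a point \<open>b + j + t p\<close> of the larger sum. If \<open>p\<close> is close
  to at most one facet, \<open>b\<close> can be exchanged for a point \<open>a\<close> of
  \<open>A\<close> on the same supporting hyperplane, since \<open>p + (b - a) / t\<close> still
  lies in \<open>M\<close>. The points with \<open>p\<close> close to two facets have a volume of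
  lower order.\<close>

lemma (in flat_body) \<phi>_eq_if_polytope:
  assumes F: "finite F" "\<And>v. v \<in> F \<Longrightarrow> v \<bullet> w = 0"
    and MF: "M = {x. x \<bullet> w = 0 \<and> (\<forall>v\<in>F. x \<bullet> v \<le> 1)}"
    and A: "flat w A" and B: "flat w B" and AB: "A \<subseteq> B"
    and eq: "\<And>v. v \<in> F \<Longrightarrow> supp A v = supp B v"
  shows "\<phi> A = \<phi> B"
proof -
  have bA: "convex_body A" and bB: "convex_body B" using A B by (auto simp: flat_def)
  obtain c where c: "\<And>x. x \<in> B \<Longrightarrow> x \<bullet> w = c" using B by (auto simp: flat_def)
  obtain R where R: "0 < R" "\<And>x. x \<in> B \<Longrightarrow> norm x \<le> R"
    using bB by (metis bounded_pos compact_imp_bounded convex_body_def)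
  obtain Q where Q: "0 < Q" "\<And>x. x \<in> M \<Longrightarrow> norm x \<le> Q"
    using M by (metis bounded_pos compact_imp_bounded convex_body_def)
  obtain \<Lambda> where \<Lambda>: "0 < \<Lambda>" "\<And>v. v \<in> F \<Longrightarrow> norm v \<le> \<Lambda>"
    using finite_imp_bounded[OF F(1)] by (metis bounded_pos)
  \<comment> \<open>Large enough for all bounds in \<open>near\<close>:
    \<open>3 * R * \<Lambda>\<close> for the facet equations, \<open>R + 1\<close> for the part in
    \<open>B + J\<close>, and \<open>Q\<close> for the scaled point of \<open>M\<close>.\<close>
  define C where "C = 3 * R * \<Lambda> + R + 1 + Q"
  have C: "0 \<le> C" using R \<Lambda> Q by (simp add: C_def)
  let ?P = "{(v, v'). v \<in> F \<and> v' \<in> F \<and> v \<noteq> v'}"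
  have finP: "finite ?P" by (rule finite_subset[of _ "F \<times> F"]) (use F in auto)
  define near where "near p t y \<longleftrightarrow> \<bar>y \<bullet> fst p - t\<bar> \<le> C \<and> \<bar>y \<bullet> snd p - t\<bar> \<le> C \<and>
      \<bar>y \<bullet> w\<bar> \<le> C \<and> norm y \<le> C * (1 + t)" for p t y
  define good where "good p Z \<longleftrightarrow> (\<forall>t. convex_body (Z t)) \<and>
    ((\<lambda>t. vol (Z t) / t ^ (CARD('n) - 2)) \<longlongrightarrow> 0) at_top \<and>
    (\<forall>\<^sub>F t in at_top. \<forall>y. near p t y \<longrightarrow> y \<in> Z t)" for p and Z :: "real \<Rightarrow> (real^'n) set"
  have "\<exists>Z. good p Z" if "p \<in> ?P" for p
  proof -
    have p: "fst p \<bullet> w = 0" "snd p \<bullet> w = 0" "fst p \<noteq> snd p" using that F(2) by auto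
    show ?thesis
      by (rule near_codim_2_negligible[OF dim w p C]) (auto simp: good_def near_def)
  qed
  then obtain Z where good: "\<forall>p\<in>?P. good p (Z p)"
    using bchoice[of ?P good] by blast
  have Z: "\<And>t. convex_body (Z p t)" "((\<lambda>t. vol (Z p t) / t ^ (CARD('n) - 2)) \<longlongrightarrow> 0) at_top"
    "\<forall>\<^sub>F t in at_top. \<forall>y. near p t y \<longrightarrow> y \<in> Z p t" if "p \<in> ?P" for p
    using bspec[OF good that] by (auto simp: good_def)
  have cover: "\<forall>\<^sub>F t in at_top. B + J + dilate t M \<subseteq> (A + J + dilate t M) \<union> (\<Union>p\<in>?P. Z p t)"
  proof -
    have "\<forall>\<^sub>F t in at_top. \<forall>p\<in>?P. \<forall>y. near p t y \<longrightarrow> y \<in> Z p t"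
      using Z(3) by (intro eventually_ball_finite finP ballI)
    then show ?thesis
      using eventually_gt_at_top[of 0]
    proof eventually_elim
      case (elim t)
      show ?case
      proof
        fix y assume "y \<in> B + J + dilate t M"
        then obtain b j p where y: "y = b + j + t *\<^sub>R p" "b \<in> B" "j \<in> J" "p \<in> M"
          by (auto elim!: set_plus_elim)
        obtain r where r: "0 \<le> r" "r \<le> 1" "j = r *\<^sub>R w" using y(3) by (auto simp: in_segment)
        \<comment> \<open>A facet is tight if a shift of \<open>p\<close> by
          \<open>(b - a) / t\<close> might cross it; \<open>2 * R * \<Lambda>\<close> bounds the
          change of \<open>v\<close> between two points of \<open>B\<close>.\<close>
        define tight where "tight v \<longleftrightarrow> p \<bullet> v > 1 - 2 * R * \<Lambda> / t" for v
        have inner_le: "\<bar>x \<bullet> v\<bar> \<le> R * \<Lambda>" if "norm x \<le> R" "v \<in> F" for x v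
          using Cauchy_Schwarz_ineq2[of x v] mult_mono[OF that(1) \<Lambda>(2)[OF that(2)]] R by simp
        have pM: "p \<bullet> w = 0" "\<And>v. v \<in> F \<Longrightarrow> p \<bullet> v \<le> 1" using y(4) MF by auto
        show "y \<in> (A + J + dilate t M) \<union> (\<Union>p\<in>?P. Z p t)"
        proof (cases "\<exists>v\<in>F. \<exists>v'\<in>F. v \<noteq> v' \<and> tight v \<and> tight v'")
          case True
          then obtain v v' where vv: "v \<in> F" "v' \<in> F" "v \<noteq> v'" "tight v" "tight v'" by blast
          have nr: "\<bar>y \<bullet> u - t\<bar> \<le> C" if u: "u \<in> F" "tight u" for u
          proof -
            have "y \<bullet> u = b \<bullet> u + t * (p \<bullet> u)"
              using F(2)[OF u(1)] by (simp add: y(1) r inner_add_left inner_commute[of w])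
            moreover have "t * (p \<bullet> u) \<le> t" using pM(2)[OF u(1)] elim by (simp add: mult_left_le)
            moreover have "t * (p \<bullet> u) \<ge> t - 2 * R * \<Lambda>"
              using mult_left_mono[OF less_imp_le[OF u(2)[unfolded tight_def]], of t] elim by (simp add: algebra_simps)
            ultimately show ?thesis using inner_le[OF R(2)[OF y(2)] u(1)] R \<Lambda> Q by (simp add: C_def abs_le_iff)
          qed
          have yw: "\<bar>y \<bullet> w\<bar> \<le> C"
          proof -
            have "y \<bullet> w = b \<bullet> w + r" using pM ww by (simp add: y(1) r inner_add_left)
            moreover have "\<bar>b \<bullet> w\<bar> \<le> R" using Cauchy_Schwarz_ineq2[of b w] w R(2)[OF y(2)] by simp
            moreover have "0 \<le> 3 * R * \<Lambda>" using R \<Lambda> by simp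
            ultimately show ?thesis using r Q by (simp add: C_def)
          qed
          have "norm y \<le> norm b + norm j + norm (t *\<^sub>R p)" unfolding y(1) by (intro norm_triangle_le add_mono) auto
          also have "\<dots> \<le> R + 1 + t * Q"
            using R(2)[OF y(2)] Q(2)[OF y(4)] r w elim by (intro add_mono) (auto simp: mult_left_mono)
          also have "\<dots> \<le> C * (1 + t)"
          proof -
            have "0 \<le> R * \<Lambda>" "0 \<le> R * (t * \<Lambda>)" "0 \<le> R * t" using R \<Lambda> elim by auto
            then show ?thesis using R Q elim by (simp add: C_def algebra_simps)
          qed
          finally have "norm y \<le> C * (1 + t)" .
          then have "near (v, v') t y" using nr vv yw by (simp add: near_def)
          then have "y \<in> Z (v, v') t" using elim(1) vv by blast
          then show ?thesis using vv by blast
        next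
          case False
          have "\<exists>a\<in>A. \<forall>v\<in>F. tight v \<longrightarrow> a \<bullet> v = supp A v"
          proof (cases "\<exists>v\<in>F. tight v")
            case True
            then obtain v where v: "v \<in> F" "tight v" by blast
            obtain a where "a \<in> A" "a \<bullet> v = supp A v" using supp_attained[OF bA] by metis
            moreover have "\<forall>v'\<in>F. tight v' \<longrightarrow> v' = v" using False v by blast
            ultimately show ?thesis by auto
          qed (use bA in \<open>auto simp: convex_body_def\<close>)
          then obtain a where a: "a \<in> A" "\<And>v. v \<in> F \<Longrightarrow> tight v \<Longrightarrow> a \<bullet> v = supp A v" by blast
          define p' where "p' = p + (1 / t) *\<^sub>R (b - a)"
          have aB: "a \<in> B" using a AB by blast
          have "p' \<in> M"
          proof -
            have "p' \<bullet> v \<le> 1" if v: "v \<in> F" for v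
            proof (cases "tight v")
              case True
              have "b \<bullet> v \<le> a \<bullet> v" using supp_ge[OF bB y(2), of v] eq[OF v] a(2)[OF v True] by simp
              then have "(1 / t) * ((b - a) \<bullet> v) \<le> 0"
                using elim by (simp add: inner_diff_left divide_nonpos_pos)
              then show ?thesis using pM(2)[OF v] by (simp add: p'_def inner_add_left)
            next
              case False
              have "(b - a) \<bullet> v \<le> 2 * R * \<Lambda>"
                using inner_le[OF R(2)[OF y(2)] v] inner_le[OF R(2)[OF aB] v] by (simp add: inner_diff_left)
              then have "(1 / t) * ((b - a) \<bullet> v) \<le> 2 * R * \<Lambda> / t"
                using elim by (simp add: divide_right_mono)
              then show ?thesis using False by (simp add: p'_def inner_add_left tight_def)
            qed
            moreover have "p' \<bullet> w = 0" using pM c[OF y(2)] c[OF aB] by (simp add: p'_def inner_add_left inner_diff_left)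
            ultimately show ?thesis using MF by simp
          qed
          then have "a + j + t *\<^sub>R p' \<in> A + J + dilate t M" using a y by (intro set_plus_intro) auto
          moreover have "a + j + t *\<^sub>R p' = y" using elim by (simp add: p'_def y(1) scaleR_add_right)
          ultimately show ?thesis by simp
        qed
      qed
    qed
  qed
  have "real (CARD('n) choose 2) * (\<phi> B - \<phi> A) \<le> (\<Sum>p\<in>?P. 0)"
  proof (rule tendsto_le[OF _ _ \<phi>_limit[OF A B]])
    show "((\<lambda>t. \<Sum>p\<in>?P. vol (Z p t) / t ^ (CARD('n) - 2)) \<longlongrightarrow> (\<Sum>p\<in>?P. 0)) at_top"
      using Z(2) by (intro tendsto_sum) auto
    show "\<forall>\<^sub>F t in at_top. (vol (B + J + dilate t M) - vol (A + J + dilate t M)) / t ^ (CARD('n) - 2)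
        \<le> (\<Sum>p\<in>?P. vol (Z p t) / t ^ (CARD('n) - 2))"
      using cover eventually_gt_at_top[of 0]
    proof eventually_elim
      case (elim t)
      have m1: "A + J + dilate t M \<in> lmeasurable" "B + J + dilate t M \<in> lmeasurable"
        using bA bB M by (auto intro!: convex_body_lmeasurable convex_body_plus convex_body_dilate)
      have m2: "Z p t \<in> lmeasurable" if "p \<in> ?P" for p
        using Z(1)[OF that] by (rule convex_body_lmeasurable)
      have m3: "(\<Union>p\<in>?P. Z p t) \<in> lmeasurable" using m2 finP by (intro fmeasurable.finite_UN) auto
      have "vol (B + J + dilate t M) \<le> vol ((A + J + dilate t M) \<union> (\<Union>p\<in>?P. Z p t))"
        using elim(1) m1 m3 by (intro measure_mono_fmeasurable) (auto intro: fmeasurableD)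
      also have "\<dots> \<le> vol (A + J + dilate t M) + vol (\<Union>p\<in>?P. Z p t)"
        using m1 m3 by (intro measure_Un_le) (auto intro: fmeasurableD)
      also have "vol (\<Union>p\<in>?P. Z p t) \<le> (\<Sum>p\<in>?P. vol (Z p t))"
        using m2 finP by (intro measure_UNION_le) (auto intro: fmeasurableD)
      finally have "vol (B + J + dilate t M) - vol (A + J + dilate t M) \<le> (\<Sum>p\<in>?P. vol (Z p t))" by simp
      then have "(vol (B + J + dilate t M) - vol (A + J + dilate t M)) / t ^ (CARD('n) - 2) \<le>
          (\<Sum>p\<in>?P. vol (Z p t)) / t ^ (CARD('n) - 2)"
        using elim by (intro divide_right_mono) auto
      then show ?case by (simp add: sum_divide_distrib)
    qed
  qed simp
  then have "\<phi> B - \<phi> A \<le> 0" using binom_pos by (simp add: mult_le_0_iff)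
  moreover have "\<phi> A \<le> \<phi> B" by (rule \<phi>_mono[OF A B AB])
  ultimately show ?thesis by simp
qed

subsection \<open>Full-dimensional bodies in a hyperplane\<close>

lemma power_growth:
  fixes a s :: real
  assumes "0 \<le> a" "0 \<le> s"
  shows "(a + s) ^ Suc m - a ^ Suc m \<ge> s * a ^ m"
proof -
  have "(a + s) * a ^ m \<le> (a + s) * (a + s) ^ m"
    using assms by (intro mult_left_mono power_mono) auto
  then show ?thesis by (simp add: algebra_simps)
qed

lemma supp_lipschitz:
  assumes X: "convex_body X" and R: "\<And>x. x \<in> X \<Longrightarrow> norm x \<le> R"
  shows "supp X u \<le> supp X v + R * norm (u - v)"
  unfolding supp_le_iff[OF X]
proof
  fix x assume x: "x \<in> X"
  have "x \<bullet> u = x \<bullet> v + x \<bullet> (u - v)" by (simp add: inner_diff_right)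
  also have "x \<bullet> (u - v) \<le> norm x * norm (u - v)" by (rule norm_cauchy_schwarz)
  also have "\<dots> \<le> R * norm (u - v)" using R[OF x] by (intro mult_right_mono) auto
  finally show "x \<bullet> u \<le> supp X v + R * norm (u - v)" using supp_ge[OF X x, of v] by simp
qed

locale full_flat_body = flat_body +
  fixes r assumes r: "0 < r" and rM: "\<And>x. x \<bullet> w = 0 \<Longrightarrow> norm x \<le> r \<Longrightarrow> x \<in> M"
begin

text \<open>The polar body of \<open>M\<close> relative to the hyperplane orthogonal to
  \<open>w\<close>.\<close>

definition D where "D = {v. v \<bullet> w = 0 \<and> (\<forall>x\<in>M. x \<bullet> v \<le> 1)}"
definition E where "E = {v. v extreme_point_of D}"

lemma zero_M: "0 \<in> M" using rM[of 0] r by simp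

lemma zero_D: "0 \<in> D" by (simp add: D_def)

lemma norm_D: "v \<in> D \<Longrightarrow> norm v \<le> 1 / r"
proof (cases "v = 0")
  case False
  assume v: "v \<in> D"
  then have "(r / norm v) *\<^sub>R v \<in> M" using False r by (intro rM) (auto simp: D_def)
  then have "((r / norm v) *\<^sub>R v) \<bullet> v \<le> 1" using v unfolding D_def by blast
  moreover have "v \<bullet> v = norm v * norm v" by (simp add: dot_square_norm power2_eq_square)
  ultimately have "r * norm v \<le> 1" using False by simp
  then show ?thesis using r by (simp add: field_simps)
qed (use r in simp)

lemma compact_D: "compact D"
proof -
  have D: "D = {v. w \<bullet> v = 0} \<inter> (\<Inter>x\<in>M. {v. x \<bullet> v \<le> 1})" by (auto simp: D_def inner_commute)
  have "closed D" unfolding D by (intro closed_Int closed_INT ballI closed_hyperplane closed_halfspace_le)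
  moreover have "bounded D" using norm_D by (auto simp: bounded_iff)
  ultimately show ?thesis by (simp add: compact_eq_bounded_closed)
qed

lemma convex_D: "convex D"
proof -
  have D: "D = {v. w \<bullet> v = 0} \<inter> (\<Inter>x\<in>M. {v. x \<bullet> v \<le> 1})" by (auto simp: D_def inner_commute)
  show ?thesis unfolding D by (intro convex_Int convex_INT convex_hyperplane convex_halfspace_le)
qed

lemma E_D: "v \<in> E \<Longrightarrow> v \<in> D"
  by (auto simp: E_def extreme_point_of_def)

lemma D_hull: "D = convex hull E"
  unfolding E_def by (rule Krein_Milman_Minkowski[OF compact_D convex_D])

lemma proj_w: "(u - (u \<bullet> w) *\<^sub>R w) \<bullet> w = 0"
  by (simp add: inner_diff_left ww)

lemma inner_proj: "x \<bullet> w = 0 \<Longrightarrow> x \<bullet> (u - (u \<bullet> w) *\<^sub>R w) = x \<bullet> u"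
  by (simp add: inner_diff_right)

text \<open>A point outside \<open>M\<close> is cut off by a point of the polar body. As the latter
  is the convex hull of \<open>E\<close>, a linear functional exceeding one somewhere on it does so
  at a point of \<open>E\<close>.\<close>

lemma extreme_separation:
  assumes x: "x \<bullet> w = 0" "x \<notin> M"
  obtains v where "v \<in> E" "x \<bullet> v > 1"
proof -
  obtain u b where u: "u \<bullet> x < b" "\<And>y. y \<in> M \<Longrightarrow> u \<bullet> y > b"
    using separating_hyperplane_closed_point[of M x] M x by (auto simp: convex_body_def compact_imp_closed)
  have b: "b < 0" using u(2)[OF zero_M] by simp
  define v where "v = (1 / b) *\<^sub>R (u - (u \<bullet> w) *\<^sub>R w)"
  have "v \<in> D"
    unfolding D_def
  proof (intro CollectI conjI ballI)
    fix y assume y: "y \<in> M"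
    then have "y \<bullet> v = (u \<bullet> y) / b" using inner_proj[OF Mw[OF y]] by (simp add: v_def inner_commute)
    then show "y \<bullet> v \<le> 1" using u(2)[OF y] b by (simp add: divide_le_eq)
  qed (simp add: v_def proj_w)
  moreover have "x \<bullet> v > 1"
    using inner_proj[OF x(1)] u(1) b by (simp add: v_def inner_commute less_divide_eq)
  moreover have "\<exists>v\<in>E. x \<bullet> v > 1"
  proof (rule ccontr)
    assume "\<not> ?thesis"
    then have "convex hull E \<subseteq> {v. x \<bullet> v \<le> 1}"
      by (intro hull_minimal convex_halfspace_le) auto
    then show False using D_hull calculation by auto
  qed
  ultimately show thesis using that by blast
qed

text \<open>Finitely many extreme normals cut off the compact shell \<open>Z\<close> of points at
  distance \<open>r * \<delta>\<close> from \<open>M\<close>. Points farther out are cut off too,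
  because their segments to the origin cross the shell. Points closer to \<open>M\<close> are in
  \<open>dilate (1 + \<delta>) M\<close>, because \<open>M\<close> contains a relative ball of
  radius \<open>r\<close>.\<close>

lemma outer_polytope:
  assumes \<delta>: "0 < \<delta>"
  obtains F where "finite F" "F \<subseteq> E"
    "{x. x \<bullet> w = 0 \<and> (\<forall>v\<in>F. x \<bullet> v \<le> 1)} \<subseteq> dilate (1 + \<delta>) M"
proof -
  define Z where "Z = {x. x \<bullet> w = 0 \<and> infdist x M = r * \<delta>}"
  have cM: "closed M" "M \<noteq> {}" "compact M" using M by (auto simp: convex_body_def compact_imp_closed)
  have rd: "0 < r * \<delta>" using r \<delta> by simp
  obtain Q where Q: "\<And>x. x \<in> M \<Longrightarrow> norm x \<le> Q" using cM(3) compact_imp_bounded bounded_iff by metis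
  have near: "\<exists>m\<in>M. norm (x - m) = infdist x M" for x
    using infdist_attains_inf[OF cM(1,2), of x] by (metis dist_norm)
  have "closed Z"
    unfolding Z_def by (intro closed_Collect_conj closed_Collect_eq continuous_intros)
  moreover have "bounded Z"
    unfolding bounded_iff
  proof (intro exI ballI)
    fix x assume "x \<in> Z"
    then obtain m where "m \<in> M" "norm (x - m) = r * \<delta>" using near[of x] by (auto simp: Z_def)
    then show "norm x \<le> Q + r * \<delta>" using Q[of m] norm_triangle_ineq2[of x m] by linarith
  qed
  ultimately have "compact Z" by (simp add: compact_eq_bounded_closed)
  moreover have "Z \<subseteq> (\<Union>v\<in>E. {x. v \<bullet> x > 1})"
  proof
    fix x assume x: "x \<in> Z"
    then have "x \<notin> M" using rd by (auto simp: Z_def)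
    then obtain v where "v \<in> E" "x \<bullet> v > 1" using extreme_separation x by (auto simp: Z_def)
    then show "x \<in> (\<Union>v\<in>E. {x. v \<bullet> x > 1})" by (auto simp: inner_commute)
  qed
  ultimately obtain F where F: "F \<subseteq> E" "finite F" "Z \<subseteq> (\<Union>v\<in>F. {x. v \<bullet> x > 1})"
    using compactE_image[of Z E "\<lambda>v. {x. v \<bullet> x > 1}"] open_halfspace_gt by metis
  have "{x. x \<bullet> w = 0 \<and> (\<forall>v\<in>F. x \<bullet> v \<le> 1)} \<subseteq> dilate (1 + \<delta>) M"
  proof
    fix x assume "x \<in> {x. x \<bullet> w = 0 \<and> (\<forall>v\<in>F. x \<bullet> v \<le> 1)}"
    then have x: "x \<bullet> w = 0" "\<And>v. v \<in> F \<Longrightarrow> x \<bullet> v \<le> 1" by auto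
    have lt: "infdist x M < r * \<delta>"
    proof (rule ccontr)
      assume "\<not> ?thesis"
      then have ge: "r * \<delta> \<le> infdist (1 *\<^sub>R x) M" by simp
      have le: "infdist (0 *\<^sub>R x) M \<le> r * \<delta>" using rd zero_M by simp
      have "continuous_on {0..1} (\<lambda>t. infdist (t *\<^sub>R x) M)" by (intro continuous_intros)
      then obtain t where t: "0 \<le> t" "t \<le> 1" "infdist (t *\<^sub>R x) M = r * \<delta>"
        using IVT'[of "\<lambda>t. infdist (t *\<^sub>R x) M" 0 "r * \<delta>" 1] ge le by auto
      then have "t *\<^sub>R x \<in> Z" using x by (simp add: Z_def)
      then obtain v where v: "v \<in> F" "v \<bullet> (t *\<^sub>R x) > 1" using F(3) by auto
      have "t * (x \<bullet> v) \<le> t * 1" using x(2)[OF v(1)] t by (intro mult_left_mono) auto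
      then show False using v(2) t by (simp add: inner_commute)
    qed
    obtain m where m: "m \<in> M" "norm (x - m) = infdist x M" using near by blast
    have "(1 / \<delta>) *\<^sub>R (x - m) \<in> M"
    proof (rule rM)
      show "((1 / \<delta>) *\<^sub>R (x - m)) \<bullet> w = 0" using x Mw[OF m(1)] by (simp add: inner_diff_left)
      have "norm (x - m) \<le> r * \<delta>" using m lt by simp
      then show "norm ((1 / \<delta>) *\<^sub>R (x - m)) \<le> r" using \<delta> by (simp add: divide_le_eq)
    qed
    then have "(1 / (1 + \<delta>)) *\<^sub>R m + (\<delta> / (1 + \<delta>)) *\<^sub>R ((1 / \<delta>) *\<^sub>R (x - m)) \<in> M"
      using M m \<delta> by (intro convexD) (auto simp: convex_body_def field_simps)
    moreover have "(1 / (1 + \<delta>)) *\<^sub>R m + (\<delta> / (1 + \<delta>)) *\<^sub>R ((1 / \<delta>) *\<^sub>R (x - m)) = (1 / (1 + \<delta>)) *\<^sub>R x"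
      using \<delta> by (simp add: algebra_simps)
    ultimately show "x \<in> dilate (1 + \<delta>) M"
      using \<delta> by (intro image_eqI[of _ _ "(1 / (1 + \<delta>)) *\<^sub>R x"]) auto
  qed
  then show thesis using that F by blast
qed

text \<open>Outer polytopes with normals in \<open>E\<close> approximate \<open>M\<close>. For each
  of them the polytope case applies, and the functionals converge because they are fixed
  combinations of volumes squeezed between those for \<open>M\<close> and for slightly larger
  dilates.\<close>

lemma \<phi>_eq_if_supp_eq:
  assumes A: "flat w A" and B: "flat w B" and AB: "A \<subseteq> B"
    and eq: "\<And>v. v \<in> E \<Longrightarrow> supp A v = supp B v"
  shows "\<phi> A = \<phi> B"
proof -
  have "\<exists>P. flat_body P w \<and> M \<subseteq> P \<and> P \<subseteq> dilate (1 + 1 / Suc k) M \<and> flat_body.\<phi> P w A = flat_body.\<phi> P w B" for k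
  proof -
    obtain F where F: "finite F" "F \<subseteq> E" "{x. x \<bullet> w = 0 \<and> (\<forall>v\<in>F. x \<bullet> v \<le> 1)} \<subseteq> dilate (1 + 1 / Suc k) M"
      using outer_polytope[of "1 / Suc k"] by auto
    define P where "P = {x. x \<bullet> w = 0 \<and> (\<forall>v\<in>F. x \<bullet> v \<le> 1)}"
    have MP: "M \<subseteq> P" using F(2) E_D Mw by (fastforce simp: P_def D_def)
    have Peq: "P = {x. w \<bullet> x = 0} \<inter> (\<Inter>v\<in>F. {x. v \<bullet> x \<le> 1})" by (auto simp: P_def inner_commute)
    have "convex P" unfolding Peq by (intro convex_Int convex_INT convex_hyperplane convex_halfspace_le)
    moreover have "closed P"
      unfolding Peq by (intro closed_Int closed_INT ballI closed_hyperplane closed_halfspace_le)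
    moreover have "bounded P"
      using F(3) convex_body_dilate[OF M, of "1 + 1 / Suc k"] unfolding P_def convex_body_def
      by (meson bounded_subset compact_imp_bounded)
    ultimately have bP: "convex_body P"
      using MP zero_M by (auto simp: convex_body_def compact_eq_bounded_closed)
    interpret P: flat_body P w
      using dim bP w by unfold_locales (auto simp: P_def)
    have "P.\<phi> A = P.\<phi> B"
    proof (rule P.\<phi>_eq_if_polytope[OF F(1) _ P_def A B AB])
      show "v \<bullet> w = 0" "supp A v = supp B v" if "v \<in> F" for v
        using that F(2) E_D eq by (auto simp: D_def)
    qed
    then show ?thesis using MP F(3) P.flat_body_axioms by (intro exI[of _ P]) (auto simp: P_def)
  qed
  then obtain P where P: "\<And>k. flat_body (P k) w" "\<And>k. M \<subseteq> P k" "\<And>k. P k \<subseteq> dilate (1 + 1 / Suc k) M"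
     "\<And>k. flat_body.\<phi> (P k) w A = flat_body.\<phi> (P k) w B"
    by metis
  have lim: "(\<lambda>k. flat_body.\<phi> (P k) w X) \<longlonglongrightarrow> \<phi> X" if X: "flat w X" for X
  proof -
    have bX: "convex_body X" "convex_body (X + J)" using X by (auto simp: flat_def convex_body_plus)
    have bP: "convex_body (P k)" for k using P(1)[of k] by (simp add: flat_body_def)
    have "(\<lambda>k. vol (X + J + dilate (real j) (P k))) \<longlonglongrightarrow> vol (X + J + dilate (real j) M)" for j
    proof (rule tendsto_sandwich[OF _ _ tendsto_const])
      show "\<forall>\<^sub>F k in sequentially. vol (X + J + dilate (real j) M) \<le> vol (X + J + dilate (real j) (P k))"
        using P(2) by (intro always_eventually allI vol_mono convex_body_plus convex_body_dilate set_plus_mono2 image_mono bX bP M) auto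
      have sc: "dilate (real j) (dilate (1 + 1 / Suc k) M) = dilate (real j * (1 + 1 / Suc k)) M" for k
        by (simp add: image_image)
      show "\<forall>\<^sub>F k in sequentially. vol (X + J + dilate (real j) (P k)) \<le> vol (X + J + dilate (real j * (1 + 1 / Suc k)) M)"
        unfolding sc[symmetric] using P(3)
        by (intro always_eventually allI vol_mono convex_body_plus convex_body_dilate set_plus_mono2 image_mono bX bP M) auto
      have t: "(\<lambda>k. real j * (1 + 1 / Suc k)) \<longlonglongrightarrow> real j * (1 + 0)"
        using LIMSEQ_inverse_real_of_nat by (intro tendsto_intros) (simp add: divide_inverse)
      have "(\<lambda>k. \<Sum>i\<le>CARD('a). of_nat (CARD('a) choose i) * ((real j * (1 + 1 / Suc k)) ^ (CARD('a) - i) * mvk M i (X + J)))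
         \<longlonglongrightarrow> (\<Sum>i\<le>CARD('a). of_nat (CARD('a) choose i) * ((real j * (1 + 0)) ^ (CARD('a) - i) * mvk M i (X + J)))"
        by (intro tendsto_intros t)
      then show "(\<lambda>k. vol (X + J + dilate (real j * (1 + 1 / Suc k)) M)) \<longlonglongrightarrow> vol (X + J + dilate (real j) M)"
        by (subst (1 2) volume_mvk_expansion[OF bX(2) M]) auto
    qed
    then show ?thesis
      unfolding flat_body.\<phi>_def[OF P(1)] \<phi>_def
      using dim by (simp add: mvk_eq_mv_coeff bX bP M) (intro tendsto_intros)
  qed
  show ?thesis
    using LIMSEQ_unique[OF lim[OF A]] lim[OF B] P(4) by simp
qed

text \<open>The dilate of \<open>X + J\<close> has height \<open>c\<close>, and its nonempty slices
  are translates of \<open>dilate c X\<close>. Dividing the factor \<open>c ^ n\<close> of the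
  volume by this height leaves \<open>c ^ (n - 1)\<close>.\<close>

lemma vol_dilate_horizontal:
  assumes X: "\<And>x. x \<in> X \<Longrightarrow> x \<bullet> w = 0" and XJ: "X + J \<in> sets borel" "bounded (X + J)" and c: "0 < c"
  shows "vol (dilate c X + J) = c ^ (CARD('a) - 1) * vol (X + J)"
proof -
  have sl: "slice w (dilate c (X + J)) s + J = (if 0 \<le> s \<and> s \<le> c then (+) (s *\<^sub>R w) ` (dilate c X + J) else {})" for s
  proof -
    have "slice w (dilate c (X + J)) s = (if 0 \<le> s \<and> s \<le> c then (+) (s *\<^sub>R w) ` dilate c X else {})"
    proof (intro equalityI subsetI)
      fix y assume "y \<in> slice w (dilate c (X + J)) s"
      then obtain x q where "x \<in> X" "0 \<le> q" "q \<le> 1" "y = c *\<^sub>R (x + q *\<^sub>R w)" "y \<bullet> w = s"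
        by (auto simp: slice_def in_segment elim!: set_plus_elim)
      moreover have "s = c * q" using calculation X ww by (simp add: inner_add_left)
      ultimately show "y \<in> (if 0 \<le> s \<and> s \<le> c then (+) (s *\<^sub>R w) ` dilate c X else {})"
        using c by (auto simp: scaleR_add_right mult_left_le add.commute)
    next
      fix y assume y: "y \<in> (if 0 \<le> s \<and> s \<le> c then (+) (s *\<^sub>R w) ` dilate c X else {})"
      then have s: "0 \<le> s" "s \<le> c" by (auto split: if_splits)
      obtain x where x: "x \<in> X" "y = s *\<^sub>R w + c *\<^sub>R x" using y by (auto split: if_splits)
      have "(s / c) *\<^sub>R w \<in> J" using s c by (auto simp: in_segment intro!: exI[of _ "s / c"])
      then have "c *\<^sub>R (x + (s / c) *\<^sub>R w) \<in> dilate c (X + J)" using x by blast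
      then show "y \<in> slice w (dilate c (X + J)) s"
        using x c X ww by (simp add: slice_def scaleR_add_right add.commute inner_add_left)
    qed
    then show ?thesis by (simp add: plus_translation)
  qed
  have dc: "dilate c (X + J) = (\<lambda>x. (1 / c) *\<^sub>R x) -` (X + J)"
    using c by (force simp: image_iff)
  have "dilate c (X + J) \<in> sets borel"
    unfolding dc using measurable_sets[OF _ XJ(1), of "\<lambda>x. (1 / c) *\<^sub>R x" borel] by simp
  moreover have "bounded (dilate c (X + J))" using XJ by (simp add: bounded_scaling)
  ultimately have "has_bochner_integral lborel (\<lambda>s. vol (slice w (dilate c (X + J)) s + J)) (vol (dilate c (X + J)))"
    by (rule vol_slices[OF w])
  moreover have "vol (slice w (dilate c (X + J)) s + J) = vol (dilate c X + J) * indicator {0..c} s" for s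
    unfolding sl by (simp add: vol_translation indicator_def)
  ultimately have "has_bochner_integral lborel (\<lambda>s. vol (dilate c X + J) * indicator {0..c} s) (vol (dilate c (X + J)))"
    by simp
  moreover have "has_bochner_integral lborel (\<lambda>s. vol (dilate c X + J) * indicator {0..c} s) (vol (dilate c X + J) * c)"
    using has_bochner_integral_real_indicator[of "{0..c}" lborel] c
    by (intro has_bochner_integral_mult_right) simp
  ultimately have "vol (dilate c (X + J)) = vol (dilate c X + J) * c" by (rule has_bochner_integral_eq)
  moreover have "vol (dilate c (X + J)) = c ^ CARD('a) * vol (X + J)"
    using c measure_lebesgue_affine[of c 0 "X + J"] by (simp add: abs_of_pos)
  moreover have "c ^ CARD('a) = c ^ (CARD('a) - 1) * c" using dim by (simp flip: power_Suc2)
  ultimately show ?thesis using c by simp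
qed

end

section \<open>Strict growth of \<phi> in the extreme normal directions\<close>

context full_flat_body
begin

text \<open>On the cone over a small ball beyond \<open>M\<close>, radial segments of \<open>M\<close> extend inside \<open>Mx\<close> by a
  factor \<open>1 + s\<close>; this part of \<open>tM + Mx\<close> exceeds \<open>(t + 1)M\<close> by a volume of the leading order.\<close>

lemma \<phi>_strict_outside:
  assumes Mx: "flat w Mx" "M \<subseteq> Mx" and p: "p \<in> Mx" and v: "v \<in> D" "p \<bullet> v > 1"
  shows "\<phi> M < \<phi> Mx"
proof -
  have bMx: "convex_body Mx" using Mx by (simp add: flat_def)
  have Mxw: "x \<bullet> w = 0" if "x \<in> Mx" for x
    using Mx that zero_M unfolding flat_def by (metis inner_zero_left subsetD)
  \<comment> \<open>With these constants \<open>p'\<close> has height \<open>1 + 2 * s\<close> in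
    direction \<open>v\<close>; \<rho> keeps the ball about \<open>p'\<close> inside
    \<open>Mx\<close> and above height \<open>1 + s\<close>.\<close>
  define q where "q = p \<bullet> v"
  define \<tau> where "\<tau> = (q - 1) / (2 * q)"
  define s where "s = (q - 1) / 4"
  define \<rho> where "\<rho> = min (\<tau> * r) (s / norm v)"
  define p' where "p' = (1 - \<tau>) *\<^sub>R p"
  have q: "q > 1" using v by (simp add: q_def)
  have \<tau>: "0 < \<tau>" "\<tau> < 1" using q by (auto simp: \<tau>_def divide_less_eq)
  have s: "0 < s" using q by (simp add: s_def)
  have v0: "0 < norm v" using v(2) by auto
  have \<rho>: "0 < \<rho>" using \<tau> r s v0 by (simp add: \<rho>_def)
  have p'v: "p' \<bullet> v = 1 + 2 * s" using q by (simp add: p'_def q_def[symmetric] \<tau>_def s_def field_simps)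
  have p'w: "p' \<bullet> w = 0" using Mxw[OF p] by (simp add: p'_def)
  have yMx: "y \<in> Mx" if y: "y \<bullet> w = 0" "norm (y - p') < \<rho>" for y
  proof -
    have "norm (y - p') \<le> r * \<tau>" using y(2) by (simp add: \<rho>_def mult.commute)
    then have "(1 / \<tau>) *\<^sub>R (y - p') \<in> M"
      using y p'w \<tau> by (intro rM) (simp_all add: inner_diff_left divide_le_eq)
    then have "(1 - \<tau>) *\<^sub>R p + \<tau> *\<^sub>R ((1 / \<tau>) *\<^sub>R (y - p')) \<in> Mx"
      using Mx p \<tau> bMx by (intro convexD) (auto simp: convex_body_def)
    then show ?thesis using \<tau> by (simp add: p'_def)
  qed
  have yv: "y \<bullet> v \<ge> 1 + s" if "norm (y - p') < \<rho>" for y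
  proof -
    have "\<bar>(y - p') \<bullet> v\<bar> \<le> norm (y - p') * norm v" by (rule Cauchy_Schwarz_ineq2)
    also have "\<dots> \<le> (s / norm v) * norm v" using that v0 by (intro mult_right_mono) (auto simp: \<rho>_def)
    also have "\<dots> = s" using v0 by simp
    finally show ?thesis using p'v by (simp add: inner_diff_left)
  qed
  \<comment> \<open>The open cone over the ball about \<open>p'\<close>, extended along
    \<open>w\<close> so that adding points of \<open>J\<close> does not affect membership.\<close>
  define Cn where "Cn = {x. \<exists>\<mu>>0. norm (x - (x \<bullet> w) *\<^sub>R w - \<mu> *\<^sub>R p') < \<mu> * \<rho>}"
  have Cn_flat: "x \<in> Cn \<longleftrightarrow> (\<exists>\<mu>>0. norm (x - \<mu> *\<^sub>R p') < \<mu> * \<rho>)" if "x \<bullet> w = 0" for x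
    using that by (simp add: Cn_def)
  have Cn_J: "x + j \<in> Cn \<longleftrightarrow> x \<in> Cn" if "x \<bullet> w = 0" "j \<in> J" for x j
    using that by (auto simp: Cn_def in_segment inner_add_left ww)
  have Cn_scale: "c *\<^sub>R x \<in> Cn" if x: "x \<in> Cn" "x \<bullet> w = 0" and c: "0 < c" for x c
  proof -
    obtain \<mu> where l: "\<mu> > 0" "norm (x - \<mu> *\<^sub>R p') < \<mu> * \<rho>" using x Cn_flat by blast
    have "norm (c *\<^sub>R x - (c * \<mu>) *\<^sub>R p') = c * norm (x - \<mu> *\<^sub>R p')"
      using c by (metis abs_of_pos norm_scaleR scaleR_diff_right scaleR_scaleR)
    also have "\<dots> < (c * \<mu>) * \<rho>" using l c by simp
    finally show ?thesis using l c x by (subst Cn_flat) (auto intro!: exI[of _ "c * \<mu>"])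
  qed
  have open_Cn: "open Cn"
  proof -
    have "Cn = (\<Union>\<mu>\<in>{0<..}. {x. norm (x - (x \<bullet> w) *\<^sub>R w - \<mu> *\<^sub>R p') < \<mu> * \<rho>})"
      by (auto simp: Cn_def)
    also have "open \<dots>" by (intro open_UN ballI open_Collect_less continuous_intros)
    finally show ?thesis .
  qed
  have ext: "(1 + s) *\<^sub>R x \<in> Mx" if x: "x \<in> M" "x \<in> Cn" for x
  proof -
    obtain \<mu> where l: "\<mu> > 0" "norm (x - \<mu> *\<^sub>R p') < \<mu> * \<rho>" using x Cn_flat[OF Mw] by blast
    define y where "y = (1 / \<mu>) *\<^sub>R x"
    have "norm (y - p') = (1 / \<mu>) * norm (x - \<mu> *\<^sub>R p')"
    proof -
      have "y - p' = (1 / \<mu>) *\<^sub>R (x - \<mu> *\<^sub>R p')" using l by (simp add: y_def scaleR_diff_right)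
      then show ?thesis using l by simp
    qed
    then have ny: "norm (y - p') < \<rho>" using l by (simp add: divide_less_eq mult.commute)
    have yw: "y \<bullet> w = 0" using Mw[OF x(1)] by (simp add: y_def)
    have "x \<bullet> v \<le> 1" using x v by (auto simp: D_def)
    moreover have "x \<bullet> v = \<mu> * (y \<bullet> v)" using l by (simp add: y_def)
    ultimately have le: "\<mu> * (1 + s) \<le> 1" using yv[OF ny] l mult_left_mono[of "1 + s" "y \<bullet> v" \<mu>] by linarith
    have "(\<mu> * (1 + s)) *\<^sub>R y + (1 - \<mu> * (1 + s)) *\<^sub>R 0 \<in> Mx"
      using bMx yMx[OF yw ny] Mx(2) zero_M le l s by (intro convexD) (auto simp: convex_body_def)
    moreover have "(\<mu> * (1 + s)) *\<^sub>R y = (1 + s) *\<^sub>R x" using l by (simp add: y_def)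
    ultimately show ?thesis by simp
  qed
  define D0 where "D0 = M \<inter> Cn"
  define D1 where "D1 = M - Cn"
  have D01w: "x \<bullet> w = 0" if "x \<in> D0 \<or> x \<in> D1" for x using that Mw by (auto simp: D0_def D1_def)
  have MJ: "M + J \<in> sets borel" "bounded (M + J)"
    using convex_body_plus[OF M convex_body_seg, of w] by (auto simp: convex_body_borel convex_body_def compact_imp_bounded)
  have D0J: "D0 + J = (M + J) \<inter> Cn"
    by (auto simp: D0_def Cn_J Mw elim!: set_plus_elim)
  have D1J: "D1 + J = (M + J) - Cn"
    by (auto simp: D1_def Cn_J Mw elim!: set_plus_elim)
  have m0: "D0 + J \<in> sets borel" and m1: "D1 + J \<in> sets borel"
    unfolding D0J D1J using MJ open_Cn by auto
  have b0: "bounded (D0 + J)" and b1: "bounded (D1 + J)"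
    unfolding D0J D1J using MJ by (auto intro: bounded_subset)
  have lmeas: "X \<in> lmeasurable" if "X \<in> sets borel" "bounded X" for X :: "(real^'a) set"
    using that by (intro bounded_set_imp_lmeasurable) auto
  define V where "V = vol (D0 + J)"
  have Vpos: "V > 0"
  proof -
    \<comment> \<open>Scaled by \<open>l\<close>, the ball about \<open>p'\<close> lies within
      distance \<open>r\<close> of the origin, hence in \<open>M\<close>; shifted to half the height
      of \<open>J\<close> it leaves room for a solid ball.\<close>
    define l where "l = r / (norm p' + \<rho>)"
    have l: "0 < l" using r \<rho> by (simp add: l_def add_nonneg_pos)
    define \<eta> where "\<eta> = min (1 / 2) (l * \<rho>)"
    have \<eta>: "0 < \<eta>" using l \<rho> by (simp add: \<eta>_def)
    have "ball (l *\<^sub>R p' + (1 / 2) *\<^sub>R w) \<eta> \<subseteq> D0 + J"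
    proof
      fix x assume x: "x \<in> ball (l *\<^sub>R p' + (1 / 2) *\<^sub>R w) \<eta>"
      define h where "h = x - (l *\<^sub>R p' + (1 / 2) *\<^sub>R w)"
      have nh: "norm h < \<eta>" using x by (simp add: h_def dist_norm norm_minus_commute)
      have xe: "x = l *\<^sub>R p' + (1 / 2) *\<^sub>R w + h" by (simp add: h_def)
      have hw: "\<bar>h \<bullet> w\<bar> < 1 / 2" using Cauchy_Schwarz_ineq2[of h w] nh w by (simp add: \<eta>_def)
      define h' where "h' = h - (h \<bullet> w) *\<^sub>R w"
      have h'w: "h' \<bullet> w = 0" by (simp add: h'_def proj_w)
      have "(norm h')\<^sup>2 \<le> (norm h)\<^sup>2"
      proof -
        have "h = h' + (h \<bullet> w) *\<^sub>R w" by (simp add: h'_def)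
        then have "(norm h)\<^sup>2 = (norm h')\<^sup>2 + (norm ((h \<bullet> w) *\<^sub>R w))\<^sup>2"
          using h'w by (metis inner_scaleR_right mult_zero_right norm_add_Pythagorean orthogonal_def)
        then show ?thesis by simp
      qed
      then have nh': "norm h' < l * \<rho>" using nh power2_le_imp_le[of "norm h'" "norm h"] by (simp add: \<eta>_def)
      define x' where "x' = l *\<^sub>R p' + h'"
      have x'w: "x' \<bullet> w = 0" using p'w h'w by (simp add: x'_def inner_add_left)
      have "norm x' \<le> l * norm p' + l * \<rho>"
        using norm_triangle_ineq[of "l *\<^sub>R p'" h'] nh' l by (simp add: x'_def)
      also have "\<dots> = l * (norm p' + \<rho>)" by (simp add: distrib_left)
      also have "\<dots> = r" using add_nonneg_pos[OF norm_ge_zero[of p'] \<rho>] by (simp add: l_def)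
      finally have "x' \<in> M" using x'w by (intro rM)
      moreover have "x' \<in> Cn" using x'w nh' l by (subst Cn_flat) (auto simp: x'_def intro!: exI[of _ l])
      ultimately have "x' \<in> D0" by (simp add: D0_def)
      moreover have "(1 / 2 + h \<bullet> w) *\<^sub>R w \<in> J"
        using hw by (auto simp: in_segment intro!: exI[of _ "1 / 2 + h \<bullet> w"])
      ultimately have "x' + (1 / 2 + h \<bullet> w) *\<^sub>R w \<in> D0 + J" by (rule set_plus_intro)
      moreover have "x' + (1 / 2 + h \<bullet> w) *\<^sub>R w = x" by (simp add: x'_def h'_def xe scaleR_add_left)
      ultimately show "x \<in> D0 + J" by simp
    qed
    then have "vol (ball (l *\<^sub>R p' + (1 / 2) *\<^sub>R w) \<eta>) \<le> V"
      unfolding V_def using lmeas[OF m0 b0] by (intro measure_mono_fmeasurable) auto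
    moreover have "0 < vol (ball (l *\<^sub>R p' + (1 / 2) *\<^sub>R w) \<eta>)"
      using content_ball_pos[OF \<eta>] by simp
    ultimately show ?thesis by linarith
  qed
  let ?N = "CARD('a)"
  have lower: "vol (Mx + J + dilate t M) - vol (M + J + dilate t M) \<ge> s * V * t ^ (?N - 2)" if t: "0 \<le> t" for t
  proof -
    let ?a = "t + 1"
    \<comment> \<open>In the cone, \<open>t + 1 + s\<close> times \<open>x\<close> is the sum of
      \<open>1 + s\<close> times \<open>x\<close>, a point of \<open>Mx\<close>, and
      \<open>t\<close> times \<open>x\<close>. Outside the cone only the factor \<open>t + 1\<close>
      is available.\<close>
    have sub0: "dilate (?a + s) D0 + J \<subseteq> Mx + J + dilate t M"
    proof
      fix y assume "y \<in> dilate (?a + s) D0 + J"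
      then obtain x j where x: "x \<in> M" "x \<in> Cn" "j \<in> J" "y = (?a + s) *\<^sub>R x + j"
        by (auto simp: D0_def elim!: set_plus_elim)
      have "(1 + s) *\<^sub>R x + j + t *\<^sub>R x \<in> Mx + J + dilate t M"
        using ext x by (intro set_plus_intro) auto
      moreover have "(1 + s) *\<^sub>R x + j + t *\<^sub>R x = y" by (simp add: x algebra_simps)
      ultimately show "y \<in> Mx + J + dilate t M" by simp
    qed
    have sub1: "dilate ?a D1 + J \<subseteq> Mx + J + dilate t M"
    proof
      fix y assume "y \<in> dilate ?a D1 + J"
      then obtain x j where x: "x \<in> M" "j \<in> J" "y = ?a *\<^sub>R x + j"
        by (auto simp: D1_def elim!: set_plus_elim)
      have "x + j + t *\<^sub>R x \<in> Mx + J + dilate t M"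
        using x Mx by (intro set_plus_intro) auto
      moreover have "x + j + t *\<^sub>R x = y" by (simp add: x algebra_simps)
      ultimately show "y \<in> Mx + J + dilate t M" by simp
    qed
    have disj: "(dilate (?a + s) D0 + J) \<inter> (dilate ?a D1 + J) = {}"
    proof (rule ccontr)
      assume "\<not> ?thesis"
      then obtain x j x' j' where x: "x \<in> D0" "x' \<in> D1" "j \<in> J" "j' \<in> J" "(?a + s) *\<^sub>R x + j = ?a *\<^sub>R x' + j'"
        by (auto elim!: set_plus_elim)
      have w0: "x \<bullet> w = 0" "x' \<bullet> w = 0" using x D01w by auto
      have "(?a + s) *\<^sub>R x \<in> Cn" using x w0 t s by (intro Cn_scale) (auto simp: D0_def)
      then have "(?a + s) *\<^sub>R x + j \<in> Cn" using Cn_J[of "(?a + s) *\<^sub>R x" j] w0 x by simp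
      then have "?a *\<^sub>R x' \<in> Cn" using Cn_J[of "?a *\<^sub>R x'" j'] w0 x by simp
      then have "(1 / ?a) *\<^sub>R (?a *\<^sub>R x') \<in> Cn" by (rule Cn_scale) (use w0 t in auto)
      then show False using x t by (simp add: D1_def)
    qed
    have v0: "vol (dilate (?a + s) D0 + J) = (?a + s) ^ (?N - 1) * V"
      unfolding V_def using D01w t s by (intro vol_dilate_horizontal m0 b0) auto
    have v1: "vol (dilate ?a D1 + J) = ?a ^ (?N - 1) * vol (D1 + J)"
      using D01w t by (intro vol_dilate_horizontal m1 b1) auto
    have bdl: "dilate c X + J \<in> lmeasurable" if X: "\<And>x. x \<in> X \<Longrightarrow> x \<bullet> w = 0" "X + J \<in> sets borel" "bounded (X + J)" and c: "0 < c" for X c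
    proof (rule lmeas)
      have "dilate c X + J = {y. 0 \<le> y \<bullet> w \<and> y \<bullet> w \<le> 1 \<and> (1 / c) *\<^sub>R (y - (y \<bullet> w) *\<^sub>R w) \<in> X + J}"
      proof (intro equalityI subsetI)
        fix y assume "y \<in> dilate c X + J"
        then obtain x j where "x \<in> X" "0 \<le> j" "j \<le> 1" "y = c *\<^sub>R x + j *\<^sub>R w"
          by (auto simp: in_segment elim!: set_plus_elim)
        moreover have "x + 0 \<in> X + J" using \<open>x \<in> X\<close> by (intro set_plus_intro) auto
        ultimately show "y \<in> {y. 0 \<le> y \<bullet> w \<and> y \<bullet> w \<le> 1 \<and> (1 / c) *\<^sub>R (y - (y \<bullet> w) *\<^sub>R w) \<in> X + J}"
          using X(1) c by (simp add: inner_add_left ww)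
      next
        fix y assume y: "y \<in> {y. 0 \<le> y \<bullet> w \<and> y \<bullet> w \<le> 1 \<and> (1 / c) *\<^sub>R (y - (y \<bullet> w) *\<^sub>R w) \<in> X + J}"
        then have "(1 / c) *\<^sub>R (y - (y \<bullet> w) *\<^sub>R w) \<in> X + J" by simp
        then obtain x q where q: "(1 / c) *\<^sub>R (y - (y \<bullet> w) *\<^sub>R w) = x + q" "x \<in> X" "q \<in> J"
          by (rule set_plus_elim)
        obtain j where "q = j *\<^sub>R w" using q(3) by (auto simp: in_segment)
        then have x: "x \<in> X" "(1 / c) *\<^sub>R (y - (y \<bullet> w) *\<^sub>R w) = x + j *\<^sub>R w" using q by auto
        have "((1 / c) *\<^sub>R (y - (y \<bullet> w) *\<^sub>R w)) \<bullet> w = j" unfolding x(2) using X(1)[OF x(1)] by (simp add: inner_add_left ww)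
        then have "j = 0" by (simp add: proj_w)
        then have "c *\<^sub>R ((1 / c) *\<^sub>R (y - (y \<bullet> w) *\<^sub>R w)) = c *\<^sub>R x" using x(2) by simp
        then have "y - (y \<bullet> w) *\<^sub>R w = c *\<^sub>R x" using c by simp
        then have "y = c *\<^sub>R x + (y \<bullet> w) *\<^sub>R w" by (simp add: algebra_simps)
        moreover have "(y \<bullet> w) *\<^sub>R w \<in> J" using y by (auto simp: in_segment)
        ultimately show "y \<in> dilate c X + J" using x(1) by (metis imageI set_plus_intro)
      qed
      also have "\<dots> \<in> sets borel" using X(2) by measurable
      finally show "dilate c X + J \<in> sets borel" .
      have "bounded X" using X(3) by (rule bounded_subset) (use set_plus_intro[of _ X 0 J] in auto)
      then show "bounded (dilate c X + J)"
        by (intro bounded_set_plus bounded_scaling) (auto simp: compact_imp_bounded)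
    qed
    have l0: "dilate (?a + s) D0 + J \<in> lmeasurable" using D01w m0 b0 t s by (intro bdl) auto
    have l1: "dilate ?a D1 + J \<in> lmeasurable" using D01w m1 b1 t by (intro bdl) auto
    have lM: "Mx + J + dilate t M \<in> lmeasurable"
      using bMx M by (intro convex_body_lmeasurable convex_body_plus convex_body_dilate) auto
    have "vol (dilate (?a + s) D0 + J) + vol (dilate ?a D1 + J) = vol ((dilate (?a + s) D0 + J) \<union> (dilate ?a D1 + J))"
      using measure_Un2[OF l0 l1] disj by (simp add: Diff_triv Int_commute)
    also have "\<dots> \<le> vol (Mx + J + dilate t M)"
      using sub0 sub1 l0 l1 lM by (intro measure_mono_fmeasurable) (auto intro: fmeasurableD)
    finally have 1: "(?a + s) ^ (?N - 1) * V + ?a ^ (?N - 1) * vol (D1 + J) \<le> vol (Mx + J + dilate t M)"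
      by (simp add: v0 v1)
    have "M + J + dilate t M = dilate ?a M + J"
    proof -
      have "M + dilate t M = dilate ?a M"
      proof (intro equalityI subsetI)
        fix y assume "y \<in> M + dilate t M"
        then obtain a b where ab: "a \<in> M" "b \<in> M" "y = a + t *\<^sub>R b" by (auto elim!: set_plus_elim)
        have "(1 / ?a) *\<^sub>R a + (t / ?a) *\<^sub>R b \<in> M"
          using M ab t by (intro convexD) (auto simp: convex_body_def field_simps)
        moreover have "y = ?a *\<^sub>R ((1 / ?a) *\<^sub>R a + (t / ?a) *\<^sub>R b)" using t ab by (simp add: scaleR_add_right)
        ultimately show "y \<in> dilate ?a M" by blast
      next
        fix y assume "y \<in> dilate ?a M"
        then obtain a where "a \<in> M" "y = a + t *\<^sub>R a" by (auto simp: algebra_simps)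
        then show "y \<in> M + dilate t M" by blast
      qed
      moreover have "M + J + dilate t M = (M + dilate t M) + J" by (simp only: ac_simps)
      ultimately show ?thesis by simp
    qed
    then have "vol (M + J + dilate t M) = ?a ^ (?N - 1) * vol (M + J)"
      using Mw MJ t by (simp add: vol_dilate_horizontal)
    moreover have "vol (M + J) = V + vol (D1 + J)"
    proof -
      have "M + J = (D0 + J) \<union> (D1 + J)" unfolding D0J D1J by auto
      moreover have "(D0 + J) \<inter> (D1 + J) = {}" unfolding D0J D1J by auto
      ultimately show ?thesis
        unfolding V_def using lmeas[OF m0 b0] lmeas[OF m1 b1]
measure_Un2[OF lmeas[OF m0 b0] lmeas[OF m1 b1]]
        by (simp add: Diff_triv Int_commute)
    qed
    ultimately have "vol (Mx + J + dilate t M) - vol (M + J + dilate t M) \<ge> ((?a + s) ^ (?N - 1) - ?a ^ (?N - 1)) * V"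
      using 1 by (simp add: algebra_simps)
    moreover have "((?a + s) ^ (?N - 1) - ?a ^ (?N - 1)) * V \<ge> s * t ^ (?N - 2) * V"
    proof (rule mult_right_mono)
      have "s * t ^ (?N - 2) \<le> s * ?a ^ (?N - 2)" using s t by (intro mult_left_mono power_mono) auto
      also have "\<dots> \<le> (?a + s) ^ Suc (?N - 2) - ?a ^ Suc (?N - 2)" using s t by (intro power_growth) auto
      also have "Suc (?N - 2) = ?N - 1" using dim by simp
      finally show "s * t ^ (?N - 2) \<le> (?a + s) ^ (?N - 1) - ?a ^ (?N - 1)" .
    qed (use Vpos in simp)
    ultimately show ?thesis by (simp add: mult_ac)
  qed
  have "s * V \<le> real (?N choose 2) * (\<phi> Mx - \<phi> M)"
  proof (rule tendsto_lowerbound[OF \<phi>_limit[OF flat_M Mx(1)]])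
    show "\<forall>\<^sub>F t in at_top. s * V \<le> (vol (Mx + J + dilate t M) - vol (M + J + dilate t M)) / t ^ (?N - 2)"
      using eventually_gt_at_top[of 0]
    proof eventually_elim
      case (elim t)
      then show ?case using lower[of t] by (simp add: le_divide_eq)
    qed
  qed simp
  then have "0 < real (?N choose 2) * (\<phi> Mx - \<phi> M)" using s Vpos by (simp add: less_le_trans[rotated])
  then show ?thesis using binom_pos by (simp add: zero_less_mult_iff)
qed

text \<open>Extremality of \<open>v0\<close> allows \<open>M\<close> to be enlarged to a body
  \<open>Mx\<close> that, among the directions in which \<open>M\<close> has support one, differs
  from \<open>M\<close> only near \<open>v0\<close>. There \<open>B\<close> exceeds \<open>A\<close>
  by a margin, so \<open>A + dilate c Mx \<subseteq> B + dilate c M\<close> for small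
  \<open>c\<close>, whereas \<phi> is strictly larger at \<open>Mx\<close> than at
  \<open>M\<close>.\<close>

lemma \<phi>_less_if_supp_less:
  assumes A: "flat w A" and B: "flat w B" and AB: "A \<subseteq> B"
    and v0: "v0 \<in> E" and less: "supp A v0 < supp B v0"
  shows "\<phi> A < \<phi> B"
proof -
  have bA: "convex_body A" and bB: "convex_body B" using A B by (auto simp: flat_def)
  obtain c0 where c0: "\<And>x. x \<in> B \<Longrightarrow> x \<bullet> w = c0" using B by (auto simp: flat_def)
  obtain R where R: "0 < R" "\<And>x. x \<in> B \<Longrightarrow> norm x \<le> R"
    using bB by (metis bounded_pos compact_imp_bounded convex_body_def)
  have v0D: "v0 \<in> D" using v0 by (rule E_D)
  have "v0 \<noteq> 0"
  proof
    assume "v0 = 0"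
    moreover obtain a where "a \<bullet> v0 = supp A v0" using supp_attained[OF bA] by metis
    moreover obtain b where "b \<bullet> v0 = supp B v0" using supp_attained[OF bB] by metis
    ultimately show False using less by simp
  qed
  define \<delta> where "\<delta> = (supp B v0 - supp A v0) / 2"
  have \<delta>: "0 < \<delta>" using less by (simp add: \<delta>_def)
  \<comment> \<open>The first bound keeps the origin out of the ball about \<open>v0\<close>; the
    second makes the change of both support functions within it at most
    \<open>\<delta> / 2\<close>.\<close>
  define \<rho> where "\<rho> = min (norm v0) (\<delta> / (2 * R))"
  have \<rho>: "0 < \<rho>" using \<delta> R \<open>v0 \<noteq> 0\<close> by (simp add: \<rho>_def)
  have near: "supp A v + \<delta> \<le> supp B v" if "norm (v - v0) < \<rho>" for v
  proof -
    have AR: "norm x \<le> R" if "x \<in> A" for x using that AB R by blast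
    have "R * norm (v - v0) \<le> R * (\<delta> / (2 * R))" using that R by (intro mult_left_mono) (auto simp: \<rho>_def)
    then have "R * norm (v - v0) \<le> \<delta> / 2" using R by simp
    moreover have "supp A v \<le> supp A v0 + R * norm (v - v0)" by (rule supp_lipschitz[OF bA AR])
    moreover have "supp B v0 \<le> supp B v + R * norm (v - v0)"
      using supp_lipschitz[OF bB R(2), of v0 v] by (simp add: norm_minus_commute)
    moreover have "supp B v0 = supp A v0 + 2 * \<delta>" by (simp add: \<delta>_def field_simps)
    ultimately show ?thesis by linarith
  qed
  \<comment> \<open>The rest of the polar body. Being extreme, \<open>v0\<close> is not in its
    convex hull; the normalised separating functional is a point \<open>p\<close> that is at most
    one on \<open>T\<close> and greater than one at \<open>v0\<close>.\<close>
  define T where "T = D - ball v0 \<rho>"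
  have "compact T" unfolding T_def using compact_D by (simp add: compact_diff)
  have T0: "0 \<in> T" using zero_D \<rho> by (simp add: T_def \<rho>_def)
  have "v0 \<notin> convex hull T"
  proof
    assume a: "v0 \<in> convex hull T"
    have "convex hull T \<subseteq> D" by (rule hull_minimal) (auto simp: T_def convex_D)
    then have "v0 extreme_point_of (convex hull T)"
      using v0 a unfolding E_def extreme_point_of_def by blast
    then have "v0 \<in> T" by (rule extreme_point_of_convex_hull)
    then show False using \<rho> by (simp add: T_def)
  qed
  moreover have "closed (convex hull T)" using \<open>compact T\<close> by (simp add: compact_convex_hull compact_imp_closed)
  ultimately obtain u b where u: "u \<bullet> v0 < b" "\<And>v. v \<in> convex hull T \<Longrightarrow> u \<bullet> v > b"
    using separating_hyperplane_closed_point[of "convex hull T" v0] by auto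
  have b: "b < 0" using u(2)[of 0] T0 by (simp add: hull_inc)
  define p where "p = (1 / b) *\<^sub>R (u - (u \<bullet> w) *\<^sub>R w)"
  have pw: "p \<bullet> w = 0" by (simp add: p_def proj_w)
  have pv: "p \<bullet> v = (u \<bullet> v) / b" if "v \<in> D" for v
    using inner_proj[of v u] that by (simp add: p_def inner_commute D_def)
  have pT: "p \<bullet> v \<le> 1" if "v \<in> T" for v
    using u(2)[OF hull_inc[OF that]] pv[of v] that b by (simp add: T_def divide_le_eq)
  have pv0: "p \<bullet> v0 > 1" using pv[OF v0D] u(1) b by (simp add: less_divide_eq)
  define Mx where "Mx = convex hull (insert p M)"
  have MMx: "M \<subseteq> Mx" "p \<in> Mx" by (auto simp: Mx_def hull_inc)
  have bMx: "convex_body Mx"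
    using M by (simp add: Mx_def convex_body_def compact_convex_hull compact_insert)
  have Mxle: "supp Mx v \<le> m" if "supp M v \<le> m" "p \<bullet> v \<le> m" for v m
  proof -
    have "Mx \<subseteq> {x. v \<bullet> x \<le> m}"
      unfolding Mx_def using that M by (intro hull_minimal convex_halfspace_le) (auto simp: supp_le_iff inner_commute)
    then show ?thesis using bMx by (auto simp: supp_le_iff inner_commute)
  qed
  have Mxw: "x \<bullet> w = 0" if "x \<in> Mx" for x
  proof -
    have "Mx \<subseteq> {x. w \<bullet> x = 0}"
      unfolding Mx_def using pw Mw by (intro hull_minimal convex_hyperplane) (auto simp: inner_commute)
    then show ?thesis using that by (auto simp: inner_commute)
  qed
  then have fMx: "flat w Mx" using bMx by (auto simp: flat_def)
  obtain Q where Q: "0 < Q" "\<And>x. x \<in> Mx \<Longrightarrow> norm x \<le> Q"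
    using bMx by (metis bounded_pos compact_imp_bounded convex_body_def)
  \<comment> \<open>Small enough that \<open>c\<close> times the support of \<open>Mx\<close> is at
    most the margin \<delta> in all directions closer than \<rho> to \<open>v0\<close>.\<close>
  define c where "c = \<delta> / (Q * (norm v0 + \<rho>))"
  have den: "0 < Q * (norm v0 + \<rho>)" using Q \<rho> by (simp add: add_nonneg_pos)
  have c: "0 < c" using \<delta> den by (simp add: c_def)
  have key: "supp A v + c * supp Mx v \<le> supp B v + c * supp M v" if v: "v \<bullet> w = 0" "supp M v = 1" for v
  proof -
    have vD: "v \<in> D" using v supp_ge[OF M, of _ v] by (auto simp: D_def)
    show ?thesis
    proof (cases "norm (v - v0) < \<rho>")
      case True
      have "norm v \<le> norm v0 + \<rho>" using True norm_triangle_ineq2[of v v0] by linarith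
      have "supp Mx v \<le> Q * (norm v0 + \<rho>)"
        unfolding supp_le_iff[OF bMx]
      proof
        fix x assume "x \<in> Mx"
        then have "norm x * norm v \<le> Q * (norm v0 + \<rho>)"
          using Q \<open>norm v \<le> norm v0 + \<rho>\<close> by (intro mult_mono) auto
        then show "x \<bullet> v \<le> Q * (norm v0 + \<rho>)" using norm_cauchy_schwarz[of x v] by linarith
      qed
      then have "c * supp Mx v \<le> c * (Q * (norm v0 + \<rho>))" using c by (intro mult_left_mono) auto
      also have "\<dots> = \<delta>" using den c_def by (metis less_irrefl nonzero_eq_divide_eq)
      finally show ?thesis using near[OF True] c v by simp
    next
      case False
      then have "v \<in> T" using vD by (simp add: T_def dist_norm norm_minus_commute)
      then have "supp Mx v \<le> supp M v" using pT v by (intro Mxle) auto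
      then have "c * supp Mx v \<le> c * supp M v" using c by simp
      then show ?thesis using supp_mono[OF bA bB AB, of v] by linarith
    qed
  qed
  have sub: "A + dilate c Mx \<subseteq> B + dilate c M"
  proof (rule subset_if_supp_le)
    show "convex_body (A + dilate c Mx)" "convex_body (B + dilate c M)"
      using bA bB bMx M by (auto intro: convex_body_plus convex_body_dilate)
    fix u
    \<comment> \<open>Both sides lie at the same height, so the component of \<open>u\<close> along
      \<open>w\<close> cancels; homogeneity then reduces the claim to directions with
      \<open>supp M v = 1\<close>.\<close>
    define v where "v = u - (u \<bullet> w) *\<^sub>R w"
    have vw: "v \<bullet> w = 0" by (simp add: v_def proj_w)
    have u: "u = v + (u \<bullet> w) *\<^sub>R w" by (simp add: v_def)
    have "supp A v + c * supp Mx v \<le> supp B v + c * supp M v"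
    proof (cases "v = 0")
      case True
      have "supp X 0 = 0" if "convex_body X" for X :: "(real^'a) set"
        using supp_attained[OF that, of 0] by (metis inner_zero_right)
      then show ?thesis using True bA bB bMx M by simp
    next
      case False
      have "(r / norm v) *\<^sub>R v \<in> M" using False r vw by (intro rM) auto
      then have "((r / norm v) *\<^sub>R v) \<bullet> v \<le> supp M v" by (rule supp_ge[OF M])
      moreover have "0 < ((r / norm v) *\<^sub>R v) \<bullet> v" using False r by simp
      ultimately have m: "0 < supp M v" by linarith
      define v1 where "v1 = (1 / supp M v) *\<^sub>R v"
      have "supp M v1 = 1" "v1 \<bullet> w = 0" using m vw by (simp_all add: v1_def supp_scale[OF M])
      then have "supp A v1 + c * supp Mx v1 \<le> supp B v1 + c * supp M v1" by (intro key)
      then have "supp M v * (supp A v1 + c * supp Mx v1) \<le> supp M v * (supp B v1 + c * supp M v1)"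
        using m by (intro mult_left_mono) auto
      moreover have "supp M v * supp X v1 = supp X v" if "convex_body X" for X
        using m by (simp add: v1_def supp_scale[OF that])
      ultimately show ?thesis using bA bB bMx M by (simp add: distrib_left mult.left_commute)
    qed
    moreover have "supp X u = supp X v + (u \<bullet> w) * k" if "convex_body X" "\<And>x. x \<in> X \<Longrightarrow> x \<bullet> w = k" for X k
      using supp_flat[OF that, of v "u \<bullet> w"] u by simp
    from this[of A c0] this[of B c0] this[of Mx 0] this[of M 0]
    have "supp A u = supp A v + (u \<bullet> w) * c0" "supp B u = supp B v + (u \<bullet> w) * c0"
      "supp Mx u = supp Mx v" "supp M u = supp M v"
      using bA bB bMx M c0 AB Mxw Mw by auto
    ultimately show "supp (A + dilate c Mx) u \<le> supp (B + dilate c M) u"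
      using bA bB bMx M c by (simp add: supp_plus supp_dilate convex_body_dilate)
  qed
  have "\<phi> A + c * \<phi> Mx \<le> \<phi> B + c * \<phi> M"
    using \<phi>_mono[OF flat_plus[OF A flat_dilate[OF fMx]] flat_plus[OF B flat_dilate[OF flat_M]] sub] c
    by (simp add: \<phi>_plus[OF A flat_dilate[OF fMx]] \<phi>_plus[OF B flat_dilate[OF flat_M]] \<phi>_dilate[OF fMx] \<phi>_dilate[OF flat_M])
  moreover have "c * \<phi> M < c * \<phi> Mx"
    using \<phi>_strict_outside[OF fMx MMx(1,2) v0D pv0] c by simp
  ultimately show ?thesis by simp
qed

end

subsection \<open>Concave functions of one variable\<close>

lemma AE_lborel_dense:
  assumes "AE s in lborel. P s" "(x::real) < y"
  obtains s where "x < s" "s < y" "P s"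
proof -
  have "\<exists>s. x < s \<and> s < y \<and> P s"
  proof (rule ccontr)
    assume "\<not> ?thesis"
    then have "AE s in lborel. s \<notin> {x<..<y}"
      using assms(1) by (auto elim: eventually_mono)
    then have "{x<..<y} \<in> null_sets lborel" by (simp add: AE_iff_null_sets)
    then have "emeasure lborel {x<..<y} = 0" by (rule null_setsD1)
    then show False using assms(2) by simp
  qed
  then show thesis using that by blast
qed

text \<open>Closed superlevel sets give upper semicontinuity. Concavity on the segments towards
  \<open>a\<close> and \<open>b\<close> gives lower semicontinuity, also at the end points.\<close>

lemma concave_closed_levels_continuous:
  fixes f :: "real \<Rightarrow> real"
  assumes conc: "\<And>x y t. x \<in> {a..b} \<Longrightarrow> y \<in> {a..b} \<Longrightarrow> 0 \<le> t \<Longrightarrow> t \<le> 1 \<Longrightarrow>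
      (1 - t) * f x + t * f y \<le> f ((1 - t) * x + t * y)"
    and lev: "\<And>c. closed {s \<in> {a..b}. c \<le> f s}"
  shows "continuous_on {a..b} f"
  unfolding continuous_on_iff
proof (intro ballI allI impI)
  fix s0 e :: real assume s0: "s0 \<in> {a..b}" and e: "0 < e"
  have "s0 \<in> - {s \<in> {a..b}. f s0 + e \<le> f s}" using e by simp
  moreover have "open (- {s \<in> {a..b}. f s0 + e \<le> f s})" using lev by (rule open_Compl)
  ultimately obtain d1 where d1: "0 < d1" "\<And>s. dist s s0 < d1 \<Longrightarrow> s \<in> - {s \<in> {a..b}. f s0 + e \<le> f s}"
    unfolding open_dist by blast
  have lower: "\<exists>d>0. \<forall>s. s \<in> closed_segment s0 z \<longrightarrow> dist s s0 < d \<longrightarrow> f s0 - e < f s" if z: "z \<in> {a..b}" for z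
  proof (cases "z = s0")
    case True
    then show ?thesis using e by (intro exI[of _ 1]) auto
  next
    case False
    define H where "H = \<bar>f z - f s0\<bar> + 1"
    have H: "0 < H" by (simp add: H_def)
    define d where "d = \<bar>z - s0\<bar> * e / H"
    have "f s0 - e < f s" if s: "s \<in> closed_segment s0 z" "dist s s0 < d" for s
    proof -
      obtain t where t: "0 \<le> t" "t \<le> 1" "s = (1 - t) * s0 + t * z" using s by (auto simp: in_segment)
      have "dist s s0 = t * \<bar>z - s0\<bar>"
      proof -
        have "s - s0 = t * (z - s0)" by (simp add: t(3) algebra_simps)
        then show ?thesis using t by (simp add: dist_real_def abs_mult)
      qed
      then have "t * \<bar>z - s0\<bar> < (e / H) * \<bar>z - s0\<bar>" using s(2) by (simp add: d_def mult.commute)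
      then have "t < e / H" by (rule mult_right_less_imp_less) simp
      then have "t * H < e" using H by (simp add: less_divide_eq)
      moreover have "t * (f z - f s0) \<ge> - (t * H)"
      proof -
        have "t * - H \<le> t * (f z - f s0)" using t by (intro mult_left_mono) (auto simp: H_def)
        then show ?thesis by simp
      qed
      moreover have "f s0 + t * (f z - f s0) \<le> f s"
        using conc[OF s0 z t(1,2)] by (simp add: t(3) algebra_simps)
      ultimately show ?thesis by linarith
    qed
    moreover have "0 < d" using False e H by (simp add: d_def)
    ultimately show ?thesis by blast
  qed
  obtain d2 where d2: "d2 > 0" "\<And>s. s \<in> closed_segment s0 a \<Longrightarrow> dist s s0 < d2 \<Longrightarrow> f s0 - e < f s"
    using lower[of a] s0 by auto
  obtain d3 where d3: "d3 > 0" "\<And>s. s \<in> closed_segment s0 b \<Longrightarrow> dist s s0 < d3 \<Longrightarrow> f s0 - e < f s"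
    using lower[of b] s0 by auto
  show "\<exists>d>0. \<forall>s\<in>{a..b}. dist s s0 < d \<longrightarrow> dist (f s) (f s0) < e"
  proof (intro exI[of _ "min d1 (min d2 d3)"] conjI ballI impI)
    fix s assume s: "s \<in> {a..b}" "dist s s0 < min d1 (min d2 d3)"
    have "f s < f s0 + e" using d1(2)[of s] s by auto
    moreover have "f s0 - e < f s"
    proof (cases "s \<le> s0")
      case True
      then have "s \<in> closed_segment s0 a" using s by (auto simp: closed_segment_eq_real_ivl)
      then show ?thesis using d2(2) s by simp
    next
      case False
      then have "s \<in> closed_segment s0 b" using s by (auto simp: closed_segment_eq_real_ivl)
      then show ?thesis using d3(2) s by simp
    qed
    ultimately show "dist (f s) (f s0) < e" by (simp add: dist_real_def abs_less_iff)
  qed (use d1 d2 d3 in auto)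
qed

text \<open>The hypothesis says that the increments of \<open>f\<close> over a step are at most those of \<open>g\<close> over
  the preceding step, and conversely.\<close>

lemma difference_constant:
  fixes f g :: "real \<Rightarrow> real"
  assumes \<omega>: "0 < \<omega>" and cf: "continuous_on {0..\<omega>} f" and cg: "continuous_on {0..\<omega>} g"
    and mid: "\<And>x y. x \<in> {0..\<omega>} \<Longrightarrow> y \<in> {0..\<omega>} \<Longrightarrow> 0 < x + y \<Longrightarrow> x + y < 2 * \<omega> \<Longrightarrow>
      f x + g y \<le> f ((x + y) / 2) + g ((x + y) / 2)"
    and s: "s \<in> {0..\<omega>}"
  shows "f s - g s = f \<omega> - g \<omega>"
proof -
  have increment: "f y - f x \<le> g y - g x"
    if xy: "0 < x" "x < y" "y < \<omega>" and cg: "continuous_on {0..\<omega>} g"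
      and mid: "\<And>x y. x \<in> {0..\<omega>} \<Longrightarrow> y \<in> {0..\<omega>} \<Longrightarrow> 0 < x + y \<Longrightarrow> x + y < 2 * \<omega> \<Longrightarrow>
        f x + g y \<le> f ((x + y) / 2) + g ((x + y) / 2)" for x y and f g :: "real \<Rightarrow> real"
  proof -
    \<comment> \<open>The interval is cut into \<open>Suc N\<close> steps. The hypothesis for the
      points \<open>p i + d N\<close> and \<open>p i - d N\<close> bounds an increment of
      \<open>f\<close> by the preceding increment of \<open>g\<close>, and both sums
      telescope.\<close>
    define d where "d N = (y - x) / Suc N" for N
    have d: "d \<longlonglongrightarrow> 0"
      using tendsto_mult_right_zero[OF LIMSEQ_inverse_real_of_nat, of "y - x"]
      by (simp add: d_def[abs_def] divide_inverse)
    have dpos: "0 < d N" for N using xy by (simp add: d_def)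
    have "\<forall>\<^sub>F N in sequentially. f y - f x \<le> g (y - d N) - g (x - d N)"
      \<comment> \<open>Eventually \<open>d N < x\<close>, so the points shifted to the left stay
        positive.\<close>
      using order_tendstoD(2)[OF d xy(1)]
    proof eventually_elim
      case (elim N)
      define p where "p i = x + real i * d N" for i
      have pN: "p (Suc N) = y" by (simp add: p_def d_def del: of_nat_Suc)
      have p0: "p 0 = x" by (simp add: p_def)
      have pS: "p (Suc i) = p i + d N" for i by (simp add: p_def algebra_simps)
      have ple: "p i \<le> y" if "i \<le> Suc N" for i
      proof -
        have "p i \<le> p (Suc N)" using that dpos[of N] by (simp add: p_def mult_right_mono del: of_nat_Suc)
        then show ?thesis by (simp add: pN)
      qed
      have pge: "x \<le> p i" for i using dpos[of N] by (simp add: p_def)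
      have step: "f (p (Suc i)) - f (p i) \<le> g (p (Suc i) - d N) - g (p i - d N)" if i: "i < Suc N" for i
      proof -
        have "f (p i + d N) + g (p i - d N) \<le> f ((p i + d N + (p i - d N)) / 2) + g ((p i + d N + (p i - d N)) / 2)"
          using i ple[of "Suc i"] ple[of i] pge[of i] dpos[of N] elim xy by (intro mid) (auto simp: pS)
        then show ?thesis by (simp add: pS)
      qed
      have "(\<Sum>i<Suc N. f (p (Suc i)) - f (p i)) \<le> (\<Sum>i<Suc N. g (p (Suc i) - d N) - g (p i - d N))"
        using step by (intro sum_mono) auto
      then have "f (p (Suc N)) - f (p 0) \<le> g (p (Suc N) - d N) - g (p 0 - d N)"
        using sum_lessThan_telescope[of "\<lambda>i. f (p i)" "Suc N"]
          sum_lessThan_telescope[of "\<lambda>i. g (p i - d N)" "Suc N"] by simp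
      then show ?case by (simp only: pN p0)
    qed
    moreover have "(\<lambda>N. g (z - d N)) \<longlonglongrightarrow> g z" if "0 < z" "z < \<omega>" for z
    proof -
      have "isCont g z" using continuous_on_interior[OF cg, of z] that by simp
      moreover have "(\<lambda>N. z - d N) \<longlonglongrightarrow> z" using tendsto_diff[OF tendsto_const d, of z] by simp
      ultimately show ?thesis by (rule isCont_tendsto_compose)
    qed
    then have "(\<lambda>N. g (y - d N) - g (x - d N)) \<longlonglongrightarrow> g y - g x"
      using xy by (intro tendsto_diff) auto
    ultimately show ?thesis
      by (intro tendsto_lowerbound) auto
  qed
  have eq: "f y - f x = g y - g x" if "0 < x" "x < y" "y < \<omega>" for x y
  proof (rule antisym)
    show "f y - f x \<le> g y - g x" by (rule increment[OF that cg mid])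
    show "g y - g x \<le> f y - f x"
    proof (rule increment[OF that cf])
      show "g x + f y \<le> g ((x + y) / 2) + f ((x + y) / 2)"
        if "x \<in> {0..\<omega>}" "y \<in> {0..\<omega>}" "0 < x + y" "x + y < 2 * \<omega>" for x y
        using mid[of y x] that by (simp add: add.commute)
    qed
  qed
  define k where "k = f (\<omega> / 2) - g (\<omega> / 2)"
  have open_eq: "f z - g z = k" if z: "z \<in> {0<..<\<omega>}" for z
  proof -
    consider "z < \<omega> / 2" | "z = \<omega> / 2" | "\<omega> / 2 < z" by linarith
    then show ?thesis
      using eq[of z "\<omega> / 2"] eq[of "\<omega> / 2" z] z by cases (auto simp: k_def)
  qed
  have cl: "closure {0<..<\<omega>} = {0..\<omega>}" using \<omega> by (rule closure_greaterThanLessThan)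
  have "f z - g z = k" if "z \<in> {0..\<omega>}" for z
  proof (rule continuous_constant_on_closure[of "{0<..<\<omega>}" "\<lambda>z. f z - g z" k])
    show "continuous_on (closure {0<..<\<omega>}) (\<lambda>z. f z - g z)" unfolding cl using cf cg by (rule continuous_on_diff)
  qed (use open_eq that cl in auto)
  then show ?thesis using s \<omega> by simp
qed

subsection \<open>Support functions of slices\<close>

text \<open>For fixed \<open>v\<close>, the upper boundary of the planar image of \<open>X\<close>
  with coordinates \<open>x \<bullet> w\<close> and \<open>x \<bullet> v\<close>.\<close>

definition upper :: "'a::euclidean_space \<Rightarrow> 'a set \<Rightarrow> 'a \<Rightarrow> real \<Rightarrow> real" where
  "upper w X v s = supp (slice w X s) v"

abbreviation lo :: "'a::euclidean_space \<Rightarrow> 'a set \<Rightarrow> real" where "lo w X \<equiv> - supp X (- w)"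
abbreviation hi :: "'a::euclidean_space \<Rightarrow> 'a set \<Rightarrow> real" where "hi w X \<equiv> supp X w"

lemma slice_segment:
  assumes X: "convex X" and t: "0 \<le> t" "t \<le> 1" and x: "x \<in> slice w X s" and y: "y \<in> slice w X s'"
  shows "(1 - t) *\<^sub>R x + t *\<^sub>R y \<in> slice w X ((1 - t) * s + t * s')"
  using assms by (auto simp: slice_def inner_add_left intro!: convexD)

lemma lo_le_hi: "convex_body X \<Longrightarrow> lo w X \<le> hi w X"
proof -
  assume X: "convex_body X"
  then obtain x where "x \<in> X" by (auto simp: convex_body_def)
  then show ?thesis using supp_ge[OF X, of x w] supp_ge[OF X, of x "- w"] by simp
qed

lemma slice_nonempty_iff:
  assumes X: "convex_body X"
  shows "slice w X s \<noteq> {} \<longleftrightarrow> lo w X \<le> s \<and> s \<le> hi w X"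
proof
  assume "slice w X s \<noteq> {}"
  then obtain x where "x \<in> X" "x \<bullet> w = s" by (auto simp: slice_def)
  then show "lo w X \<le> s \<and> s \<le> hi w X"
    using supp_ge[OF X, of x w] supp_ge[OF X, of x "- w"] by simp
next
  assume s: "lo w X \<le> s \<and> s \<le> hi w X"
  obtain x where x: "x \<in> X" "x \<bullet> w = hi w X" using supp_attained[OF X] by metis
  obtain y where y: "y \<in> X" "y \<bullet> (- w) = supp X (- w)" using supp_attained[OF X] by metis
  show "slice w X s \<noteq> {}"
  proof (cases "lo w X = hi w X")
    case True
    then show ?thesis using s x by (auto simp: slice_def)
  next
    case False
    define t where "t = (s - lo w X) / (hi w X - lo w X)"
    have lt: "0 < hi w X - lo w X" using False lo_le_hi[OF X, of w] by simp
    have t: "0 \<le> t" "t \<le> 1" using s lt by (auto simp: t_def divide_le_eq)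
    have "(1 - t) *\<^sub>R y + t *\<^sub>R x \<in> slice w X ((1 - t) * lo w X + t * hi w X)"
      by (rule slice_segment[OF _ t]) (use x y X in \<open>auto simp: slice_def convex_body_def\<close>)
    moreover have "(1 - t) * lo w X + t * hi w X = lo w X + t * (hi w X - lo w X)" by (simp add: algebra_simps)
    moreover have "lo w X + t * (hi w X - lo w X) = s" using lt by (simp add: t_def)
    ultimately show ?thesis by auto
  qed
qed

lemma upper_attained:
  assumes "convex_body X" "lo w X \<le> s" "s \<le> hi w X"
  obtains x where "x \<in> X" "x \<bullet> w = s" "x \<bullet> v = upper w X v s"
proof -
  have "convex_body (slice w X s)" using assms slice_nonempty_iff convex_body_slice by metis
  then obtain x where "x \<in> slice w X s" "x \<bullet> v = upper w X v s" unfolding upper_def using supp_attained by metis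
  then show thesis using that by (auto simp: slice_def)
qed

lemma upper_ge: "convex_body X \<Longrightarrow> x \<in> X \<Longrightarrow> x \<bullet> v \<le> upper w X v (x \<bullet> w)"
  unfolding upper_def by (intro supp_ge convex_body_slice) (auto simp: slice_def)

lemma upper_concave:
  assumes X: "convex_body X" and s: "s \<in> {lo w X..hi w X}" "s' \<in> {lo w X..hi w X}" and t: "0 \<le> t" "t \<le> 1"
  shows "(1 - t) * upper w X v s + t * upper w X v s' \<le> upper w X v ((1 - t) * s + t * s')"
proof -
  obtain x where x: "x \<in> X" "x \<bullet> w = s" "x \<bullet> v = upper w X v s"
    by (rule upper_attained[OF X, of w s v]) (use s in auto)
  obtain y where y: "y \<in> X" "y \<bullet> w = s'" "y \<bullet> v = upper w X v s'"
    by (rule upper_attained[OF X, of w s' v]) (use s in auto)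
  have "(1 - t) *\<^sub>R x + t *\<^sub>R y \<in> X" using X x y t by (intro convexD) (auto simp: convex_body_def)
  from upper_ge[OF X this, of v w] show ?thesis by (simp add: x y inner_add_left)
qed

text \<open>The superlevel sets are images of compact sets, so concavity gives continuity up to the
  extreme heights.\<close>

lemma upper_continuous:
  assumes X: "convex_body X"
  shows "continuous_on {lo w X..hi w X} (upper w X v)"
proof (rule concave_closed_levels_continuous[OF upper_concave[OF X]])
  fix c
  have "{s \<in> {lo w X..hi w X}. c \<le> upper w X v s} = (\<lambda>x. x \<bullet> w) ` {x \<in> X. c \<le> x \<bullet> v}"
  proof (intro equalityI subsetI)
    fix s assume s: "s \<in> {s \<in> {lo w X..hi w X}. c \<le> upper w X v s}"
    obtain x where "x \<in> X" "x \<bullet> w = s" "x \<bullet> v = upper w X v s"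
      by (rule upper_attained[OF X, of w s v]) (use s in auto)
    then show "s \<in> (\<lambda>x. x \<bullet> w) ` {x \<in> X. c \<le> x \<bullet> v}" using s by auto
  next
    fix s assume "s \<in> (\<lambda>x. x \<bullet> w) ` {x \<in> X. c \<le> x \<bullet> v}"
    then obtain x where x: "x \<in> X" "s = x \<bullet> w" "c \<le> x \<bullet> v" by auto
    then have "slice w X s \<noteq> {}" by (auto simp: slice_def)
    then show "s \<in> {s \<in> {lo w X..hi w X}. c \<le> upper w X v s}"
      using x upper_ge[OF X x(1), of v w] by (auto simp: slice_nonempty_iff[OF X])
  qed
  moreover have "compact {x \<in> X. c \<le> x \<bullet> v}"
  proof -
    have "{x \<in> X. c \<le> x \<bullet> v} = X \<inter> {x. c \<le> x \<bullet> v}" by auto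
    moreover have "closed {x. c \<le> x \<bullet> v}" by (intro closed_Collect_le continuous_intros)
    ultimately show ?thesis using X by (simp add: convex_body_def compact_Int_closed)
  qed
  ultimately show "closed {s \<in> {lo w X..hi w X}. c \<le> upper w X v s}"
    by (auto intro!: compact_imp_closed compact_continuous_image continuous_intros)
qed

text \<open>Concave biduality: a point below all the support lines of the planar image lies below
  its upper boundary. Otherwise a line would separate the image from the vertical ray above the
  point.\<close>

lemma upper_if_supp:
  assumes X: "convex_body X" and s: "lo w X \<le> s" "s \<le> hi w X"
    and le: "\<And>q. c + q * s \<le> supp X (v + q *\<^sub>R w)"
  shows "c \<le> upper w X v s"
proof (rule ccontr)
  assume "\<not> ?thesis"
  then have c: "upper w X v s < c" by simp
  define S where "S = (\<lambda>x. (x \<bullet> w, x \<bullet> v)) ` X"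
  define T where "T = {s} \<times> {c..}"
  have "convex S" unfolding S_def
    using X by (intro convex_linear_image) (auto simp: convex_body_def linear_iff inner_add_left)
  moreover have "compact S" unfolding S_def
    using X by (intro compact_continuous_image continuous_intros) (auto simp: convex_body_def)
  moreover have "S \<noteq> {}" using X by (auto simp: S_def convex_body_def)
  moreover have "convex T" "closed T" unfolding T_def by (auto intro: convex_Times closed_Times)
  moreover have "S \<inter> T = {}"
  proof (rule ccontr)
    assume "S \<inter> T \<noteq> {}"
    then obtain x where x: "x \<in> X" "(x \<bullet> w, x \<bullet> v) \<in> T" by (auto simp: S_def)
    then show False using upper_ge[OF X x(1), of v w] c by (auto simp: T_def)
  qed
  ultimately obtain a b where ab: "\<forall>z\<in>S. inner a z < b" "\<forall>z\<in>T. inner a z > b"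
    using separating_hyperplane_compact_closed by metis
  define \<alpha> \<beta> where "\<alpha> = fst a" and "\<beta> = snd a"
  have S: "\<alpha> * (x \<bullet> w) + \<beta> * (x \<bullet> v) < b" if "x \<in> X" for x
    using ab(1) that by (auto simp: S_def \<alpha>_def \<beta>_def inner_prod_def)
  have T: "\<alpha> * s + \<beta> * y > b" if "c \<le> y" for y
    using ab(2)[rule_format, of "(s, y)"] that by (auto simp: T_def \<alpha>_def \<beta>_def inner_prod_def)
  obtain x where x: "x \<in> X" "x \<bullet> w = s" "x \<bullet> v = upper w X v s" using upper_attained[OF X s] .
  have "\<beta> * upper w X v s < \<beta> * c" using S[OF x(1)] T[of c] x by simp
  \<comment> \<open>The separating line is not vertical, because the image also has a point over
    \<open>s\<close>, strictly below the ray.\<close>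
  then have \<beta>: "0 < \<beta>" using c by (simp add: mult_less_cancel_left)
  define q where "q = \<alpha> / \<beta>"
  obtain y where y: "y \<in> X" "y \<bullet> (v + q *\<^sub>R w) = supp X (v + q *\<^sub>R w)" using supp_attained[OF X] by metis
  have "\<beta> * (c + q * s) \<le> \<beta> * (y \<bullet> (v + q *\<^sub>R w))" using le[of q] y \<beta> by simp
  also have "\<dots> = \<alpha> * (y \<bullet> w) + \<beta> * (y \<bullet> v)" using \<beta> by (simp add: q_def inner_add_right algebra_simps)
  also have "\<dots> < b" by (rule S[OF y(1)])
  finally have "\<beta> * (c + q * s) < b" .
  moreover have "b < \<beta> * (c + q * s)" using T[of c] \<beta> by (simp add: q_def algebra_simps)
  ultimately show False by simp
qed

lemma supp_le_upper:
  assumes X: "convex_body X" and x: "x \<in> X"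
  shows "x \<bullet> (v + q *\<^sub>R w) \<le> upper w X v (x \<bullet> w) + q * (x \<bullet> w)"
  using upper_ge[OF X x, of v w] by (simp add: inner_add_right)

lemma upper_le_supp:
  assumes X: "convex_body X" and s: "lo w X \<le> s" "s \<le> hi w X"
  shows "upper w X v s + q * s \<le> supp X (v + q *\<^sub>R w)"
proof -
  obtain x where x: "x \<in> X" "x \<bullet> w = s" "x \<bullet> v = upper w X v s" using upper_attained[OF X s] .
  then show ?thesis using supp_ge[OF X x(1), of "v + q *\<^sub>R w"] by (simp add: inner_add_right)
qed

lemma face_dir_conv:
  assumes X: "convex_body X"
  shows "face_dir X w = slice w X (hi w X)"
proof -
  obtain x where x: "x \<in> X" "x \<bullet> w = hi w X" using supp_attained[OF X] by metis
  show ?thesis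
  proof (intro equalityI subsetI)
    fix y assume "y \<in> face_dir X w"
    then have "y \<in> X" "x \<bullet> w \<le> y \<bullet> w" using x by (auto simp: face_dir_def)
    then show "y \<in> slice w X (hi w X)" using supp_ge[OF X, of y w] x by (simp add: slice_def)
  next
    fix y assume "y \<in> slice w X (hi w X)"
    then show "y \<in> face_dir X w" using supp_ge[OF X] by (auto simp: face_dir_def slice_def)
  qed
qed

lemma convex_body_face: "convex_body X \<Longrightarrow> convex_body (face_dir X w)"
  using slice_nonempty_iff[of X w "hi w X"] lo_le_hi[of X w]
  by (simp add: face_dir_conv convex_body_slice)

lemma supp_face:
  assumes X: "convex_body X"
  shows "supp (face_dir X w) (v + q *\<^sub>R w) = upper w X v (hi w X) + q * hi w X"
  using convex_body_face[OF X, of w] unfolding face_dir_conv[OF X] upper_def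
  by (rule supp_flat) (simp add: slice_def)

subsection \<open>The equality cases\<close>

lemma slice_plus_subset: "slice w X s + slice w Y s' \<subseteq> slice w (X + Y) (s + s')"
  by (auto simp: slice_def inner_add_left elim!: set_plus_elim)

lemma slice_plusE:
  assumes "z \<in> slice w (X + Y) s"
  obtains x y where "x \<in> X" "y \<in> Y" "z = x + y" "x \<bullet> w + y \<bullet> w = s"
  using assms by (auto simp: slice_def inner_add_left elim!: set_plus_elim)

lemma has_bochner_integral_nonneg:
  fixes f :: "'a \<Rightarrow> real"
  shows "has_bochner_integral N f x \<Longrightarrow> (\<And>s. 0 \<le> f s) \<Longrightarrow> 0 \<le> x"
  by (auto simp: has_bochner_integral_iff)

text \<open>The cone over \<open>E\<close> represents the support of the surface area measure of \<open>M\<close> within the hyperplane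
  orthogonal to \<open>w\<close>.\<close>

locale normals = flat_body M w for M :: "(real^'n) set" and w +
  fixes E :: "(real^'n) set"
  assumes E_w: "\<And>v. v \<in> E \<Longrightarrow> v \<bullet> w = 0"
    and \<phi>_eq: "\<And>A B. flat w A \<Longrightarrow> flat w B \<Longrightarrow> A \<subseteq> B \<Longrightarrow> (\<And>v. v \<in> E \<Longrightarrow> supp A v = supp B v) \<Longrightarrow> \<phi> A = \<phi> B"
    and \<phi>_less: "\<And>A B v. flat w A \<Longrightarrow> flat w B \<Longrightarrow> A \<subseteq> B \<Longrightarrow> v \<in> E \<Longrightarrow> supp A v < supp B v \<Longrightarrow> \<phi> A < \<phi> B"
    and E_nonempty: "E \<noteq> {}"
    and one_extreme: "\<And>u. one_extreme_normal M u \<longleftrightarrow> u \<noteq> 0 \<and> (\<exists>c\<ge>0. \<exists>q. \<exists>v\<in>E. u = c *\<^sub>R v + q *\<^sub>R w)"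
begin

definition matching :: "(real^'n) set \<Rightarrow> (real^'n) set \<Rightarrow> bool" where
  "matching K L \<longleftrightarrow> (\<forall>v\<in>E. \<forall>s\<in>{0..hi w K - lo w K}.
     upper w K v (lo w K + s) - upper w L v (lo w L + s) = upper w K v (hi w K) - upper w L v (hi w L))"

text \<open>The defect of superadditivity at relative height \<open>s\<close>. Heights are counted
  from the lowest points, so slices of \<open>K\<close> and \<open>L\<close> at \<open>s\<close>
  meet the slice of the sum at \<open>2 * s\<close>.\<close>

definition gap :: "(real^'n) set \<Rightarrow> (real^'n) set \<Rightarrow> real \<Rightarrow> real" where
  "gap K L s = \<phi> (slice w (K + L) (lo w K + lo w L + 2 * s)) - \<phi> (slice w K (lo w K + s)) - \<phi> (slice w L (lo w L + s))"

text \<open>The substitution \<open>2 * s\<close> halves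
  \<open>W (K + L) = W K + 2 * V2 K L M + W L\<close>.\<close>

lemma gap_integral:
  assumes K: "convex_body K" and L: "convex_body L"
  shows "has_bochner_integral lborel (gap K L) (V2 K L M - (W K + W L) / 2)"
proof -
  have "has_bochner_integral lborel (\<lambda>s. \<phi> (slice w (K + L) ((lo w K + lo w L) + 2 * s))) (W (K + L) /\<^sub>R \<bar>2\<bar>)"
    using W_slices[OF convex_body_plus[OF K L]] by (subst lborel_has_bochner_integral_real_affine_iff[symmetric]) auto
  moreover have "has_bochner_integral lborel (\<lambda>s. \<phi> (slice w K (lo w K + 1 * s))) (W K /\<^sub>R \<bar>1\<bar>)"
    using W_slices[OF K] by (subst lborel_has_bochner_integral_real_affine_iff[symmetric]) auto
  moreover have "has_bochner_integral lborel (\<lambda>s. \<phi> (slice w L (lo w L + 1 * s))) (W L /\<^sub>R \<bar>1\<bar>)"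
    using W_slices[OF L] by (subst lborel_has_bochner_integral_real_affine_iff[symmetric]) auto
  ultimately have "has_bochner_integral lborel (gap K L) (W (K + L) /\<^sub>R \<bar>2\<bar> - W K /\<^sub>R \<bar>1\<bar> - W L /\<^sub>R \<bar>1\<bar>)"
    unfolding gap_def by (intro has_bochner_integral_diff) auto
  moreover have "W (K + L) /\<^sub>R \<bar>2\<bar> - W K /\<^sub>R \<bar>1\<bar> - W L /\<^sub>R \<bar>1\<bar> = V2 K L M - (W K + W L) / 2"
    by (simp add: W_plus[OF K L] field_simps)
  ultimately show ?thesis by simp
qed

context
  fixes K L :: "(real^'n) set" and \<omega> :: real
  assumes K: "convex_body K" and L: "convex_body L"
    and wK: "hi w K = lo w K + \<omega>" and wL: "hi w L = lo w L + \<omega>"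
begin

lemma sum_bounds: "lo w (K + L) = lo w K + lo w L" "hi w (K + L) = lo w K + lo w L + 2 * \<omega>"
  using wK wL by (simp_all add: supp_plus K L)

lemma slices_inside:
  assumes s: "s \<in> {0..\<omega>}"
  shows "flat w (slice w K (lo w K + s))" "flat w (slice w L (lo w L + s))"
    "flat w (slice w (K + L) (lo w K + lo w L + 2 * s))"
    "slice w K (lo w K + s) + slice w L (lo w L + s) \<subseteq> slice w (K + L) (lo w K + lo w L + 2 * s)"
proof -
  show "flat w (slice w K (lo w K + s))" "flat w (slice w L (lo w L + s))"
  proof -
    have "slice w K (lo w K + s) \<noteq> {}" "slice w L (lo w L + s) \<noteq> {}"
      unfolding slice_nonempty_iff[OF K] slice_nonempty_iff[OF L] using s wK wL by auto
    then show "flat w (slice w K (lo w K + s))" "flat w (slice w L (lo w L + s))"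
      using K L by (auto intro: flat_slice)
  qed
  show "flat w (slice w (K + L) (lo w K + lo w L + 2 * s))"
    using s sum_bounds convex_body_plus[OF K L] by (intro flat_slice) (auto simp: slice_nonempty_iff)
  show "slice w K (lo w K + s) + slice w L (lo w L + s) \<subseteq> slice w (K + L) (lo w K + lo w L + 2 * s)"
    using slice_plus_subset[of w K "lo w K + s" L "lo w L + s"] by (simp add: algebra_simps)
qed

lemma gap_inside:
  assumes "s \<in> {0..\<omega>}"
  shows "gap K L s = \<phi> (slice w (K + L) (lo w K + lo w L + 2 * s)) - \<phi> (slice w K (lo w K + s) + slice w L (lo w L + s))"
  using slices_inside[OF assms] by (simp add: gap_def \<phi>_plus)

lemma gap_outside:
  assumes "s \<notin> {0..\<omega>}"
  shows "gap K L s = 0"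
proof -
  have "slice w K (lo w K + s) = {}" "slice w L (lo w L + s) = {}"
    "slice w (K + L) (lo w K + lo w L + 2 * s) = {}"
    using assms slice_nonempty_iff[OF K, of w "lo w K + s"] slice_nonempty_iff[OF L, of w "lo w L + s"]
      slice_nonempty_iff[OF convex_body_plus[OF K L], of w "lo w K + lo w L + 2 * s"] wK wL sum_bounds
    by auto
  then show ?thesis by (simp add: gap_def \<phi>_empty)
qed

lemma gap_nonneg: "0 \<le> gap K L s"
proof (cases "s \<in> {0..\<omega>}")
  case True
  show ?thesis
    unfolding gap_inside[OF True] using slices_inside[OF True] by (simp add: \<phi>_mono flat_plus)
qed (simp add: gap_outside)

lemma V2_ge: "W K + W L \<le> 2 * V2 K L M"
  using has_bochner_integral_nonneg[OF gap_integral[OF K L]] gap_nonneg by simp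

lemma supp_slices:
  assumes "s \<in> {0..\<omega>}"
  shows "supp (slice w K (lo w K + s) + slice w L (lo w L + s)) v =
    upper w K v (lo w K + s) + upper w L v (lo w L + s)"
  using slices_inside[OF assms] by (simp add: supp_plus flat_def upper_def)

lemma upper_cont:
  "continuous_on {0..\<omega>} (\<lambda>s. upper w K v (lo w K + s))"
  "continuous_on {0..\<omega>} (\<lambda>s. upper w L v (lo w L + s))"
  "continuous_on {0..\<omega>} (\<lambda>s. upper w (K + L) v (lo w K + lo w L + 2 * s))"
  using wK wL sum_bounds
  by (auto intro!: continuous_on_compose2[OF upper_continuous[OF K]] continuous_on_compose2[OF upper_continuous[OF L]]
      continuous_on_compose2[OF upper_continuous[OF convex_body_plus[OF K L]]] continuous_intros)

text \<open>The gap is nonnegative with integral zero, hence zero almost everywhere. So in the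
  directions of \<open>E\<close> the slices of the sum support no farther than the sums of slices,
  which is the midpoint hypothesis of \<open>difference_constant\<close>.\<close>

lemma matching_if_equality:
  assumes \<omega>: "0 < \<omega>" and eq: "2 * V2 K L M = W K + W L"
  shows "matching K L"
proof -
  have int: "integrable lborel (gap K L)" "integral\<^sup>L lborel (gap K L) = 0"
    using gap_integral[OF K L] eq by (simp_all add: has_bochner_integral_iff)
  have AE: "AE s in lborel. gap K L s = 0"
    using integral_nonneg_eq_0_iff_AE[OF int(1)] int(2) gap_nonneg by simp
  have le: "upper w (K + L) v (lo w K + lo w L + 2 * s) \<le> upper w K v (lo w K + s) + upper w L v (lo w L + s)"
    if v: "v \<in> E" and s: "0 < s" "s < \<omega>" for v s
  proof (rule ccontr)
    \<comment> \<open>If the bound fails at \<open>s\<close>, continuity makes it fail on an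
      interval. This contains a height with zero gap, where \<open>\<phi>_less\<close> would force a
      positive one.\<close>
    define h where "h s = upper w (K + L) v (lo w K + lo w L + 2 * s) - (upper w K v (lo w K + s) + upper w L v (lo w L + s))" for s
    assume "\<not> ?thesis"
    then have h: "0 < h s" by (simp add: h_def)
    have "continuous_on {0..\<omega>} h" unfolding h_def by (intro continuous_on_diff continuous_on_add upper_cont)
    then have "isCont h s" using s by (intro continuous_on_interior[of "{0..\<omega>}"]) auto
    then have "\<forall>\<^sub>F z in nhds s. 0 < h z"
      using h order_tendstoD(1)[of h "h s" "nhds s" 0] by (simp add: continuous_at_imp_continuous_at_within isCont_def tendsto_at_iff_tendsto_nhds)
    then obtain d where d: "0 < d" "\<And>z. dist z s < d \<Longrightarrow> 0 < h z" by (auto simp: eventually_nhds_metric)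
    obtain z where z: "s < z" "z < s + min d (\<omega> - s)" "gap K L z = 0"
      by (rule AE_lborel_dense[OF AE, of s "s + min d (\<omega> - s)"]) (use d s in auto)
    have zi: "z \<in> {0..\<omega>}" using z s by auto
    have "0 < h z" using z d by (auto simp: dist_real_def)
    then have "supp (slice w K (lo w K + z) + slice w L (lo w L + z)) v < supp (slice w (K + L) (lo w K + lo w L + 2 * z)) v"
      unfolding supp_slices[OF zi] h_def upper_def[of w "K + L"] by linarith
    then have "\<phi> (slice w K (lo w K + z) + slice w L (lo w L + z)) < \<phi> (slice w (K + L) (lo w K + lo w L + 2 * z))"
      using slices_inside[OF zi] v by (intro \<phi>_less flat_plus)
    then show False using z(3) gap_inside[OF zi] by simp
  qed
  show ?thesis
    unfolding matching_def
  proof (intro ballI)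
    fix v s assume v: "v \<in> E" and s: "s \<in> {0..hi w K - lo w K}"
    have "upper w K v (lo w K + s) - upper w L v (lo w L + s) = upper w K v (lo w K + \<omega>) - upper w L v (lo w L + \<omega>)"
    proof (rule difference_constant[OF \<omega> upper_cont(1,2)])
      fix x y assume xy: "x \<in> {0..\<omega>}" "y \<in> {0..\<omega>}" "0 < x + y" "x + y < 2 * \<omega>"
      \<comment> \<open>Maximisers at different relative heights \<open>x\<close> and
        \<open>y\<close>: their sum lies in the slice of \<open>K + L\<close> at twice the mean
        height, where \<open>le\<close> applies.\<close>
      obtain a where a: "a \<in> K" "a \<bullet> w = lo w K + x" "a \<bullet> v = upper w K v (lo w K + x)"
        by (rule upper_attained[OF K, of w "lo w K + x" v]) (use xy wK in auto)
      obtain b where b: "b \<in> L" "b \<bullet> w = lo w L + y" "b \<bullet> v = upper w L v (lo w L + y)"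
        by (rule upper_attained[OF L, of w "lo w L + y" v]) (use xy wL in auto)
      have "upper w K v (lo w K + x) + upper w L v (lo w L + y) = (a + b) \<bullet> v"
        using a b by (simp add: inner_add_left)
      also have "\<dots> \<le> upper w (K + L) v ((a + b) \<bullet> w)"
        using a b by (intro upper_ge convex_body_plus K L set_plus_intro)
      also have "upper w (K + L) v ((a + b) \<bullet> w) = upper w (K + L) v (lo w K + lo w L + 2 * ((x + y) / 2))"
      proof -
        have "(a + b) \<bullet> w = lo w K + lo w L + 2 * ((x + y) / 2)"
          unfolding inner_add_left a(2) b(2) by simp
        then show ?thesis by simp
      qed
      also have "\<dots> \<le> upper w K v (lo w K + (x + y) / 2) + upper w L v (lo w L + (x + y) / 2)"
        using xy v by (intro le) auto
      finally show "upper w K v (lo w K + x) + upper w L v (lo w L + y)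
        \<le> upper w K v (lo w K + (x + y) / 2) + upper w L v (lo w L + (x + y) / 2)" .
    qed (use s wK in simp)
    then show "upper w K v (lo w K + s) - upper w L v (lo w L + s) = upper w K v (hi w K) - upper w L v (hi w L)"
      by (simp add: wK wL)
  qed
qed

text \<open>In each direction of \<open>E\<close> the slice function of \<open>K\<close> is that of
  \<open>L\<close> plus a constant. Concavity then bounds the support of a slice of the sum by that
  of the sum of slices, and \<phi> does not tell them apart.\<close>

lemma equality_if_matching:
  assumes m: "matching K L"
  shows "2 * V2 K L M = W K + W L"
proof -
  have "gap K L s = 0" for s
  proof (cases "s \<in> {0..\<omega>}")
    case s: True
    note sl = slices_inside[OF s]
    have "\<phi> (slice w K (lo w K + s) + slice w L (lo w L + s)) = \<phi> (slice w (K + L) (lo w K + lo w L + 2 * s))"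
    proof (rule \<phi>_eq[OF flat_plus[OF sl(1,2)] sl(3,4)])
      fix v assume v: "v \<in> E"
      define k where "k = upper w K v (hi w K) - upper w L v (hi w L)"
      have KL: "upper w K v (lo w K + x) = upper w L v (lo w L + x) + k" if "x \<in> {0..\<omega>}" for x
      proof -
        have "x \<in> {0..hi w K - lo w K}" using that wK by auto
        then have "upper w K v (lo w K + x) - upper w L v (lo w L + x) = upper w K v (hi w K) - upper w L v (hi w L)"
          using m v unfolding matching_def by blast
        then show ?thesis unfolding k_def by linarith
      qed
      have "supp (slice w (K + L) (lo w K + lo w L + 2 * s)) v \<le> supp (slice w K (lo w K + s) + slice w L (lo w L + s)) v"
        unfolding supp_slices[OF s]
      proof (subst supp_le_iff)
        show "convex_body (slice w (K + L) (lo w K + lo w L + 2 * s))" using sl(3) by (simp add: flat_def)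
        show "\<forall>z\<in>slice w (K + L) (lo w K + lo w L + 2 * s). z \<bullet> v \<le> upper w K v (lo w K + s) + upper w L v (lo w L + s)"
        proof
          fix z assume "z \<in> slice w (K + L) (lo w K + lo w L + 2 * s)"
          then obtain x y where xy: "x \<in> K" "y \<in> L" "z = x + y" "x \<bullet> w + y \<bullet> w = lo w K + lo w L + 2 * s"
            by (rule slice_plusE)
          define p q where "p = x \<bullet> w - lo w K" and "q = y \<bullet> w - lo w L"
          have "slice w K (x \<bullet> w) \<noteq> {}" "slice w L (y \<bullet> w) \<noteq> {}" using xy by (auto simp: slice_def)
          then have pq: "p \<in> {0..\<omega>}" "q \<in> {0..\<omega>}"
            using wK wL by (auto simp: slice_nonempty_iff K L p_def q_def)
          \<comment> \<open>The relative heights \<open>p\<close> and \<open>q\<close> have mean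
            \<open>s\<close>. Matching expresses the value of \<open>K\<close> at \<open>p\<close>
            through \<open>L\<close>, where concavity applies.\<close>
          have mid: "(1 - 1 / 2) * (lo w L + p) + 1 / 2 * (lo w L + q) = lo w L + s"
            using xy(4) by (simp add: p_def q_def field_simps)
          have "(1 - 1 / 2) * upper w L v (lo w L + p) + 1 / 2 * upper w L v (lo w L + q) \<le> upper w L v (lo w L + s)"
            using upper_concave[OF L, of "lo w L + p" w "lo w L + q" "1 / 2" v] pq wL unfolding mid by simp
          moreover have "x \<bullet> v \<le> upper w K v (lo w K + p)" using upper_ge[OF K xy(1), of v w] by (simp add: p_def)
          moreover have "y \<bullet> v \<le> upper w L v (lo w L + q)" using upper_ge[OF L xy(2), of v w] by (simp add: q_def)
          ultimately show "z \<bullet> v \<le> upper w K v (lo w K + s) + upper w L v (lo w L + s)"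
            using KL[OF pq(1)] KL[OF s] by (simp add: xy(3) inner_add_left)
        qed
      qed
      moreover have "supp (slice w K (lo w K + s) + slice w L (lo w L + s)) v \<le> supp (slice w (K + L) (lo w K + lo w L + 2 * s)) v"
        using sl by (intro supp_mono) (auto simp: flat_def convex_body_plus)
      ultimately show "supp (slice w K (lo w K + s) + slice w L (lo w L + s)) v = supp (slice w (K + L) (lo w K + lo w L + 2 * s)) v"
        by simp
    qed
    then show ?thesis by (simp add: gap_inside[OF s])
  qed (simp add: gap_outside)
  then have "gap K L = (\<lambda>_. 0)" by (simp add: fun_eq_iff)
  then have "has_bochner_integral lborel (gap K L) 0" by (simp only: has_bochner_integral_zero)
  then have "V2 K L M - (W K + W L) / 2 = 0"
    by (rule has_bochner_integral_eq[OF gap_integral[OF K L]])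
  then show ?thesis by simp
qed

end

section \<open>The support condition in terms of slices\<close>

definition same_support :: "(real^'n) set \<Rightarrow> (real^'n) set \<Rightarrow> bool" where
  "same_support K L \<longleftrightarrow> (\<forall>u. one_extreme_normal M u \<longrightarrow>
     supp (K + face_dir L w) u = supp (L + face_dir K w) u)"

lemma supp_0: "convex_body X \<Longrightarrow> supp X 0 = 0"
  using supp_attained[of X 0] by (metis inner_zero_right)

text \<open>The equations for all slopes \<open>q\<close> equate the conjugates of two concave
  functions up to affine terms. Equal widths reduce these terms to a shift of the heights and a
  constant, and \<open>upper_if_supp\<close> inverts the conjugation.\<close>

lemma upper_le_if_supp:
  assumes K: "convex_body K" and L: "convex_body L" and width: "hi w K - lo w K = hi w L - lo w L"
    and eq: "\<And>q. supp K (v + q *\<^sub>R w) + upper w L v (hi w L) + q * hi w L =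
      supp L (v + q *\<^sub>R w) + upper w K v (hi w K) + q * hi w K"
    and s: "s \<in> {0..hi w K - lo w K}"
  shows "upper w K v (lo w K + s) - (upper w K v (hi w K) - upper w L v (hi w L)) \<le> upper w L v (lo w L + s)"
proof (rule upper_if_supp[OF L])
  fix q
  have "upper w K v (lo w K + s) + q * (lo w K + s) \<le> supp K (v + q *\<^sub>R w)"
    using s by (intro upper_le_supp K) auto
  moreover have "q * hi w K - q * hi w L = q * lo w K - q * lo w L"
  proof -
    have "hi w K - hi w L = lo w K - lo w L" using width by linarith
    then have "q * (hi w K - hi w L) = q * (lo w K - lo w L)" by simp
    then show ?thesis by (simp only: right_diff_distrib)
  qed
  ultimately show "upper w K v (lo w K + s) - (upper w K v (hi w K) - upper w L v (hi w L)) + q * (lo w L + s)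
      \<le> supp L (v + q *\<^sub>R w)"
    using eq[of q] by (simp add: algebra_simps)
qed (use s width in auto)

text \<open>On the half-plane spanned by \<open>v\<close> and \<open>w\<close>, support functions
  are conjugates of slice functions, and the added faces align the values at the highest slices.
  Multiples of \<open>v\<close> are covered by homogeneity.\<close>

lemma same_support_iff:
  assumes K: "convex_body K" and L: "convex_body L"
  shows "same_support K L \<longleftrightarrow> hi w K - lo w K = hi w L - lo w L \<and> matching K L"
proof
  assume ss: "same_support K L"
  have S: "supp K (c *\<^sub>R v + q *\<^sub>R w) + upper w L (c *\<^sub>R v) (hi w L) + q * hi w L =
      supp L (c *\<^sub>R v + q *\<^sub>R w) + upper w K (c *\<^sub>R v) (hi w K) + q * hi w K" if "v \<in> E" "0 \<le> c" for v q c
  proof -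
    have "supp (K + face_dir L w) (c *\<^sub>R v + q *\<^sub>R w) = supp (L + face_dir K w) (c *\<^sub>R v + q *\<^sub>R w)"
    \<comment> \<open>The zero vector is not a 1-extreme normal, but there both sides are
      zero.\<close>
    proof (cases "c *\<^sub>R v + q *\<^sub>R w = 0")
      case True
      then show ?thesis using K L by (simp add: supp_0 convex_body_plus convex_body_face)
    next
      case False
      then show ?thesis using ss that by (auto simp: same_support_def one_extreme)
    qed
    then show ?thesis
      using K L by (simp add: supp_plus convex_body_face supp_face)
  qed
  obtain v0 where v0: "v0 \<in> E" using E_nonempty by blast
  have z: "upper w X 0 s = 0" if "slice w X s \<noteq> {}" "convex_body X" for X s
    unfolding upper_def using that by (intro supp_0 convex_body_slice)
  \<comment> \<open>Evaluated at \<open>- w\<close>, the condition involves nothing but the extreme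
    heights.\<close>
  have width: "hi w K - lo w K = hi w L - lo w L"
    using S[OF v0, of 0 "-1"] z[of K "hi w K"] z[of L "hi w L"] K L lo_le_hi[OF K, of w] lo_le_hi[OF L, of w]
    by (simp add: slice_nonempty_iff)
  have "matching K L"
    unfolding matching_def
  proof (intro ballI antisym)
    fix v s assume v: "v \<in> E" and s: "s \<in> {0..hi w K - lo w K}"
    show "upper w K v (lo w K + s) - upper w L v (lo w L + s) \<le> upper w K v (hi w K) - upper w L v (hi w L)"
      using upper_le_if_supp[OF K L width _ s, of v] S[OF v, of 1] by simp
    show "upper w K v (hi w K) - upper w L v (hi w L) \<le> upper w K v (lo w K + s) - upper w L v (lo w L + s)"
      using upper_le_if_supp[OF L K width[symmetric], of v s] S[OF v, of 1] s width by simp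
  qed
  with width show "hi w K - lo w K = hi w L - lo w L \<and> matching K L" by blast
next
  assume a: "hi w K - lo w K = hi w L - lo w L \<and> matching K L"
  have le: "supp X (v + q *\<^sub>R w) \<le> supp Y (v + q *\<^sub>R w) + k + q * (lo w X - lo w Y)"
    if X: "convex_body X" and Y: "convex_body Y" and width: "hi w X - lo w X = hi w Y - lo w Y"
      and m: "\<And>s. s \<in> {0..hi w X - lo w X} \<Longrightarrow> upper w X v (lo w X + s) = upper w Y v (lo w Y + s) + k"
    for X Y v q k
    unfolding supp_le_iff[OF X]
  proof
    fix x assume x: "x \<in> X"
    then have "slice w X (x \<bullet> w) \<noteq> {}" by (auto simp: slice_def)
    then have s: "x \<bullet> w - lo w X \<in> {0..hi w X - lo w X}" by (auto simp: slice_nonempty_iff[OF X])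
    have "x \<bullet> (v + q *\<^sub>R w) \<le> upper w X v (x \<bullet> w) + q * (x \<bullet> w)" by (rule supp_le_upper[OF X x])
    also have "\<dots> = upper w Y v (lo w Y + (x \<bullet> w - lo w X)) + q * (lo w Y + (x \<bullet> w - lo w X)) + k + q * (lo w X - lo w Y)"
      using m[OF s] by (simp add: algebra_simps)
    also have "upper w Y v (lo w Y + (x \<bullet> w - lo w X)) + q * (lo w Y + (x \<bullet> w - lo w X)) \<le> supp Y (v + q *\<^sub>R w)"
      using s width by (intro upper_le_supp[OF Y]) auto
    finally show "x \<bullet> (v + q *\<^sub>R w) \<le> supp Y (v + q *\<^sub>R w) + k + q * (lo w X - lo w Y)" by simp
  qed
  show "same_support K L"
    unfolding same_support_def
  proof (intro allI impI)
    fix u assume "one_extreme_normal M u"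
    then obtain c q v where u: "0 \<le> c" "v \<in> E" "u = c *\<^sub>R v + q *\<^sub>R w" by (auto simp: one_extreme)
    have sc: "upper w X (c *\<^sub>R v) s = c * upper w X v s" if "convex_body X" "lo w X \<le> s" "s \<le> hi w X" for X s
      unfolding upper_def using that u by (intro supp_scale) (auto simp: convex_body_slice slice_nonempty_iff)
    define k where "k = upper w K (c *\<^sub>R v) (hi w K) - upper w L (c *\<^sub>R v) (hi w L)"
    have m: "upper w K (c *\<^sub>R v) (lo w K + s) = upper w L (c *\<^sub>R v) (lo w L + s) + k" if s: "s \<in> {0..hi w K - lo w K}" for s
    proof -
      have "c * (upper w K v (lo w K + s) - upper w L v (lo w L + s)) = c * (upper w K v (hi w K) - upper w L v (hi w L))"
        using a u s by (simp add: matching_def)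
      then show ?thesis
        using s a lo_le_hi[OF K, of w] lo_le_hi[OF L, of w]
        by (simp add: k_def sc K L right_diff_distrib)
    qed
    have "supp K u \<le> supp L u + k + q * (lo w K - lo w L)"
      unfolding u using a m by (intro le K L) auto
    moreover have "supp L u \<le> supp K u + (- k) + q * (lo w L - lo w K)"
      unfolding u using a m by (intro le K L) auto
    ultimately have "supp K u = supp L u + k + q * (lo w K - lo w L)" by (simp add: algebra_simps)
    moreover have "q * (lo w K - lo w L) = q * hi w K - q * hi w L"
    proof -
      have "lo w K - lo w L = hi w K - hi w L" using a by linarith
      then show ?thesis by (simp only: right_diff_distrib)
    qed
    ultimately show "supp (K + face_dir L w) u = supp (L + face_dir K w) u"
      using K L by (simp add: supp_plus convex_body_face u supp_face k_def)
  qed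
qed

lemma W_nonneg: "convex_body X \<Longrightarrow> 0 \<le> W X"
proof -
  assume X: "convex_body X"
  have "0 \<le> \<phi> (slice w X s)" for s
    using \<phi>_nonneg[OF flat_slice[OF X]] \<phi>_empty by (cases "slice w X s = {}") auto
  then show ?thesis using has_bochner_integral_nonneg[OF W_slices[OF X]] by blast
qed

lemma flat_if_width_0:
  assumes X: "convex_body X" and "hi w X = lo w X"
  shows "flat w X" "face_dir X w = X"
proof -
  have "x \<bullet> w = hi w X" if "x \<in> X" for x
    using supp_ge[OF X that, of w] supp_ge[OF X that, of "- w"] assms(2) by simp
  then show "flat w X" "face_dir X w = X" using X by (auto simp: flat_def face_dir_def)
qed

lemma lo_dilate: "convex_body X \<Longrightarrow> 0 \<le> c \<Longrightarrow> lo w (dilate c X) = c * lo w X"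
  and hi_dilate: "convex_body X \<Longrightarrow> 0 \<le> c \<Longrightarrow> hi w (dilate c X) = c * hi w X"
  by (simp_all add: supp_dilate)

text \<open>Adding a flat body \<open>A\<close> does not decrease \<phi> of the slices of
  \<open>B\<close>, so \<open>W B \<le> W (A + B)\<close>, and \<open>W A = 0\<close> leaves
  \<open>2 * V2 A B M\<close>. If neither body is flat, rescaling to equal width makes
  \<open>V2_ge\<close> applicable.\<close>

lemma V2_nonneg:
  assumes K: "convex_body K" and L: "convex_body L"
  shows "0 \<le> V2 K L M"
proof -
  consider "hi w K = lo w K" | "hi w L = lo w L" | "lo w K < hi w K" "lo w L < hi w L"
    using lo_le_hi[OF K, of w] lo_le_hi[OF L, of w] by linarith
  then show ?thesis
  proof cases
    have flat_case: "0 \<le> V2 A B M" if A: "flat w A" and B: "convex_body B" for A B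
    proof -
      have bA: "convex_body A" using A by (simp add: flat_def)
      obtain k where k: "\<And>x. x \<in> A \<Longrightarrow> x \<bullet> w = k" using A by (auto simp: flat_def)
      have "\<phi> (slice w B s) \<le> \<phi> (slice w (A + B) (k + s))" for s
      proof (cases "slice w B s = {}")
        case True
        have "0 \<le> \<phi> (slice w (A + B) (k + s))"
          using \<phi>_nonneg[OF flat_slice[OF convex_body_plus[OF bA B]]] \<phi>_empty
          by (cases "slice w (A + B) (k + s) = {}") auto
        then show ?thesis by (simp add: True \<phi>_empty)
      next
        case False
        have "A = slice w A k" using k by (auto simp: slice_def)
        then have sub: "A + slice w B s \<subseteq> slice w (A + B) (k + s)"
          using slice_plus_subset[of w A k B s] by simp
        moreover have "A + slice w B s \<noteq> {}"
          using flat_plus[OF A flat_slice[OF B False]] by (simp add: flat_def convex_body_def)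
        ultimately have "flat w (slice w (A + B) (k + s))"
          by (intro flat_slice convex_body_plus bA B) auto
        then have "\<phi> (A + slice w B s) \<le> \<phi> (slice w (A + B) (k + s))"
          by (rule \<phi>_mono[OF flat_plus[OF A flat_slice[OF B False]] _ sub])
        then show ?thesis using \<phi>_plus[OF A flat_slice[OF B False]] \<phi>_nonneg[OF A] by simp
      qed
      moreover have "has_bochner_integral lborel (\<lambda>s. \<phi> (slice w (A + B) (k + 1 * s))) (W (A + B) /\<^sub>R \<bar>1\<bar>)"
        using W_slices[OF convex_body_plus[OF bA B]] by (subst lborel_has_bochner_integral_real_affine_iff[symmetric]) auto
      ultimately have "W B \<le> W (A + B)"
        using has_bochner_integral_nonneg[OF has_bochner_integral_diff[OF _ W_slices[OF B]]] by fastforce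
      then show ?thesis using W_plus[OF bA B] mvk_flat[OF A, of 2] dim by simp
    qed
    {
      case 1
      then show ?thesis using flat_case[OF flat_if_width_0(1)[OF K] L] by simp
    next
      case 2
      then show ?thesis using flat_case[OF flat_if_width_0(1)[OF L] K] V2_commute[of K L] by simp
    next
      case 3
      define m where "m = (hi w K - lo w K) / (hi w L - lo w L)"
      have m: "0 < m" using 3 by (simp add: m_def)
      have "W K + W (dilate m L) \<le> 2 * V2 K (dilate m L) M"
      proof (rule V2_ge[OF K convex_body_dilate[OF L]])
        show "hi w K = lo w K + (hi w K - lo w K)" by simp
        have "m * (hi w L - lo w L) = hi w K - lo w K" using 3 by (simp add: m_def)
        then show "hi w (dilate m L) = lo w (dilate m L) + (hi w K - lo w K)"
          using m by (simp only: lo_dilate[OF L] hi_dilate[OF L] less_imp_le right_diff_distrib)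
      qed
      then have "0 \<le> m * V2 K L M"
        using W_nonneg[OF K] W_nonneg[OF convex_body_dilate[OF L, of m]] V2_dilate[OF K L] m by simp
      then show ?thesis using m by (simp add: zero_le_mult_iff)
    }
  qed
qed

text \<open>With \<open>c\<close> the factor in the statement, equality reads
  \<open>W K = c\<^sup>2 * W L\<close>. If \<open>K\<close> and \<open>dilate c L\<close> have equal
  width, this is the case of equality in \<open>V2_ge\<close>.\<close>

theorem equality_iff:
  assumes K: "convex_body K" and L: "convex_body L" and WL: "0 < W L"
  shows "(V2 K L M)\<^sup>2 = W K * W L \<longleftrightarrow> same_support K (dilate (V2 K L M / W L) L)"
proof -
  define c where "c = V2 K L M / W L"
  have c: "0 \<le> c" using V2_nonneg[OF K L] WL by (simp add: c_def)
  have VKL: "V2 K L M = c * W L" using WL by (simp add: c_def)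
  let ?Lt = "dilate c L"
  have bLt: "convex_body ?Lt" using L by (rule convex_body_dilate)
  have widthL: "lo w L < hi w L"
  proof (rule ccontr)
    assume "\<not> ?thesis"
    then have "flat w L" using lo_le_hi[OF L, of w] by (intro flat_if_width_0(1) L) simp
    then show False using mvk_flat[of L 2] dim WL by simp
  qed
  have wLt: "hi w ?Lt - lo w ?Lt = c * (hi w L - lo w L)"
    using c L by (simp add: supp_dilate algebra_simps)
  have VLt: "V2 K ?Lt M = c\<^sup>2 * W L" using V2_dilate[OF K L c] by (simp add: VKL power2_eq_square)
  have WLt: "W ?Lt = c\<^sup>2 * W L" using W_dilate[OF L c] .
  have equality: "(V2 K L M)\<^sup>2 = W K * W L \<longleftrightarrow> W K = c\<^sup>2 * W L"
    using WL by (auto simp: VKL power2_eq_square)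
  show ?thesis
  proof (cases "hi w K = lo w K")
    case True
    have WK: "W K = 0" using flat_if_width_0(1)[OF K True] dim by (simp add: mvk_flat)
    \<comment> \<open>For \<open>K\<close> of width zero \<open>W K = 0\<close>, so equality means
      \<open>c = 0\<close>. The support condition says the same, because \<open>L\<close> has
      positive width.\<close>
    have "same_support K ?Lt \<longleftrightarrow> c = 0"
    proof
      assume "same_support K ?Lt"
      then have "c * (hi w L - lo w L) = 0" using same_support_iff[OF K bLt] wLt True by simp
      then show "c = 0" using widthL by simp
    next
      assume "c = 0"
      then have "?Lt = {0}" using L by (auto simp: convex_body_def)
      moreover have "face_dir {0} w = {0}" by (auto simp: face_dir_def)
      ultimately show "same_support K ?Lt" using flat_if_width_0(2)[OF K True] by (simp add: same_support_def)
    qed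
    then show ?thesis using equality WK WL by (simp add: c_def[symmetric])
  next
    case False
    then have widthK: "lo w K < hi w K" using lo_le_hi[OF K, of w] by simp
    show ?thesis
      unfolding c_def[symmetric]
    proof
      assume eq: "(V2 K L M)\<^sup>2 = W K * W L"
      then have WK: "W K = c\<^sup>2 * W L" using equality by simp
      \<comment> \<open>The factor that gives \<open>L\<close> the width of \<open>K\<close>. The
        inequality for \<open>K\<close> and \<open>dilate m L\<close> becomes
        \<open>(c - m)\<^sup>2 * W L \<le> 0\<close>, so \<open>c\<close> has to be this
        factor.\<close>
      define m where "m = (hi w K - lo w K) / (hi w L - lo w L)"
      have m: "0 < m" using widthK widthL by (simp add: m_def)
      have mw: "m * (hi w L - lo w L) = hi w K - lo w K" using widthL by (simp add: m_def)
      have "W K + W (dilate m L) \<le> 2 * V2 K (dilate m L) M"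
      proof (rule V2_ge[OF K convex_body_dilate[OF L]])
        show "hi w K = lo w K + (hi w K - lo w K)" by simp
        show "hi w (dilate m L) = lo w (dilate m L) + (hi w K - lo w K)"
          using mw m by (simp only: lo_dilate[OF L] hi_dilate[OF L] less_imp_le right_diff_distrib)
      qed
      then have "c\<^sup>2 * W L + m\<^sup>2 * W L \<le> 2 * (m * (c * W L))"
        using W_dilate[OF L, of m] V2_dilate[OF K L, of m] m by (simp add: WK VKL)
      then have "(c - m)\<^sup>2 * W L \<le> 0" by (simp add: power2_eq_square algebra_simps)
      then have "c = m" using WL by (simp add: mult_le_0_iff)
      have w: "hi w ?Lt - lo w ?Lt = hi w K - lo w K" using wLt mw \<open>c = m\<close> by simp
      have "matching K ?Lt"
      proof (rule matching_if_equality[OF K bLt])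
        show "hi w K = lo w K + (hi w K - lo w K)" by simp
        show "hi w ?Lt = lo w ?Lt + (hi w K - lo w K)" using w by linarith
        show "0 < hi w K - lo w K" using widthK by simp
        show "2 * V2 K ?Lt M = W K + W ?Lt" by (simp add: VLt WK WLt)
      qed
      then show "same_support K ?Lt" using same_support_iff[OF K bLt] w by simp
    next
      assume "same_support K ?Lt"
      then have w: "hi w ?Lt - lo w ?Lt = hi w K - lo w K" and m: "matching K ?Lt"
        using same_support_iff[OF K bLt] by auto
      have "2 * V2 K ?Lt M = W K + W ?Lt"
      proof (rule equality_if_matching[OF K bLt _ _ m])
        show "hi w K = lo w K + (hi w K - lo w K)" by simp
        show "hi w ?Lt = lo w ?Lt + (hi w K - lo w K)" using w by linarith
      qed
      then have "W K = c\<^sup>2 * W L" by (simp add: VLt WLt)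
      then show "(V2 K L M)\<^sup>2 = W K * W L" using equality by simp
    qed
  qed
qed

end

subsection \<open>Extreme normal directions\<close>

lemma independent_3I:
  fixes a b c :: "'a::real_vector"
  assumes lin: "\<And>\<alpha> \<beta> \<gamma>. \<alpha> *\<^sub>R a + \<beta> *\<^sub>R b + \<gamma> *\<^sub>R c = 0 \<Longrightarrow> \<alpha> = 0 \<and> \<beta> = 0 \<and> \<gamma> = 0"
  shows "a \<noteq> b" "a \<noteq> c" "b \<noteq> c" "independent {a, b, c}"
proof -
  show ab: "a \<noteq> b" using lin[of 1 "-1" 0] by auto
  show ac: "a \<noteq> c" using lin[of 1 0 "-1"] by auto
  show bc: "b \<noteq> c" using lin[of 0 1 "-1"] by auto
  have "c \<noteq> 0" using lin[of 0 0 1] by auto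
  moreover have "b \<notin> span {c}"
  proof
    assume "b \<in> span {c}"
    then obtain k where "b = k *\<^sub>R c" by (auto simp: span_singleton)
    then show False using lin[of 0 1 "- k"] by simp
  qed
  moreover have "a \<notin> span {b, c}"
  proof
    assume "a \<in> span {b, c}"
    then obtain k m where "a - k *\<^sub>R b = m *\<^sub>R c" by (auto simp: span_breakdown_eq span_singleton)
    then show False using lin[of 1 "- k" "- m"] by (simp add: algebra_simps)
  qed
  ultimately show "independent {a, b, c}"
    using ab ac bc by (simp add: independent_insert)
qed

lemma not_independent_3:
  fixes u1 u2 u3 :: "'a::euclidean_space"
  assumes "u1 \<in> span {a, b}" "u2 \<in> span {a, b}" "u3 \<in> span {a, b}"
    and "u1 \<noteq> u2" "u1 \<noteq> u3" "u2 \<noteq> u3"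
  shows "\<not> independent {u1, u2, u3}"
proof
  assume "independent {u1, u2, u3}"
  then have "card {u1, u2, u3} \<le> card {a, b}"
    using independent_span_bound[of "{a, b}" "{u1, u2, u3}"] assms by auto
  also have "card {a, b} \<le> 2" by (simp add: card_insert_if)
  finally show False using assms by simp
qed

context flat_body
begin

lemma frontier_M: "frontier M = M"
proof -
  have "interior M \<subseteq> interior {x. w \<bullet> x = 0}" using Mw by (intro interior_mono) (auto simp: inner_commute)
  then have "interior M = {}" using interior_hyperplane[OF w0, of 0] by simp
  then show ?thesis using M by (simp add: frontier_def convex_body_def compact_imp_closed)
qed

lemma not_one_extremeI:
  assumes "normal_at M x u1" "normal_at M x u2" "normal_at M x u3" "u = u1 + u2 + u3"
    and "\<And>\<alpha> \<beta> \<gamma>. \<alpha> *\<^sub>R u1 + \<beta> *\<^sub>R u2 + \<gamma> *\<^sub>R u3 = 0 \<Longrightarrow> \<alpha> = 0 \<and> \<beta> = 0 \<and> \<gamma> = 0"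
  shows "\<not> one_extreme_normal M u"
proof -
  have "x \<in> frontier M" using assms(1) by (simp add: frontier_M normal_at_def)
  then have "\<exists>x\<in>frontier M. \<exists>u1 u2 u3. normal_at M x u1 \<and> normal_at M x u2 \<and> normal_at M x u3 \<and>
      u1 \<noteq> u2 \<and> u1 \<noteq> u3 \<and> u2 \<noteq> u3 \<and> independent {u1, u2, u3} \<and> u = u1 + u2 + u3"
    using assms(1-4) independent_3I[OF assms(5)] by (intro bexI[of _ x] exI conjI)
  then show ?thesis by (simp only: one_extreme_normal_def not_False_eq_True simp_thms)
qed

text \<open>Three vectors in a plane are dependent, so it suffices that all decompositions of
  \<open>u\<close> stay in the span of two vectors.\<close>

lemma one_extremeI:
  assumes "u \<noteq> 0"
    and "\<And>x u1 u2 u3. normal_at M x u1 \<Longrightarrow> normal_at M x u2 \<Longrightarrow> normal_at M x u3 \<Longrightarrow> u = u1 + u2 + u3 \<Longrightarrow>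
      u1 \<in> span {a, b} \<and> u2 \<in> span {a, b} \<and> u3 \<in> span {a, b}"
  shows "one_extreme_normal M u"
  unfolding one_extreme_normal_def using assms not_independent_3[of _ a b] by blast

end

context full_flat_body
begin

lemma zero_if_support_0:
  assumes p: "p \<bullet> w = 0" and le: "\<And>y. y \<in> M \<Longrightarrow> y \<bullet> p \<le> 0"
  shows "p = 0"
proof (rule ccontr)
  assume "p \<noteq> 0"
  then have "(r / norm p) *\<^sub>R p \<in> M" using p r by (intro rM) auto
  then have "((r / norm p) *\<^sub>R p) \<bullet> p \<le> 0" by (rule le)
  moreover have "0 < ((r / norm p) *\<^sub>R p) \<bullet> p" using \<open>p \<noteq> 0\<close> r by simp
  ultimately show False by simp
qed

text \<open>After normalisation both summands are points of the polar body with \<open>v\<close> as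
  a convex combination, so extremality identifies them with \<open>v\<close>. A zero bound makes the
  summand itself zero, as \<open>M\<close> contains a relative ball about the origin.\<close>

lemma extreme_summand:
  assumes p: "p \<bullet> w = 0" "p' \<bullet> w = 0" and le: "\<And>y. y \<in> M \<Longrightarrow> y \<bullet> p \<le> a" "\<And>y. y \<in> M \<Longrightarrow> y \<bullet> p' \<le> a'"
    and a: "a + a' \<le> c" and sum: "p + p' = c *\<^sub>R v" and v: "v \<in> E"
  shows "\<exists>k. p = k *\<^sub>R v"
proof -
  have a0: "0 \<le> a" "0 \<le> a'" using le[OF zero_M] by auto
  consider "a = 0" | "a' = 0" | "0 < a" "0 < a'" using a0 by linarith
  then show ?thesis
  proof cases
    case 1
    then have "p = 0" using zero_if_support_0[OF p(1)] le(1) by simp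
    then show ?thesis by (intro exI[of _ 0]) simp
  next
    case 2
    then have "p' = 0" using zero_if_support_0[OF p(2)] le(2) by simp
    then show ?thesis using sum by auto
  next
    case 3
    then have c: "a < c" "0 < c" "a' \<le> c - a" using a by linarith+
    \<comment> \<open>Dividing \<open>p'\<close> by \<open>c - a\<close> makes the coefficients
      \<open>a / c\<close> and \<open>1 - a / c\<close> add up to one; \<open>z'\<close> is in
      \<open>D\<close> because \<open>a' \<le> c - a\<close>.\<close>
    define z z' where "z = (1 / a) *\<^sub>R p" and "z' = (1 / (c - a)) *\<^sub>R p'"
    have "z \<in> D" using p le 3 by (simp add: D_def z_def divide_le_eq)
    moreover have "z' \<in> D"
    proof -
      have "y \<bullet> p' \<le> c - a" if "y \<in> M" for y using le(2)[OF that] c by simp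
      then show ?thesis using p c by (simp add: D_def z'_def divide_le_eq)
    qed
    moreover have "v = (1 - a / c) *\<^sub>R z' + (a / c) *\<^sub>R z"
    proof -
      have "(1 - a / c) *\<^sub>R z' = (1 / c) *\<^sub>R p'"
        using c by (simp add: z'_def field_simps)
      moreover have "(a / c) *\<^sub>R z = (1 / c) *\<^sub>R p" using 3 by (simp add: z_def)
      ultimately have "(1 - a / c) *\<^sub>R z' + (a / c) *\<^sub>R z = (1 / c) *\<^sub>R (p + p')" by (simp add: scaleR_add_right)
      then show ?thesis using c by (simp add: sum)
    qed
    moreover have "0 < a / c" "a / c < 1" using 3 c by auto
    ultimately have seg: "v \<in> open_segment z' z" if "z' \<noteq> z"
      using that by (auto simp: in_segment intro!: exI[of _ "a / c"])
    have "v \<notin> open_segment z' z"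
      using v \<open>z \<in> D\<close> \<open>z' \<in> D\<close> by (simp add: E_def extreme_point_of_def)
    then have "z = z'" using seg by blast
    then have "v = z" using \<open>v = (1 - a / c) *\<^sub>R z' + (a / c) *\<^sub>R z\<close> by (simp add: scaleR_add_left[symmetric])
    then show ?thesis using 3 by (intro exI[of _ a]) (simp add: z_def)
  qed
qed

text \<open>Multiples of \<open>w\<close> can be added to normals freely, so the projection to the
  hyperplane decides. If its normalisation is inside a segment of the polar body, the end points and
  \<open>w\<close> supply three independent normals; if it is extreme, all summands project to
  multiples of it.\<close>

lemma one_extreme_iff:
  "one_extreme_normal M u \<longleftrightarrow> u \<noteq> 0 \<and> (\<exists>c\<ge>0. \<exists>q. \<exists>v\<in>E. u = c *\<^sub>R v + q *\<^sub>R w)"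
proof
  assume ext: "one_extreme_normal M u"
  have E0: "E \<noteq> {}" using D_hull zero_D by auto
  define p where "p = u - (u \<bullet> w) *\<^sub>R w"
  have u: "u = p + (u \<bullet> w) *\<^sub>R w" by (simp add: p_def)
  have pw: "p \<bullet> w = 0" by (simp add: p_def proj_w)
  have "\<exists>c\<ge>0. \<exists>q. \<exists>v\<in>E. u = c *\<^sub>R v + q *\<^sub>R w"
  proof (cases "p = 0")
    case True
    then have "u = 0 *\<^sub>R v + (u \<bullet> w) *\<^sub>R w" for v using u by simp
    then show ?thesis using E0 by blast
  next
    case False
    define m where "m = supp M p"
    have m: "0 < m"
    proof (rule ccontr)
      assume "\<not> 0 < m"
      then have "y \<bullet> p \<le> 0" if "y \<in> M" for y using supp_ge[OF M that, of p] by (simp add: m_def)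
      then show False using zero_if_support_0[OF pw] False by blast
    qed
    define v where "v = (1 / m) *\<^sub>R p"
    have pv: "p = m *\<^sub>R v" using m by (simp add: v_def)
    have vD: "v \<in> D" using pw m supp_ge[OF M, of _ p] by (simp add: D_def v_def m_def divide_le_eq)
    have "v \<in> E"
    proof (rule ccontr)
      assume "v \<notin> E"
      then obtain a b where ab: "a \<in> D" "b \<in> D" "v \<in> open_segment a b"
        using vD by (auto simp: E_def extreme_point_of_def)
      then obtain t where t: "0 < t" "t < 1" "a \<noteq> b" "v = (1 - t) *\<^sub>R a + t *\<^sub>R b" by (auto simp: in_segment)
      obtain x where x: "x \<in> M" "x \<bullet> p = m" using supp_attained[OF M] unfolding m_def by metis
      have xv: "x \<bullet> v = 1" using x m by (simp add: v_def)
      have le: "x \<bullet> a \<le> 1" "x \<bullet> b \<le> 1" using ab x by (auto simp: D_def)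
      have "(1 - t) * (x \<bullet> a) + t * (x \<bullet> b) = 1" using xv t(4) by (simp add: inner_add_right)
      \<comment> \<open>Two numbers that are at most one have a proper convex combination equal to
        one only if both are one; so \<open>a\<close> and \<open>b\<close> are normals at
        \<open>x\<close>.\<close>
      then have xab: "x \<bullet> a = 1" "x \<bullet> b = 1"
      proof -
        assume e: "(1 - t) * (x \<bullet> a) + t * (x \<bullet> b) = 1"
        have nn: "0 \<le> (1 - t) * (1 - x \<bullet> a)" "0 \<le> t * (1 - x \<bullet> b)" using le t by simp_all
        have "(1 - t) * (1 - x \<bullet> a) + t * (1 - x \<bullet> b) = 0" using e by (simp add: algebra_simps)
        then have "(1 - t) * (1 - x \<bullet> a) = 0 \<and> t * (1 - x \<bullet> b) = 0"
          using add_nonneg_eq_0_iff[OF nn] by simp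
        then show "x \<bullet> a = 1" "x \<bullet> b = 1" using t by auto
      qed
      have abw: "a \<bullet> w = 0" "b \<bullet> w = 0" "\<And>y. y \<in> M \<Longrightarrow> y \<bullet> a \<le> 1" "\<And>y. y \<in> M \<Longrightarrow> y \<bullet> b \<le> 1"
        using ab by (auto simp: D_def)
      define q where "q = u \<bullet> w"
      \<comment> \<open>The projection of \<open>u\<close> is split along \<open>a\<close> and
        \<open>b\<close>. The first summand also takes up \<open>q - 1\<close> copies of
        \<open>w\<close>, so that \<open>w\<close> itself can be the third normal.\<close>
      define k1 k2 where "k1 = m * (1 - t)" and "k2 = m * t"
      have k: "0 < k1" "0 < k2" using m t by (auto simp: k1_def k2_def)
      have "\<not> one_extreme_normal M u"
      proof (rule not_one_extremeI[of x "k1 *\<^sub>R a + (q - 1) *\<^sub>R w" "k2 *\<^sub>R b" w])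
        have "k1 *\<^sub>R a + (q - 1) *\<^sub>R w \<noteq> 0"
        proof
          assume "k1 *\<^sub>R a + (q - 1) *\<^sub>R w = 0"
          then have "x \<bullet> (k1 *\<^sub>R a + (q - 1) *\<^sub>R w) = 0" by simp
          then show False using xab k Mw[OF x(1)] by (simp add: inner_add_right)
        qed
        then show "normal_at M x (k1 *\<^sub>R a + (q - 1) *\<^sub>R w)"
          using x xab abw k Mw by (simp add: normal_at_def inner_add_right)
        have "b \<noteq> 0" using xab by auto
        then show "normal_at M x (k2 *\<^sub>R b)"
          using x xab abw k by (simp add: normal_at_def)
        show "normal_at M x w" using x Mw w0 by (simp add: normal_at_def)
        show "u = k1 *\<^sub>R a + (q - 1) *\<^sub>R w + k2 *\<^sub>R b + w"
          by (subst u) (simp add: pv t(4) k1_def k2_def q_def algebra_simps)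
        fix \<alpha> \<beta> \<gamma> assume eq: "\<alpha> *\<^sub>R (k1 *\<^sub>R a + (q - 1) *\<^sub>R w) + \<beta> *\<^sub>R (k2 *\<^sub>R b) + \<gamma> *\<^sub>R w = 0"
        then have "x \<bullet> (\<alpha> *\<^sub>R (k1 *\<^sub>R a + (q - 1) *\<^sub>R w) + \<beta> *\<^sub>R (k2 *\<^sub>R b) + \<gamma> *\<^sub>R w) = 0" by simp
        then have s: "\<beta> * k2 = - (\<alpha> * k1)" using xab Mw[OF x(1)] by (simp add: inner_add_right)
        have g: "\<alpha> * (q - 1) + \<gamma> = 0"
          using arg_cong[OF eq, of "\<lambda>z. z \<bullet> w"] abw ww by (simp add: inner_add_left)
        have "(\<alpha> * k1) *\<^sub>R a + (\<beta> * k2) *\<^sub>R b + (\<alpha> * (q - 1) + \<gamma>) *\<^sub>R w = 0" using eq by (simp add: algebra_simps)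
        then have "(\<alpha> * k1) *\<^sub>R (a - b) = 0" by (simp add: s g scaleR_diff_right)
        then have "\<alpha> = 0" using t(3) k by simp
        then show "\<alpha> = 0 \<and> \<beta> = 0 \<and> \<gamma> = 0" using s g k by simp
      qed
      then show False using ext by blast
    qed
    then show ?thesis using m u pv by (intro exI[of _ m]) auto
  qed
  then show "u \<noteq> 0 \<and> (\<exists>c\<ge>0. \<exists>q. \<exists>v\<in>E. u = c *\<^sub>R v + q *\<^sub>R w)"
    using ext by (simp add: one_extreme_normal_def)
next
  assume a: "u \<noteq> 0 \<and> (\<exists>c\<ge>0. \<exists>q. \<exists>v\<in>E. u = c *\<^sub>R v + q *\<^sub>R w)"
  then obtain c q v where u: "u \<noteq> 0" "0 \<le> c" "v \<in> E" "u = c *\<^sub>R v + q *\<^sub>R w" by blast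
  have vD: "v \<in> D" using u(3) by (rule E_D)
  have vw: "v \<bullet> w = 0" using vD by (simp add: D_def)
  have span: "u1 \<in> span {v, w}"
    if n: "normal_at M x u1" "normal_at M x u2" "normal_at M x u3" and s: "u = u1 + u2 + u3" for x u1 u2 u3
  proof -
    define p where "p z = z - (z \<bullet> w) *\<^sub>R w" for z
    have pw: "p z \<bullet> w = 0" for z by (simp add: p_def proj_w)
    have yp: "y \<bullet> p z = y \<bullet> z" if "y \<in> M" for y z using inner_proj[OF Mw[OF that]] by (simp add: p_def)
    have x: "x \<in> M" using n by (simp add: normal_at_def)
    have "p u1 + (p u2 + p u3) = p u" by (simp add: p_def s inner_add_left algebra_simps)
    also have "p u = c *\<^sub>R v" using vw ww by (simp add: p_def u(4) inner_add_left)
    finally have sum: "p u1 + (p u2 + p u3) = c *\<^sub>R v" .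
    have "\<exists>k. p u1 = k *\<^sub>R v"
    proof (rule extreme_summand[OF _ _ _ _ _ sum u(3)])
      show "p u1 \<bullet> w = 0" "(p u2 + p u3) \<bullet> w = 0" using pw by (simp_all add: inner_add_left)
      show "y \<bullet> p u1 \<le> x \<bullet> p u1" if "y \<in> M" for y using n(1) that x by (simp add: yp normal_at_def)
      show "y \<bullet> (p u2 + p u3) \<le> x \<bullet> (p u2 + p u3)" if "y \<in> M" for y
        using n(2,3) that x by (auto simp: yp normal_at_def inner_add_right intro: add_mono)
      have "x \<bullet> p u1 + x \<bullet> (p u2 + p u3) = c * (x \<bullet> v)"
        using arg_cong[OF sum, of "\<lambda>z. x \<bullet> z"] by (simp add: inner_add_right)
      also have "\<dots> \<le> c" using vD x u(2) by (simp add: D_def mult_left_le)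
      finally show "x \<bullet> p u1 + x \<bullet> (p u2 + p u3) \<le> c" .
    qed
    then obtain k where "u1 = k *\<^sub>R v + (u1 \<bullet> w) *\<^sub>R w" by (auto simp: p_def algebra_simps)
    moreover have "k *\<^sub>R v + (u1 \<bullet> w) *\<^sub>R w \<in> span {v, w}"
      by (intro span_add span_scale span_base) auto
    ultimately show ?thesis by simp
  qed
  show "one_extreme_normal M u"
  proof (rule one_extremeI[of u v w])
    fix x u1 u2 u3
    assume n: "normal_at M x u1" "normal_at M x u2" "normal_at M x u3" and s: "u = u1 + u2 + u3"
    show "u1 \<in> span {v, w} \<and> u2 \<in> span {v, w} \<and> u3 \<in> span {v, w}"
      using span[OF n s] span[OF n(2,1,3)] span[OF n(3,1,2)] s by (simp add: add_ac)
  qed (rule u(1))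
qed

lemma normals_E: "normals M w E"
proof unfold_locales
  show "v \<bullet> w = 0" if "v \<in> E" for v using E_D[OF that] by (simp add: D_def)
  show "E \<noteq> {}" using D_hull zero_D by auto
qed (fact \<phi>_eq_if_supp_eq \<phi>_less_if_supp_less one_extreme_iff)+

end

context flat_body_2
begin

text \<open>\<phi> is a positive multiple of the width along \<open>e\<close>, which grows strictly
  with the support in either of the directions \<open>e\<close> and \<open>- e\<close>.\<close>

lemma normals_line:
  assumes pos: "0 < \<phi> (seg e)" and zero: "0 \<in> M"
  shows "normals M w {e, - e}"
proof unfold_locales
  show "v \<bullet> w = 0" if "v \<in> {e, - e}" for v using that e by auto
  show "{e, - e} \<noteq> {}" by simp
  show "\<phi> A = \<phi> B" if "flat w A" "flat w B" "A \<subseteq> B" "\<And>v. v \<in> {e, - e} \<Longrightarrow> supp A v = supp B v" for A B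
    using that by (simp add: \<phi>_width)
  show "\<phi> A < \<phi> B" if AB: "flat w A" "flat w B" "A \<subseteq> B" and v: "v \<in> {e, - e}" "supp A v < supp B v" for A B v
  proof -
    have "supp A u \<le> supp B u" for u using AB by (intro supp_mono) (auto simp: flat_def)
    from this[of e] this[of "- e"] have "supp A e + supp A (- e) < supp B e + supp B (- e)" using v by auto
    then show ?thesis using pos AB by (simp add: \<phi>_width[of A] \<phi>_width[of B])
  qed
  \<comment> \<open>The component of such a \<open>u\<close> outside the plane would be a third
    direction orthogonal to \<open>M\<close>, and \<phi> would vanish.\<close>
  have span_e: "u \<in> span {e, w}" if "\<And>y. y \<in> M \<Longrightarrow> y \<bullet> u = 0" for u
  proof (rule ccontr)
    assume u: "u \<notin> span {e, w}"
    define g where "g = u - (u \<bullet> e) *\<^sub>R e - (u \<bullet> w) *\<^sub>R w"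
    have "g \<noteq> 0"
    proof
      assume "g = 0"
      moreover have "g + ((u \<bullet> e) *\<^sub>R e + (u \<bullet> w) *\<^sub>R w) = u" by (simp add: g_def)
      ultimately have "u = (u \<bullet> e) *\<^sub>R e + (u \<bullet> w) *\<^sub>R w" by (metis add_0)
      moreover have "(u \<bullet> e) *\<^sub>R e + (u \<bullet> w) *\<^sub>R w \<in> span {e, w}" by (intro span_add span_scale span_base) auto
      ultimately show False using u by simp
    qed
    have ew: "w \<bullet> e = 0" using e by (simp add: inner_commute)
    have g: "g \<bullet> w = 0" "g \<bullet> e = 0" "y \<bullet> g = 0" if "y \<in> M" for y
      using that \<open>\<And>y. y \<in> M \<Longrightarrow> y \<bullet> u = 0\<close> Mw Me
      by (simp_all add: g_def inner_diff_left inner_diff_right ww ee e ew)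
    interpret F: flat_body_3 M w e "(1 / norm g) *\<^sub>R g"
      using \<open>g \<noteq> 0\<close> g[OF zero] g(3) by unfold_locales auto
    have "\<phi> (seg e) = 0" using e by (intro F.\<phi>_zero flat_seg)
    then show False using pos by simp
  qed
  show "one_extreme_normal M u \<longleftrightarrow> u \<noteq> 0 \<and> (\<exists>c\<ge>0. \<exists>q. \<exists>v\<in>{e, - e}. u = c *\<^sub>R v + q *\<^sub>R w)" for u
  proof
    assume ext: "one_extreme_normal M u"
    define p where "p = u - (u \<bullet> e) *\<^sub>R e - (u \<bullet> w) *\<^sub>R w"
    have ew: "w \<bullet> e = 0" using e by (simp add: inner_commute)
    have p: "p \<bullet> w = 0" "p \<bullet> e = 0" by (simp_all add: p_def inner_diff_left ww ee e ew)
    have u: "u = p + (u \<bullet> e) *\<^sub>R e + (u \<bullet> w) *\<^sub>R w" by (simp add: p_def)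
    have "p = 0"
    proof (rule ccontr)
      assume "p \<noteq> 0"
      have "w \<bullet> p = 0" "e \<bullet> p = 0" using p by (simp_all add: inner_commute)
      obtain x where x: "x \<in> M" "\<And>y. y \<in> M \<Longrightarrow> y \<bullet> u \<le> x \<bullet> u" using supp_attained[OF M] by metis
      \<comment> \<open>Both \<open>e\<close> and \<open>w\<close> are constant on \<open>M\<close>,
        hence normals at every point, and subtracting them from \<open>u\<close> leaves a normal at
        \<open>x\<close>.\<close>
      have "\<not> one_extreme_normal M u"
      proof (rule not_one_extremeI[of x "u - e - w" e w])
        have up: "u \<bullet> p = p \<bullet> p"
          by (subst u) (simp add: inner_add_left \<open>w \<bullet> p = 0\<close> \<open>e \<bullet> p = 0\<close>)
        have "u - e - w \<noteq> 0"
        proof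
          assume "u - e - w = 0"
          then have "(u - e - w) \<bullet> p = 0" by simp
          then show False using up \<open>p \<noteq> 0\<close> by (simp add: inner_diff_left \<open>w \<bullet> p = 0\<close> \<open>e \<bullet> p = 0\<close>)
        qed
        then show "normal_at M x (u - e - w)"
          using x Mw Me by (simp add: normal_at_def inner_diff_right)
        have "e \<noteq> 0" using ee by auto
        then show "normal_at M x e" using x Me by (simp add: normal_at_def)
        show "normal_at M x w" using x Mw w0 by (simp add: normal_at_def)
        show "u = u - e - w + e + w" by simp
        fix \<alpha> \<beta> \<gamma> assume eq: "\<alpha> *\<^sub>R (u - e - w) + \<beta> *\<^sub>R e + \<gamma> *\<^sub>R w = 0"
        have "(\<alpha> *\<^sub>R (u - e - w) + \<beta> *\<^sub>R e + \<gamma> *\<^sub>R w) \<bullet> p = 0" by (simp add: eq)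
        then have "\<alpha> = 0"
          using up \<open>p \<noteq> 0\<close> by (simp add: inner_diff_left inner_add_left \<open>w \<bullet> p = 0\<close> \<open>e \<bullet> p = 0\<close>)
        moreover have "(\<alpha> *\<^sub>R (u - e - w) + \<beta> *\<^sub>R e + \<gamma> *\<^sub>R w) \<bullet> e = 0"
          "(\<alpha> *\<^sub>R (u - e - w) + \<beta> *\<^sub>R e + \<gamma> *\<^sub>R w) \<bullet> w = 0" by (simp_all add: eq)
        ultimately show "\<alpha> = 0 \<and> \<beta> = 0 \<and> \<gamma> = 0" using e ew ee ww by (simp add: inner_add_left)
      qed
      then show False using ext by blast
    qed
    then have "u = (u \<bullet> e) *\<^sub>R e + (u \<bullet> w) *\<^sub>R w" using u by simp
    then have "\<exists>c\<ge>0. \<exists>q. \<exists>v\<in>{e, - e}. u = c *\<^sub>R v + q *\<^sub>R w"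
    proof (cases "0 \<le> u \<bullet> e")
      case True
      then show ?thesis using \<open>u = (u \<bullet> e) *\<^sub>R e + (u \<bullet> w) *\<^sub>R w\<close> by blast
    next
      case False
      have "u = (- (u \<bullet> e)) *\<^sub>R (- e) + (u \<bullet> w) *\<^sub>R w" using \<open>u = (u \<bullet> e) *\<^sub>R e + (u \<bullet> w) *\<^sub>R w\<close> by simp
      moreover have "0 \<le> - (u \<bullet> e)" using False by simp
      ultimately show ?thesis by blast
    qed
    then show "u \<noteq> 0 \<and> (\<exists>c\<ge>0. \<exists>q. \<exists>v\<in>{e, - e}. u = c *\<^sub>R v + q *\<^sub>R w)"
      using ext by (simp add: one_extreme_normal_def)
  next
    assume a: "u \<noteq> 0 \<and> (\<exists>c\<ge>0. \<exists>q. \<exists>v\<in>{e, - e}. u = c *\<^sub>R v + q *\<^sub>R w)"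
    then have yu: "y \<bullet> u = 0" if "y \<in> M" for y using Mw[OF that] Me[OF that] by (auto simp: inner_add_right inner_diff_right)
    show "one_extreme_normal M u"
    proof (rule one_extremeI[of u e w])
      show "u \<noteq> 0" using a by blast
      fix x u1 u2 u3
      assume n: "normal_at M x u1" "normal_at M x u2" "normal_at M x u3" and s: "u = u1 + u2 + u3"
      have x: "x \<in> M" using n by (simp add: normal_at_def)
      \<comment> \<open>The sum of the three is zero on \<open>M\<close> and each of them is largest
        at \<open>x\<close>, so each is constant on \<open>M\<close>.\<close>
      have eq: "y \<bullet> u1 = x \<bullet> u1 \<and> y \<bullet> u2 = x \<bullet> u2 \<and> y \<bullet> u3 = x \<bullet> u3" if y: "y \<in> M" for y
      proof -
        have "y \<bullet> u1 + y \<bullet> u2 + y \<bullet> u3 = 0" "x \<bullet> u1 + x \<bullet> u2 + x \<bullet> u3 = 0"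
          using yu[OF y] yu[OF x] by (simp_all add: s inner_add_right)
        moreover have "y \<bullet> u1 \<le> x \<bullet> u1" "y \<bullet> u2 \<le> x \<bullet> u2" "y \<bullet> u3 \<le> x \<bullet> u3" using n y by (auto simp: normal_at_def)
        ultimately show ?thesis by linarith
      qed
      have "x \<bullet> u1 = 0" "x \<bullet> u2 = 0" "x \<bullet> u3 = 0" using eq[OF zero] by auto
      then show "u1 \<in> span {e, w} \<and> u2 \<in> span {e, w} \<and> u3 \<in> span {e, w}"
        using eq by (intro conjI span_e) auto
    qed
  qed
qed

end

section \<open>Translation invariance and conclusion\<close>

lemma V2_translation:
  fixes K L M :: "(real^'n) set"
  assumes "convex_body K" "convex_body L" "convex_body M" "2 \<le> CARD('n)"
  shows "V2 K L ((+) a ` M) = V2 K L M"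
proof -
  let ?l = "\<lambda>M. K # L # replicate (CARD('n) - 2) M"
  have b: "bodies (?l X)" if "convex_body X" for X
    using that assms by (auto simp: bodies_def)
  \<comment> \<open>Positions \<open>0\<close> and \<open>1\<close> hold \<open>K\<close> and
    \<open>L\<close>, which stay fixed; the copies of \<open>M\<close> start at position
    \<open>2\<close>.\<close>
  have nth: "?l ((+) a ` M) ! coord j = (+) (if coord j < 2 then 0 else a) ` (?l M ! coord j)" for j :: 'n
  proof -
    consider "coord j = 0" | "coord j = 1" | i where "coord j = Suc (Suc i)" by (metis One_nat_def old.nat.exhaust)
    then show ?thesis
    proof cases
      case 3
      moreover have "i < CARD('n) - 2" using coord_less[of j] 3 by simp
      ultimately show ?thesis by simp
    qed simp_all
  qed
  have "polar (\<lambda>j :: 'n. ?l ((+) a ` M) ! coord j) = polar (\<lambda>j :: 'n. ?l M ! coord j)"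
    unfolding nth by (rule polar_translation)
  then show ?thesis
    using b[OF assms(3)] b[OF convex_body_translation[OF assms(3), of a]]
    by (simp add: V2_def mixed_volume_eq_mvol mvol_def)
qed

lemma one_extreme_normal_translation: "one_extreme_normal ((+) a ` M) u = one_extreme_normal M u"
proof -
  have n: "normal_at ((+) a ` M) (a + x) u \<longleftrightarrow> normal_at M x u" for x u
    by (auto simp: normal_at_def inner_add_left)
  have "frontier ((+) a ` M) = (+) a ` frontier M" by (rule frontier_translation)
  then show ?thesis unfolding one_extreme_normal_def by (simp add: n)
qed

text \<open>If \<open>M\<close> does not span the hyperplane, there is a unit vector
  \<open>e\<close> orthogonal to \<open>M\<close> and \<open>w\<close>. By
  \<open>\<phi>_width\<close> every slice of \<open>L\<close> has a multiple of
  \<open>\<phi> (seg e)\<close> as its value, so \<open>V2 L L M > 0\<close> makes this number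
  positive.\<close>

lemma exists_normals:
  fixes M L :: "(real^'n) set"
  assumes dim: "3 \<le> CARD('n)" and M: "convex_body M" and w: "norm w = 1"
    and Mw: "\<And>x. x \<in> M \<Longrightarrow> x \<bullet> w = 0" and zero: "0 \<in> rel_interior M"
    and L: "convex_body L" and pos: "0 < V2 L L M"
  shows "\<exists>E. normals M w E"
proof -
  interpret flat_body M w using dim M w Mw by unfold_locales
  have zM: "0 \<in> M" using zero rel_interior_subset by blast
  let ?T = "{x. x \<bullet> w = 0}"
  have T: "subspace ?T" by (auto simp: subspace_def inner_add_left)
  have sub: "span M \<subseteq> ?T" using Mw by (intro span_minimal T) auto
  show ?thesis
  proof (cases "span M = ?T")
    case True
    have "affine hull M = span M" using affine_hull_span_0 zM hull_inc by metis
    then obtain d where d: "0 < d" "ball 0 d \<inter> ?T \<subseteq> M"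
      using zero True by (auto simp: mem_rel_interior_ball)
    interpret full_flat_body M w "d / 2"
      using d by unfold_locales auto
    show ?thesis using normals_E by blast
  next
    case False
    then have "span M \<subset> span ?T" using sub T by (simp add: span_eq_iff[THEN iffD2] psubset_eq)
    then obtain z where z: "z \<noteq> 0" "z \<in> span ?T" "\<And>y. y \<in> span M \<Longrightarrow> orthogonal z y"
      using orthogonal_to_subspace_exists_gen by metis
    define e where "e = (1 / norm z) *\<^sub>R z"
    have zT: "z \<bullet> w = 0" using z(2) T by (simp add: span_eq_iff[THEN iffD2])
    interpret flat_body_2 M w e
      using z zT span_base[of _ M] by unfold_locales (auto simp: e_def orthogonal_def inner_commute)
    have "0 < \<phi> (seg e)"
    proof (rule ccontr)
      have se: "flat w (seg e)" using e by (intro flat_seg)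
      assume "\<not> ?thesis"
      then have "\<phi> (seg e) = 0" using \<phi>_nonneg[OF se] by simp
      then have "\<phi> (slice w L s) = 0" for s
        using \<phi>_width[OF flat_slice[OF L]] \<phi>_empty by (cases "slice w L s = {}") auto
      then have "has_bochner_integral lborel (\<lambda>s::real. 0) (W L)" using W_slices[OF L] by simp
      then have "W L = 0" using has_bochner_integral_eq has_bochner_integral_zero by blast
      then show False using pos by (simp add: V2_self)
    qed
    then show ?thesis using normals_line zM by blast
  qed
qed

theorem theorem2p3:
  fixes M K L :: "(real ^ 'n) set" and w :: "real ^ 'n"
  assumes "CARD('n) \<ge> 3"
    and "convex_body M" and "interior M = {}"
    and "norm w = 1" and "\<forall>x\<in>M. \<forall>y\<in>M. inner (x - y) w = 0"
    and "convex_body K" and "convex_body L"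
    and "V2 L L M > 0"
  shows "(V2 K L M)\<^sup>2 = V2 K K M * V2 L L M \<longleftrightarrow>
    (let Lt = (\<lambda>x. (V2 K L M / V2 L L M) *\<^sub>R x) ` L in
       \<forall>u. one_extreme_normal M u \<longrightarrow>
         supp_hyperplane (K + face_dir Lt w) u = supp_hyperplane (Lt + face_dir K w) u)"
proof -
  have "rel_interior M \<noteq> {}" using assms(2) by (simp add: convex_body_def rel_interior_eq_empty)
  then obtain c where c: "c \<in> rel_interior M" by blast
  then have cM: "c \<in> M" using rel_interior_subset by blast
  \<comment> \<open>Moving a relative interior point to the origin puts \<open>M\<close> into the
    hyperplane through the origin and, if it spans that hyperplane, provides the ball that keeps the
    polar body bounded.\<close>
  define M0 where "M0 = (+) (- c) ` M"
  have bM0: "convex_body M0" unfolding M0_def by (rule convex_body_translation[OF assms(2)])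
  have M0w: "x \<bullet> w = 0" if x: "x \<in> M0" for x
  proof -
    obtain m where "m \<in> M" "x = m - c" using x by (auto simp: M0_def)
    then show ?thesis using assms(5) cM by auto
  qed
  have z: "0 \<in> rel_interior M0"
  proof -
    have "rel_interior M0 = (+) (- c) ` rel_interior M"
      unfolding M0_def by (rule rel_interior_translation)
    moreover have "- c + c \<in> (+) (- c) ` rel_interior M" using c by blast
    ultimately show ?thesis by simp
  qed
  have V2: "V2 A B M0 = V2 A B M" if "convex_body A" "convex_body B" for A B
    unfolding M0_def by (rule V2_translation[OF that assms(2)]) (use assms(1) in simp)
  obtain E where "normals M0 w E"
    using exists_normals[OF assms(1) bM0 assms(4) M0w z assms(7)] assms(7,8) by (auto simp: V2)
  then interpret normals M0 w E .
  have ext: "one_extreme_normal M0 u = one_extreme_normal M u" for u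
    unfolding M0_def by (rule one_extreme_normal_translation)
  let ?Lt = "dilate (V2 K L M / V2 L L M) L"
  have bLt: "convex_body ?Lt" using assms(7) by (rule convex_body_dilate)
  have WM: "mvk M0 2 A = V2 A A M" if "convex_body A" for A
    using V2[OF that that] by (simp add: V2_self)
  have "(V2 K L M)\<^sup>2 = V2 K K M * V2 L L M \<longleftrightarrow> same_support K ?Lt"
    using equality_iff[OF assms(6,7)] assms(6,7,8) by (simp add: WM V2)
  also have "\<dots> \<longleftrightarrow> (\<forall>u. one_extreme_normal M u \<longrightarrow>
      supp_hyperplane (K + face_dir ?Lt w) u = supp_hyperplane (?Lt + face_dir K w) u)"
    using assms(6) bLt
    by (simp add: same_support_def ext supp_hyperplane_eq_iff
        convex_body_plus convex_body_face)
  finally show ?thesis by (simp only: Let_def)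
qed

end
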